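(* Let $\Omega$ be a non-contractible $n$-dimensional manifold with sufficiently smooth Lipschitz boundary. Let $H\Lambda_h^{(k)}(\Omega)\subset H\widetilde{\Lambda}_h^{(k)}(\Omega)\subset H\Lambda^{(k)}(\Omega)$, $0\le k\le n$, be finite-dimensional subspaces such that both $H\Lambda_h^{(\bullet)}(\Omega)$ and $H\widetilde{\Lambda}_h^{(\bullet)}(\Omega)$ are de Rham subcomplexes of $H\Lambda^{(\bullet)}(\Omega)$. Assume that the enriched complex $H\widetilde{\Lambda}_h^{(\bullet)}(\Omega)$ is topologically conforming, i.e. $\mathrm{gap}\bigl(\mathcal H^{(k)},\widetilde{\mathcal H}_h^{(k)}\bigr)=0$ for all $k$. Let $\Pi^{(k)}:H\Lambda^{(k)}(\Omega)\to H\widetilde{\Lambda}_h^{(k)}(\Omega)$ be the projector defined by the augmented mixed system (given in the context) posed on the enriched spaces, and let $\Pi_{\mathscr C}^{(k)}:H\widetilde{\Lambda}_h^{(k)}(\Omega)\to H\Lambda_h^{(k)}(\Omega)$ be the canonical projector. Then the composition $\Pi_{\mathscr C}^{(k)}\Pi^{(k)}:H\Lambda^{(k)}(\Omega)\to H\Lambda_h^{(k)}(\Omega)$ is a bounded cochain projector, that is, for every $k$: (1) $(\Pi_{\mathscr C}^{(k)}\Pi^{(k)})(\Pi_{\mathscr C}^{(k)}\Pi^{(k)})=\Pi_{\mathscr C}^{(k)}\Pi^{(k)}$, and $\Pi_{\mathscr C}^{(k)}\Pi^{(k)}$ maps onto $H\Lambda_h^{(k)}(\Omega)$; (2) there is a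 constant $C>0$ such that $\|\Pi_{\mathscr C}^{(k)}\Pi^{(k)}\phi\|_{H\Lambda^{(k)}(\Omega)}\le C\|\phi\|_{H\Lambda^{(k)}(\Omega)}$ for all $\phi\in H\Lambda^{(k)}(\Omega)$; (3) $\mathrm d\,\Pi_{\mathscr C}^{(k)}\Pi^{(k)}=\Pi_{\mathscr C}^{(k+1)}\Pi^{(k+1)}\,\mathrm d$. Moreover the two-level diagram with rows $H\Lambda^{(\bullet)}(\Omega)$, $H\widetilde\Lambda_h^{(\bullet)}(\Omega)$, $H\Lambda_h^{(\bullet)}(\Omega)$, horizontal maps $\mathrm d$, and vertical maps $\Pi^{(k)}$ (first to second row) and $\Pi_{\mathscr C}^{(k)}$ (second to third row) commutes, i.e. $\mathrm d\,\Pi^{(k)}=\Pi^{(k+1)}\mathrm d$ on $H\Lambda^{(k)}(\Omega)$ and $\mathrm d\,\Pi_{\mathscr C}^{(k)}=\Pi_{\mathscr C}^{(k+1)}\mathrm d$ on $H\widetilde\Lambda_h^{(k)}(\Omega)$.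
   Context: $H\Lambda^{(k)}(\Omega)$ is the Hilbert space of $L^2$ differential $k$-forms on $\Omega$ whose exterior derivative is in $L^2$. The $L^2$ inner product is $(\alpha,\beta)=\int_\Omega\alpha\wedge\star\beta$, with norm $\|\cdot\|_{L^2\Lambda^{(k)}(\Omega)}$, and $\|\omega\|_{H\Lambda^{(k)}(\Omega)}^2=\|\omega\|_{L^2\Lambda^{(k)}(\Omega)}^2+\|\mathrm d\omega\|_{L^2\Lambda^{(k+1)}(\Omega)}^2$. The sequence $\mathbb R\hookrightarrow H\Lambda^{(0)}(\Omega)\xrightarrow{\mathrm d}\cdots\xrightarrow{\mathrm d}H\Lambda^{(n)}(\Omega)\to0$ is a closed Hilbert complex. Spaces of degree $>n$ are zero; in degree $-1$ the space is $\mathbb R$ and the map to degree $0$ is the inclusion of constants. A (de Rham) subcomplex consists of finite-dimensional subspaces $V^{(k)}\subset H\Lambda^{(k)}(\Omega)$ with $\mathrm dV^{(k)}\subset V^{(k+1)}$ (including $\mathbb R\hookrightarrow V^{(0)}$). $\mathcal Z^{(k)}=\{\omega\in H\Lambda^{(k)}(\Omega):\mathrm d\omega=0\}$, $\mathcal R^{(k)}=\mathrm dH\Lambda^{(k-1)}(\Omega)$, and the space of harmonic forms $\mathcal H^{(k)}$ is the $L^2$-orthogonal complement of $\mathcal R^{(k)}$ in $\mathcal Z^{(k)}$. Likewise, $\widetilde{\mathcal Z}_h^{(k)}=\{\omega\in H\widetilde\Lambda_h^{(k)}(\Omega):\mathrm d\omega=0\}$, $\widetilde{\mathcal R}_h^{(k)}=\mathrm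 dH\widetilde\Lambda_h^{(k-1)}(\Omega)$, and $\widetilde{\mathcal H}_h^{(k)}$ is the $L^2$-orthogonal complement of $\widetilde{\mathcal R}_h^{(k)}$ in $\widetilde{\mathcal Z}_h^{(k)}$. For subspaces $X,Y\subset H\Lambda^{(k)}(\Omega)$: $\delta(X,Y)=\sup_{0\ne x\in X}\inf_{y\in Y}\|x-y\|_{H\Lambda^{(k)}(\Omega)}/\|x\|_{H\Lambda^{(k)}(\Omega)}$ and $\mathrm{gap}(X,Y)=\max\{\delta(X,Y),\delta(Y,X)\}$. Definition of $\Pi^{(k)}$: given $\phi^{(k)}\in H\Lambda^{(k)}(\Omega)$, find $\lambda^{(i)}\in H\widetilde\Lambda_h^{(i)}(\Omega)$, $i=k,k+1,k+2$, and $h^{(k+1)}\in\widetilde{\mathcal H}_h^{(k+1)}$ such that for all $\eta^{(j)}\in H\widetilde\Lambda_h^{(j)}(\Omega)$, $j=k,k+1,k+2$, and all $\gamma^{(k+1)}\in\widetilde{\mathcal H}_h^{(k+1)}$, $$\begin{aligned}(\eta^{(k)},\lambda^{(k)})+(\mathrm d\eta^{(k)},\lambda^{(k+1)})&=(\eta^{(k)},\phi^{(k)}),\\(\eta^{(k+1)},\mathrm d\lambda^{(k)})+(\mathrm d\eta^{(k+1)},\lambda^{(k+2)})+(\eta^{(k+1)},h^{(k+1)})&=(\eta^{(k+1)},\mathrm d\phi^{(k)}),\\(\eta^{(k+2)},\mathrm d\lambda^{(k+1)})&=0,\\(\gamma^{(k+1)},\lambda^{(k+1)})&=0.\end{aligned}$$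 A solution exists and its component $\lambda^{(k)}$ is unique; set $\Pi^{(k)}\phi^{(k)}=\lambda^{(k)}$. The canonical projector is a family of linear maps $\Pi_{\mathscr C}^{(k)}$ onto $H\Lambda_h^{(k)}(\Omega)$ (here defined on $H\widetilde\Lambda_h^{(k)}(\Omega)$) that is idempotent, $\Pi_{\mathscr C}^{(k)}\Pi_{\mathscr C}^{(k)}=\Pi_{\mathscr C}^{(k)}$, and satisfies $\mathrm d\,\Pi_{\mathscr C}^{(k)}=\Pi_{\mathscr C}^{(k+1)}\mathrm d$. *)

theory Defs
  imports "HOL-Analysis.Analysis"
begin

section \<open>Smooth Riemannian manifolds\<close>

text \<open>For open \<open>S\<close>: all iterated directional derivatives of \<open>f\<close> up to order \<open>r\<close> exist and are
  continuous, the intermediate ones being Frechet differentiable.\<close>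

primrec Cr_on :: "nat \<Rightarrow> 'a::euclidean_space set \<Rightarrow> ('a \<Rightarrow> 'b::real_normed_vector) \<Rightarrow> bool" where
  "Cr_on 0 S f \<longleftrightarrow> continuous_on S f"
| "Cr_on (Suc r) S f \<longleftrightarrow> (\<forall>x\<in>S. f differentiable (at x)) \<and>
     (\<forall>v. Cr_on r S (\<lambda>x. frechet_derivative f (at x) v))"

definition smooth_on :: "'a::euclidean_space set \<Rightarrow> ('a \<Rightarrow> 'b::real_normed_vector) \<Rightarrow> bool" where
  "smooth_on S f \<longleftrightarrow> (\<forall>r. Cr_on r S f)"

text \<open>A chart is a pair of its domain and its coordinate map.  The dimension of the manifold is
  \<open>CARD('n)\<close>.\<close>

type_synonym ('m, 'n) chart = "'m set \<times> ('m \<Rightarrow> real ^ 'n)"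

definition is_chart :: "'m topology \<Rightarrow> ('m, 'n::finite) chart \<Rightarrow> bool" where
  "is_chart T c \<longleftrightarrow> openin T (fst c) \<and> open (snd c ` fst c) \<and>
     homeomorphic_map (subtopology T (fst c)) (top_of_set (snd c ` fst c)) (snd c)"

definition transition :: "('m, 'n::finite) chart \<Rightarrow> ('m, 'n) chart \<Rightarrow> real ^ 'n \<Rightarrow> real ^ 'n" where
  "transition c c' = snd c' \<circ> inv_into (fst c) (snd c)"

definition jacobian :: "('m, 'n::finite) chart \<Rightarrow> ('m, 'n) chart \<Rightarrow> real ^ 'n \<Rightarrow> real ^ 'n ^ 'n" where
  "jacobian c c' x = matrix (frechet_derivative (transition c c') (at x))"

definition compatible :: "('m, 'n::finite) chart \<Rightarrow> ('m, 'n) chart \<Rightarrow> bool" where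
  "compatible c c' \<longleftrightarrow> smooth_on (snd c ` (fst c \<inter> fst c')) (transition c c') \<and>
                       smooth_on (snd c' ` (fst c \<inter> fst c')) (transition c' c)"

text \<open>The metric is given by its coordinate matrices \<open>metric M c x\<close> at the coordinate point \<open>x\<close> of
  the chart \<open>c\<close>; \<open>vol M\<close> is the Riemannian volume measure on the Borel sets.\<close>

record ('m, 'n) riem_mfd =
  mtop :: "'m topology"
  atlas :: "('m, 'n) chart set"
  metric :: "('m, 'n) chart \<Rightarrow> real ^ 'n \<Rightarrow> real ^ 'n ^ 'n"
  vol :: "'m measure"

definition smooth_manifold :: "('m, 'n::finite) riem_mfd \<Rightarrow> bool" where
  "smooth_manifold M \<longleftrightarrow> Hausdorff_space (mtop M) \<and> second_countable (mtop M) \<and>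
     (\<forall>c\<in>atlas M. is_chart (mtop M) c) \<and> (\<Union>c\<in>atlas M. fst c) = topspace (mtop M) \<and>
     (\<forall>c\<in>atlas M. \<forall>c'\<in>atlas M. compatible c c')"

definition riemannian_metric :: "('m, 'n::finite) riem_mfd \<Rightarrow> bool" where
  "riemannian_metric M \<longleftrightarrow>
     (\<forall>c\<in>atlas M. smooth_on (snd c ` fst c) (metric M c) \<and>
        (\<forall>x\<in>snd c ` fst c. transpose (metric M c x) = metric M c x \<and>
           (\<forall>v. v \<noteq> 0 \<longrightarrow> v \<bullet> (metric M c x *v v) > 0))) \<and>
     (\<forall>c\<in>atlas M. \<forall>c'\<in>atlas M. \<forall>x\<in>snd c ` (fst c \<inter> fst c').
        metric M c x =
          transpose (jacobian c c' x) ** metric M c' (transition c c' x) ** jacobian c c' x)"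

definition riemannian_volume :: "('m, 'n::finite) riem_mfd \<Rightarrow> bool" where
  "riemannian_volume M \<longleftrightarrow>
     sets (vol M) = sigma_sets (topspace (mtop M)) {U. openin (mtop M) U} \<and>
     (\<forall>c\<in>atlas M. \<forall>A\<in>sets (vol M). A \<subseteq> fst c \<longrightarrow>
        emeasure (vol M) A =
          (\<integral>\<^sup>+ x\<in>snd c ` A. ennreal (sqrt (det (metric M c x))) \<partial>lborel))"

definition riemannian_manifold :: "('m, 'n::finite) riem_mfd \<Rightarrow> bool" where
  "riemannian_manifold M \<longleftrightarrow> smooth_manifold M \<and> riemannian_metric M \<and> riemannian_volume M"

text \<open>A compact manifold with Lipschitz boundary is the closure of a relatively compact open set
  \<open>\<Omega>\<close> which, near each of its boundary points and in a suitable smooth chart, is the strict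
  epigraph of a Lipschitz function of the other coordinates.  The boundary may be empty.\<close>

definition lipschitz_domain :: "('m, 'n::finite) riem_mfd \<Rightarrow> 'm set \<Rightarrow> bool" where
  "lipschitz_domain M \<Omega> \<longleftrightarrow> openin (mtop M) \<Omega> \<and> compactin (mtop M) (mtop M closure_of \<Omega>) \<and>
     (\<forall>p \<in> mtop M frontier_of \<Omega>. \<exists>c. is_chart (mtop M) c \<and> (\<forall>c'\<in>atlas M. compatible c c') \<and>
        p \<in> fst c \<and>
        (\<exists>(f :: real ^ 'n \<Rightarrow> real) i L. L-lipschitz_on UNIV f \<and>
           (\<forall>x t. f (x + t *\<^sub>R axis i 1) = f x) \<and>
           (\<forall>q\<in>fst c. q \<in> \<Omega> \<longleftrightarrow> f (snd c q) < snd c q $ i)))"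


section \<open>Square integrable differential forms\<close>

text \<open>A \<open>k\<close>-form is given by its components \<open>\<omega> c x [i\<^sub>1, \<dots>, i\<^sub>k]\<close> with respect to the coordinate
  differentials, at the coordinate point \<open>x\<close> of the chart \<open>c\<close>.  Only the values at charts of the
  atlas, points of \<open>\<Omega>\<close> and index lists of length \<open>k\<close> are meaningful.\<close>

type_synonym ('m, 'n) form = "('m, 'n) chart \<Rightarrow> real ^ 'n \<Rightarrow> 'n list \<Rightarrow> real"

abbreviation idx :: "nat \<Rightarrow> 'n list set" where
  "idx k \<equiv> {is. length is = k}"

definition is_form :: "('m, 'n::finite) riem_mfd \<Rightarrow> 'm set \<Rightarrow> nat \<Rightarrow> ('m, 'n) form \<Rightarrow> bool" where
  "is_form M \<Omega> k \<omega> \<longleftrightarrow>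
     (\<forall>c\<in>atlas M. \<forall>x\<in>snd c ` (fst c \<inter> \<Omega>). \<forall>is\<in>idx k. \<forall>\<sigma>. \<sigma> permutes {..<k} \<longrightarrow>
        \<omega> c x (permute_list \<sigma> is) = of_int (sign \<sigma>) * \<omega> c x is) \<and>
     (\<forall>c\<in>atlas M. \<forall>c'\<in>atlas M. \<forall>x\<in>snd c ` (fst c \<inter> fst c' \<inter> \<Omega>). \<forall>is\<in>idx k.
        \<omega> c x is = (\<Sum>js\<in>idx k. (\<Prod>l<k. jacobian c c' x $ (js ! l) $ (is ! l)) *
                                  \<omega> c' (transition c c' x) js))"

text \<open>The pointwise inner product of \<open>k\<close>-forms induced by the metric.  For forms it does not depend
  on the chart.\<close>

definition form_inner_at ::
  "('m, 'n::finite) riem_mfd \<Rightarrow> nat \<Rightarrow> ('m, 'n) form \<Rightarrow> ('m, 'n) form \<Rightarrow> 'm \<Rightarrow> real" where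
  "form_inner_at M k \<alpha> \<beta> p =
     (let c = (SOME c. c \<in> atlas M \<and> p \<in> fst c); x = snd c p; G = matrix_inv (metric M c x)
      in (\<Sum>is\<in>idx k. \<Sum>js\<in>idx k. (\<Prod>l<k. G $ (is ! l) $ (js ! l)) * \<alpha> c x is * \<beta> c x js) / fact k)"

definition l2_form :: "('m, 'n::finite) riem_mfd \<Rightarrow> 'm set \<Rightarrow> nat \<Rightarrow> ('m, 'n) form \<Rightarrow> bool" where
  "l2_form M \<Omega> k \<omega> \<longleftrightarrow> is_form M \<Omega> k \<omega> \<and>
     (\<forall>c\<in>atlas M. \<forall>is\<in>idx k. set_borel_measurable lborel (snd c ` (fst c \<inter> \<Omega>)) (\<lambda>x. \<omega> c x is)) \<and>
     set_integrable (vol M) \<Omega> (form_inner_at M k \<omega> \<omega>)"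

definition ae_eq ::
  "('m, 'n::finite) riem_mfd \<Rightarrow> 'm set \<Rightarrow> nat \<Rightarrow> ('m, 'n) form \<Rightarrow> ('m, 'n) form \<Rightarrow> bool" where
  "ae_eq M \<Omega> k \<alpha> \<beta> \<longleftrightarrow>
     (AE p in vol M. p \<in> \<Omega> \<longrightarrow>
        (\<forall>c\<in>atlas M. p \<in> fst c \<longrightarrow> (\<forall>is\<in>idx k. \<alpha> c (snd c p) is = \<beta> c (snd c p) is)))"

definition test_function :: "(real ^ 'n::finite) set \<Rightarrow> (real ^ 'n \<Rightarrow> real) \<Rightarrow> bool" where
  "test_function D u \<longleftrightarrow> smooth_on UNIV u \<and> (\<exists>K. compact K \<and> K \<subseteq> D \<and> (\<forall>x. x \<notin> K \<longrightarrow> u x = 0))"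

text \<open>\<open>\<eta>\<close> is the distributional exterior derivative of \<open>\<omega>\<close>: in every chart,
  \<open>\<eta>\<^bsub>i0\<dots>ik\<^esub> = (\<Sum>j\<le>k. (-1)\<^sup>j \<partial>\<^bsub>ij\<^esub> \<omega>\<^bsub>i0\<dots>ik without ij\<^esub>)\<close> in the sense of distributions.\<close>

definition weak_ext_deriv ::
  "('m, 'n::finite) riem_mfd \<Rightarrow> 'm set \<Rightarrow> nat \<Rightarrow> ('m, 'n) form \<Rightarrow> ('m, 'n) form \<Rightarrow> bool" where
  "weak_ext_deriv M \<Omega> k \<omega> \<eta> \<longleftrightarrow>
     (\<forall>c\<in>atlas M. \<forall>u. test_function (snd c ` (fst c \<inter> \<Omega>)) u \<longrightarrow> (\<forall>is\<in>idx (Suc k).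
        (LINT x : snd c ` (fst c \<inter> \<Omega>) | lborel. \<eta> c x is * u x) =
        - (\<Sum>j\<le>k. (-1) ^ j *
             (LINT x : snd c ` (fst c \<inter> \<Omega>) | lborel.
                \<omega> c x (take j is @ drop (Suc j) is) * frechet_derivative u (at x) (axis (is ! j) 1)))))"


section \<open>The spaces \<open>H\<Lambda>\<^sup>k\<close>\<close>

text \<open>Their elements are classes of almost everywhere equal forms.\<close>

type_synonym ('m, 'n) fclass = "('m, 'n) form set"

definition cls :: "('m, 'n::finite) riem_mfd \<Rightarrow> 'm set \<Rightarrow> nat \<Rightarrow> ('m, 'n) form \<Rightarrow> ('m, 'n) fclass" where
  "cls M \<Omega> k \<omega> = {\<omega>'. l2_form M \<Omega> k \<omega>' \<and> ae_eq M \<Omega> k \<omega> \<omega>'}"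

definition rep :: "('m, 'n) fclass \<Rightarrow> ('m, 'n) form" where
  "rep X = (SOME \<omega>. \<omega> \<in> X)"

definition HL :: "('m, 'n::finite) riem_mfd \<Rightarrow> 'm set \<Rightarrow> nat \<Rightarrow> ('m, 'n) fclass set" where
  "HL M \<Omega> k = {cls M \<Omega> k \<omega> | \<omega>. l2_form M \<Omega> k \<omega> \<and>
                  (\<exists>\<eta>. l2_form M \<Omega> (Suc k) \<eta> \<and> weak_ext_deriv M \<Omega> k \<omega> \<eta>)}"

definition ext_d :: "('m, 'n::finite) riem_mfd \<Rightarrow> 'm set \<Rightarrow> nat \<Rightarrow> ('m, 'n) fclass \<Rightarrow> ('m, 'n) fclass" where
  "ext_d M \<Omega> k X =
     cls M \<Omega> (Suc k) (SOME \<eta>. l2_form M \<Omega> (Suc k) \<eta> \<and> weak_ext_deriv M \<Omega> k (rep X) \<eta>)"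

definition czero :: "('m, 'n::finite) riem_mfd \<Rightarrow> 'm set \<Rightarrow> nat \<Rightarrow> ('m, 'n) fclass" where
  "czero M \<Omega> k = cls M \<Omega> k (\<lambda>c x is. 0)"

definition cadd ::
  "('m, 'n::finite) riem_mfd \<Rightarrow> 'm set \<Rightarrow> nat \<Rightarrow> ('m, 'n) fclass \<Rightarrow> ('m, 'n) fclass \<Rightarrow> ('m, 'n) fclass" where
  "cadd M \<Omega> k X Y = cls M \<Omega> k (\<lambda>c x is. rep X c x is + rep Y c x is)"

definition cscale ::
  "('m, 'n::finite) riem_mfd \<Rightarrow> 'm set \<Rightarrow> nat \<Rightarrow> real \<Rightarrow> ('m, 'n) fclass \<Rightarrow> ('m, 'n) fclass" where
  "cscale M \<Omega> k a X = cls M \<Omega> k (\<lambda>c x is. a * rep X c x is)"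

definition cdiff ::
  "('m, 'n::finite) riem_mfd \<Rightarrow> 'm set \<Rightarrow> nat \<Rightarrow> ('m, 'n) fclass \<Rightarrow> ('m, 'n) fclass \<Rightarrow> ('m, 'n) fclass" where
  "cdiff M \<Omega> k X Y = cls M \<Omega> k (\<lambda>c x is. rep X c x is - rep Y c x is)"

definition cconst :: "('m, 'n::finite) riem_mfd \<Rightarrow> 'm set \<Rightarrow> real \<Rightarrow> ('m, 'n) fclass" where
  "cconst M \<Omega> r = cls M \<Omega> 0 (\<lambda>c x is. r)"

text \<open>\<open>(\<alpha>, \<beta>) = \<integral>\<^sub>\<Omega> \<alpha> \<and> \<star>\<beta>\<close>, where the Hodge star is the operator determined by
  \<open>\<alpha> \<and> \<star>\<beta> = \<langle>\<alpha>, \<beta>\<rangle> vol\<close>.\<close>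

definition l2_inner ::
  "('m, 'n::finite) riem_mfd \<Rightarrow> 'm set \<Rightarrow> nat \<Rightarrow> ('m, 'n) fclass \<Rightarrow> ('m, 'n) fclass \<Rightarrow> real" where
  "l2_inner M \<Omega> k X Y = (LINT p : \<Omega> | vol M. form_inner_at M k (rep X) (rep Y) p)"

definition l2_norm :: "('m, 'n::finite) riem_mfd \<Rightarrow> 'm set \<Rightarrow> nat \<Rightarrow> ('m, 'n) fclass \<Rightarrow> real" where
  "l2_norm M \<Omega> k X = sqrt (l2_inner M \<Omega> k X X)"

definition H_norm :: "('m, 'n::finite) riem_mfd \<Rightarrow> 'm set \<Rightarrow> nat \<Rightarrow> ('m, 'n) fclass \<Rightarrow> real" where
  "H_norm M \<Omega> k X = sqrt ((l2_norm M \<Omega> k X)\<^sup>2 + (l2_norm M \<Omega> (Suc k) (ext_d M \<Omega> k X))\<^sup>2)"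


section \<open>Subcomplexes, harmonic forms, gap\<close>

definition fin_dim_subspace ::
  "('m, 'n::finite) riem_mfd \<Rightarrow> 'm set \<Rightarrow> nat \<Rightarrow> ('m, 'n) fclass set \<Rightarrow> bool" where
  "fin_dim_subspace M \<Omega> k V \<longleftrightarrow> V \<subseteq> HL M \<Omega> k \<and> czero M \<Omega> k \<in> V \<and>
     (\<forall>X\<in>V. \<forall>Y\<in>V. cadd M \<Omega> k X Y \<in> V) \<and> (\<forall>a. \<forall>X\<in>V. cscale M \<Omega> k a X \<in> V) \<and>
     (\<exists>B. finite B \<and> B \<subseteq> V \<and>
        (\<forall>X\<in>V. \<exists>a. X = cls M \<Omega> k (\<lambda>c x is. \<Sum>b\<in>B. a b * rep b c x is)))"

text \<open>All degrees are quantified over: \<open>H\<Lambda>\<^sup>k\<close>, hence also \<open>V k\<close>, is zero for \<open>k > CARD('n)\<close>.\<close>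

definition de_rham_subcomplex ::
  "('m, 'n::finite) riem_mfd \<Rightarrow> 'm set \<Rightarrow> (nat \<Rightarrow> ('m, 'n) fclass set) \<Rightarrow> bool" where
  "de_rham_subcomplex M \<Omega> V \<longleftrightarrow> (\<forall>k. fin_dim_subspace M \<Omega> k (V k)) \<and>
     (\<forall>k. ext_d M \<Omega> k ` V k \<subseteq> V (Suc k)) \<and> range (cconst M \<Omega>) \<subseteq> V 0"

text \<open>Cocycles, coboundaries and harmonic forms of a complex \<open>V\<close>, which is either \<open>HL M \<Omega>\<close> or a
  subcomplex.  In degree \<open>0\<close> the coboundaries are the constants (the complex is augmented by the
  reals in degree \<open>-1\<close>).\<close>

definition cocycles ::
  "('m, 'n::finite) riem_mfd \<Rightarrow> 'm set \<Rightarrow> (nat \<Rightarrow> ('m, 'n) fclass set) \<Rightarrow> nat \<Rightarrow> ('m, 'n) fclass set" where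
  "cocycles M \<Omega> V k = {X \<in> V k. ext_d M \<Omega> k X = czero M \<Omega> (Suc k)}"

definition coboundaries ::
  "('m, 'n::finite) riem_mfd \<Rightarrow> 'm set \<Rightarrow> (nat \<Rightarrow> ('m, 'n) fclass set) \<Rightarrow> nat \<Rightarrow> ('m, 'n) fclass set" where
  "coboundaries M \<Omega> V k =
     (case k of 0 \<Rightarrow> range (cconst M \<Omega>) | Suc j \<Rightarrow> ext_d M \<Omega> j ` V j)"

definition harmonic ::
  "('m, 'n::finite) riem_mfd \<Rightarrow> 'm set \<Rightarrow> (nat \<Rightarrow> ('m, 'n) fclass set) \<Rightarrow> nat \<Rightarrow> ('m, 'n) fclass set" where
  "harmonic M \<Omega> V k =
     {X \<in> cocycles M \<Omega> V k. \<forall>Y\<in>coboundaries M \<Omega> V k. l2_inner M \<Omega> k X Y = 0}"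

text \<open>Suprema are taken in \<open>ennreal\<close>, so that \<open>\<delta>({0}, Y) = 0\<close>.\<close>

definition sub_delta :: "('m, 'n::finite) riem_mfd \<Rightarrow> 'm set \<Rightarrow> nat \<Rightarrow>
    ('m, 'n) fclass set \<Rightarrow> ('m, 'n) fclass set \<Rightarrow> ennreal" where
  "sub_delta M \<Omega> k X Y =
     (SUP x \<in> X - {czero M \<Omega> k}. INF y \<in> Y.
        ennreal (H_norm M \<Omega> k (cdiff M \<Omega> k x y) / H_norm M \<Omega> k x))"

definition gap :: "('m, 'n::finite) riem_mfd \<Rightarrow> 'm set \<Rightarrow> nat \<Rightarrow>
    ('m, 'n) fclass set \<Rightarrow> ('m, 'n) fclass set \<Rightarrow> ennreal" where
  "gap M \<Omega> k X Y = max (sub_delta M \<Omega> k X Y) (sub_delta M \<Omega> k Y X)"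


section \<open>Projectors\<close>

text \<open>The augmented mixed system posed on the complex \<open>W\<close>; \<open>l0\<close>, \<open>l1\<close>, \<open>l2\<close> are the unknowns of
  degree \<open>k\<close>, \<open>k + 1\<close>, \<open>k + 2\<close>.\<close>

definition mixed_system :: "('m, 'n::finite) riem_mfd \<Rightarrow> 'm set \<Rightarrow> (nat \<Rightarrow> ('m, 'n) fclass set) \<Rightarrow> nat \<Rightarrow>
    ('m, 'n) fclass \<Rightarrow> ('m, 'n) fclass \<Rightarrow> ('m, 'n) fclass \<Rightarrow> ('m, 'n) fclass \<Rightarrow> ('m, 'n) fclass \<Rightarrow> bool" where
  "mixed_system M \<Omega> W k \<phi> l0 l1 l2 h \<longleftrightarrow>
     l0 \<in> W k \<and> l1 \<in> W (k + 1) \<and> l2 \<in> W (k + 2) \<and> h \<in> harmonic M \<Omega> W (k + 1) \<and>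
     (\<forall>\<eta>\<in>W k. l2_inner M \<Omega> k \<eta> l0 + l2_inner M \<Omega> (k + 1) (ext_d M \<Omega> k \<eta>) l1 =
                l2_inner M \<Omega> k \<eta> \<phi>) \<and>
     (\<forall>\<eta>\<in>W (k + 1). l2_inner M \<Omega> (k + 1) \<eta> (ext_d M \<Omega> k l0) +
                l2_inner M \<Omega> (k + 2) (ext_d M \<Omega> (k + 1) \<eta>) l2 + l2_inner M \<Omega> (k + 1) \<eta> h =
                l2_inner M \<Omega> (k + 1) \<eta> (ext_d M \<Omega> k \<phi>)) \<and>
     (\<forall>\<eta>\<in>W (k + 2). l2_inner M \<Omega> (k + 2) \<eta> (ext_d M \<Omega> (k + 1) l1) = 0) \<and>
     (\<forall>\<gamma>\<in>harmonic M \<Omega> W (k + 1). l2_inner M \<Omega> (k + 1) \<gamma> l1 = 0)"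

definition mixed_proj :: "('m, 'n::finite) riem_mfd \<Rightarrow> 'm set \<Rightarrow> (nat \<Rightarrow> ('m, 'n) fclass set) \<Rightarrow> nat \<Rightarrow>
    ('m, 'n) fclass \<Rightarrow> ('m, 'n) fclass" where
  "mixed_proj M \<Omega> W k \<phi> = (THE l0. \<exists>l1 l2 h. mixed_system M \<Omega> W k \<phi> l0 l1 l2 h)"

definition linear_on_forms :: "('m, 'n::finite) riem_mfd \<Rightarrow> 'm set \<Rightarrow> nat \<Rightarrow> ('m, 'n) fclass set \<Rightarrow>
    (('m, 'n) fclass \<Rightarrow> ('m, 'n) fclass) \<Rightarrow> bool" where
  "linear_on_forms M \<Omega> k V P \<longleftrightarrow>
     (\<forall>X\<in>V. \<forall>Y\<in>V. P (cadd M \<Omega> k X Y) = cadd M \<Omega> k (P X) (P Y)) \<and>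
     (\<forall>a. \<forall>X\<in>V. P (cscale M \<Omega> k a X) = cscale M \<Omega> k a (P X))"

text \<open>A canonical projector from the complex \<open>W\<close> onto its subcomplex \<open>V\<close>.\<close>

definition canonical_projector :: "('m, 'n::finite) riem_mfd \<Rightarrow> 'm set \<Rightarrow> (nat \<Rightarrow> ('m, 'n) fclass set) \<Rightarrow>
    (nat \<Rightarrow> ('m, 'n) fclass set) \<Rightarrow> (nat \<Rightarrow> ('m, 'n) fclass \<Rightarrow> ('m, 'n) fclass) \<Rightarrow> bool" where
  "canonical_projector M \<Omega> W V P \<longleftrightarrow>
     (\<forall>k. linear_on_forms M \<Omega> k (W k) (P k) \<and> P k ` W k = V k \<and>
          (\<forall>X\<in>W k. P k (P k X) = P k X) \<and>
          (\<forall>X\<in>W k. ext_d M \<Omega> k (P k X) = P (Suc k) (ext_d M \<Omega> k X)))"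

end

theory Submission
  imports Defs
begin

text \<open>
The mixed system has four unknowns, but its component \<open>\<lambda>\<^sup>k\<close> is governed by two orthogonality
conditions.  Write \<open>Z\<close> for the cocycles of the enriched complex \<open>W\<close>.  The third and fourth equations
force \<open>\<lambda>\<^sup>k\<^sup>+\<^sup>1\<close> to be closed and orthogonal to the discrete harmonic forms, hence to be a coboundary;
testing the first equation with \<open>\<eta> \<in> Z\<close> and the second one with coboundaries then eliminates
everything except
\<^item> \<open>\<lambda>\<^sup>k - \<phi>\<close> is orthogonal to \<open>Z\<close> in degree \<open>k\<close>, and
\<^item> \<open>d \<lambda>\<^sup>k - d \<phi>\<close> is orthogonal to \<open>d W\<^sup>k\<close>.

Conversely, if \<open>\<lambda>\<^sup>k\<close> satisfies these two conditions, then the residuals of the first two equations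
vanish on the cocycles (up to the harmonic correction \<open>h\<close>), so the Riesz representation theorem in
finite dimension provides the other unknowns, which are Lagrange multipliers.  Lemma
\<open>ex_mixed_iff_galerkin\<close> states this equivalence.

The two conditions determine \<open>\<lambda>\<^sup>k\<close> uniquely, depend linearly on \<open>\<phi>\<close>, and hold for \<open>\<lambda>\<^sup>k = \<phi>\<close> if
\<open>\<phi> \<in> W\<^sup>k\<close>.  So \<open>\<Pi>\<close> is a linear projection onto \<open>W\<close>.  It is the sum of the orthogonal projection
of \<open>\<phi>\<close> onto \<open>Z\<close> and the unique element of \<open>W\<^sup>k\<close> orthogonal to \<open>Z\<close> whose derivative is the
orthogonal projection of \<open>d \<phi>\<close> onto \<open>d W\<^sup>k\<close>.  Both projections do not increase norms, and a linear map on a finite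
dimensional space is bounded; this bounds \<open>\<Pi>\<close> and equally the composition of \<open>\<Pi>\<close> with any linear
map on \<open>W\<close> (\<open>galerkin_bounded\<close>).

For the commutation with \<open>d\<close> the two conditions are verified for \<open>d \<Pi> \<phi>\<close> with respect to \<open>d \<phi>\<close>.
The second one is trivial because \<open>d d = 0\<close>.  For the first one, a cocycle of degree \<open>k + 1\<close> is a
coboundary plus a discrete harmonic form.  The difference \<open>d \<Pi> \<phi> - d \<phi>\<close> is orthogonal to
coboundaries by the choice of \<open>\<Pi> \<phi>\<close>.  It is orthogonal to discrete harmonic forms because these
are orthogonal to all of \<open>d H\<Lambda>\<^sup>k\<close>: as the gap is zero, they are limits of harmonic forms of the full
complex (\<open>harmonic_orthogonal_of_gap_zero\<close>).  The statements about the composition with the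
canonical projector follow formally.

All of this takes place in an abstract Hilbert complex.  Most of the text below shows that classes of
square integrable forms on a Riemannian manifold are one, which rests on four facts.
\<^item> The pointwise inner product does not depend on the chart used to compute it and is a measurable
  function of the point, so that the integral defining the inner product is additive.  It is a
  tensor power of the inverse metric, and positive definite because a positive definite matrix
  factors as \<open>B\<^sup>T B\<close>.
\<^item> Components of square integrable forms are locally integrable in every chart, since the metric is
  bounded above and below on compact sets.
\<^item> Weak derivatives are unique up to null sets, by the fundamental lemma of the calculus of
  variations; hence \<open>d\<close> is a well defined linear map on classes.
\<^item> Second derivatives of test functions commute, hence \<open>d d = 0\<close>.
\<close>

section \<open>Inner product spaces on a carrier set\<close>

text \<open>The group laws are consequences of the last axiom, which says that the squared distance of distinct
elements, expanded into inner products, does not vanish: two terms are equal as soon as they have the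
same inner product with every element (\<open>eq_by_testing\<close>), and this reduces every vector identity to
an identity of real numbers.\<close>

locale ip_carrier =
  fixes H :: "'a set" and add :: "'a \<Rightarrow> 'a \<Rightarrow> 'a" and scale :: "real \<Rightarrow> 'a \<Rightarrow> 'a"
    and zero :: 'a and ip :: "'a \<Rightarrow> 'a \<Rightarrow> real"
  assumes zero_closed [simp]: "zero \<in> H"
    and add_closed [simp]: "x \<in> H \<Longrightarrow> y \<in> H \<Longrightarrow> add x y \<in> H"
    and scale_closed [simp]: "x \<in> H \<Longrightarrow> scale c x \<in> H"
    and ip_sym: "x \<in> H \<Longrightarrow> y \<in> H \<Longrightarrow> ip x y = ip y x"
    and ip_zero_left [simp]: "x \<in> H \<Longrightarrow> ip zero x = 0"
    and ip_add_left [simp]: "x \<in> H \<Longrightarrow> y \<in> H \<Longrightarrow> z \<in> H \<Longrightarrow> ip (add x y) z = ip x z + ip y z"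
    and ip_scale_left [simp]: "x \<in> H \<Longrightarrow> z \<in> H \<Longrightarrow> ip (scale c x) z = c * ip x z"
    and ip_nonneg [simp]: "x \<in> H \<Longrightarrow> 0 \<le> ip x x"
    and ip_separates: "x \<in> H \<Longrightarrow> y \<in> H \<Longrightarrow> ip x x - 2 * ip x y + ip y y = 0 \<Longrightarrow> x = y"
begin

lemma ip_zero_right [simp]: "x \<in> H \<Longrightarrow> ip x zero = 0"
  by (metis ip_sym ip_zero_left zero_closed)

lemma ip_add_right [simp]: "x \<in> H \<Longrightarrow> y \<in> H \<Longrightarrow> z \<in> H \<Longrightarrow> ip z (add x y) = ip z x + ip z y"
  using ip_add_left ip_sym add_closed by metis

lemma ip_scale_right [simp]: "x \<in> H \<Longrightarrow> z \<in> H \<Longrightarrow> ip z (scale c x) = c * ip z x"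
  using ip_scale_left ip_sym scale_closed by metis

lemma eq_by_testing: "x \<in> H \<Longrightarrow> y \<in> H \<Longrightarrow> (\<And>z. z \<in> H \<Longrightarrow> ip x z = ip y z) \<Longrightarrow> x = y"
  using ip_separates[of x y] ip_sym[of x y] by simp

lemma eq_zero_iff: "x \<in> H \<Longrightarrow> ip x x = 0 \<longleftrightarrow> x = zero"
  using ip_separates[of x zero] by auto

lemma cauchy_schwarz:
  assumes "x \<in> H" "y \<in> H"
  shows "(ip x y)\<^sup>2 \<le> ip x x * ip y y"
proof (cases "ip y y = 0")
  case True
  then show ?thesis using assms eq_zero_iff by auto
next
  case False
  (* the minimizer of the squared norm of x + c y *)
  define c where "c = - ip x y / ip y y"
  have pos: "ip y y > 0" using False assms ip_nonneg[of y] by linarith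
  have "0 \<le> ip (add x (scale c y)) (add x (scale c y))"
    using assms by (intro ip_nonneg) simp_all
  also have "\<dots> = ip x x + 2 * c * ip x y + c\<^sup>2 * ip y y"
    using assms ip_sym[of y x] by (simp add: algebra_simps power2_eq_square)
  also have "\<dots> = ip x x - (ip x y)\<^sup>2 / ip y y"
    using pos by (simp add: c_def field_simps power2_eq_square)
  finally show ?thesis using pos by (simp add: field_simps)
qed

definition nrm :: "'a \<Rightarrow> real" where "nrm x = sqrt (ip x x)"

lemma nrm_nonneg [simp]: "x \<in> H \<Longrightarrow> 0 \<le> nrm x"
  by (simp add: nrm_def)

lemma abs_ip_le: "x \<in> H \<Longrightarrow> y \<in> H \<Longrightarrow> \<bar>ip x y\<bar> \<le> nrm x * nrm y"
  using real_sqrt_le_mono[OF cauchy_schwarz, of x y] by (simp add: nrm_def real_sqrt_mult)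

lemma nrm_add_le:
  assumes "x \<in> H" "y \<in> H" shows "nrm (add x y) \<le> nrm x + nrm y"
proof -
  have "(nrm (add x y))\<^sup>2 = (nrm x)\<^sup>2 + 2 * ip x y + (nrm y)\<^sup>2"
    using assms ip_sym[of y x] ip_nonneg[of "add x y"] unfolding nrm_def
    by (subst real_sqrt_pow2) auto
  also have "\<dots> \<le> (nrm x + nrm y)\<^sup>2"
    using abs_ip_le[OF assms] by (simp add: power2_sum)
  finally show ?thesis
    by (rule power2_le_imp_le) (use assms in simp)
qed

lemma nrm_scale: "x \<in> H \<Longrightarrow> nrm (scale c x) = \<bar>c\<bar> * nrm x"
  by (simp add: nrm_def real_sqrt_mult flip: mult.assoc)

definition minus :: "'a \<Rightarrow> 'a \<Rightarrow> 'a" where "minus x y = add x (scale (-1) y)"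

lemma minus_closed [simp]: "x \<in> H \<Longrightarrow> y \<in> H \<Longrightarrow> minus x y \<in> H"
  by (simp add: minus_def)

lemma ip_minus_left [simp]: "x \<in> H \<Longrightarrow> y \<in> H \<Longrightarrow> z \<in> H \<Longrightarrow> ip (minus x y) z = ip x z - ip y z"
  and ip_minus_right [simp]: "x \<in> H \<Longrightarrow> y \<in> H \<Longrightarrow> z \<in> H \<Longrightarrow> ip z (minus x y) = ip z x - ip z y"
  by (simp_all add: minus_def)

definition subspace :: "'a set \<Rightarrow> bool" where
  "subspace F \<longleftrightarrow> F \<subseteq> H \<and> zero \<in> F \<and> (\<forall>x\<in>F. \<forall>y\<in>F. add x y \<in> F) \<and> (\<forall>c. \<forall>x\<in>F. scale c x \<in> F)"

lemma subspace_minus: "subspace F \<Longrightarrow> x \<in> F \<Longrightarrow> y \<in> F \<Longrightarrow> minus x y \<in> F"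
  by (simp add: subspace_def minus_def)

definition adjoin :: "'a set \<Rightarrow> 'a \<Rightarrow> 'a set" where
  "adjoin F b = {add x (scale c b) | x c. x \<in> F}"

text \<open>Finite dimension is expressed by adjoining one vector at a time, which needs neither finite sums of
vectors nor a notion of basis and makes every argument below an induction.\<close>

inductive fin_dim :: "'a set \<Rightarrow> bool" where
  fin_dim_zero: "fin_dim {zero}"
| fin_dim_adjoin: "fin_dim F \<Longrightarrow> b \<in> H \<Longrightarrow> fin_dim (adjoin F b)"

lemma adjoinI: "x \<in> F \<Longrightarrow> add x (scale c b) \<in> adjoin F b"
  by (auto simp: adjoin_def)

lemma adjoinE:
  assumes "z \<in> adjoin F b" obtains x c where "x \<in> F" "z = add x (scale c b)"
  using assms by (auto simp: adjoin_def)

lemma subset_adjoin: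
  assumes "F \<subseteq> H" "b \<in> H" shows "F \<subseteq> adjoin F b"
proof
  fix x assume x: "x \<in> F"
  then have "x = add x (scale 0 b)" using assms by (intro eq_by_testing) auto
  then show "x \<in> adjoin F b" using x by (metis adjoinI)
qed

lemma scale_in_adjoin:
  assumes "zero \<in> F" "b \<in> H" shows "scale c b \<in> adjoin F b"
proof -
  have "scale c b = add zero (scale c b)" using assms by (intro eq_by_testing) auto
  then show ?thesis using assms by (metis adjoinI)
qed

lemma new_in_adjoin:
  assumes "zero \<in> F" "b \<in> H" shows "b \<in> adjoin F b"
proof -
  have "b = scale 1 b" using assms by (intro eq_by_testing) auto
  then show ?thesis using scale_in_adjoin[OF assms, of 1] by simp
qed

lemma subspace_adjoin:
  assumes F: "subspace F" and b: "b \<in> H" shows "subspace (adjoin F b)"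
proof -
  have sub: "x \<in> F \<Longrightarrow> x \<in> H" for x using F by (auto simp: subspace_def)
  have 1: "adjoin F b \<subseteq> H" using sub b by (auto simp: adjoin_def)
  have "zero = add zero (scale 0 b)"
    using b by (intro eq_by_testing) auto
  then have 2: "zero \<in> adjoin F b" using F by (metis adjoinI subspace_def)
  have 3: "add u v \<in> adjoin F b" if uv: "u \<in> adjoin F b" "v \<in> adjoin F b" for u v
  proof -
    obtain x c where x: "x \<in> F" "u = add x (scale c b)" using uv(1) by (rule adjoinE)
    obtain y e where y: "y \<in> F" "v = add y (scale e b)" using uv(2) by (rule adjoinE)
    have "add u v = add (add x y) (scale (c + e) b)"
      using x y b sub by (intro eq_by_testing) (auto simp: algebra_simps)
    then show ?thesis using x y F by (simp add: adjoinI subspace_def)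
  qed
  have 4: "scale a u \<in> adjoin F b" if u: "u \<in> adjoin F b" for a u
  proof -
    obtain x c where x: "x \<in> F" "u = add x (scale c b)" using u by (rule adjoinE)
    have "scale a u = add (scale a x) (scale (a * c) b)"
      using x b sub by (intro eq_by_testing) (auto simp: algebra_simps)
    then show ?thesis using x F by (simp add: adjoinI subspace_def)
  qed
  show ?thesis unfolding subspace_def using 1 2 3 4 by blast
qed

lemma subspace_fin_dim: "fin_dim F \<Longrightarrow> subspace F"
proof (induction rule: fin_dim.induct)
  case fin_dim_zero
  have "add zero zero = zero" "scale c zero = zero" for c by (auto intro!: eq_by_testing)
  then show ?case by (simp add: subspace_def)
qed (simp add: subspace_adjoin)

definition linear_fun :: "'a set \<Rightarrow> ('a \<Rightarrow> real) \<Rightarrow> bool" where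
  "linear_fun F f \<longleftrightarrow> (\<forall>x\<in>F. \<forall>y\<in>F. f (add x y) = f x + f y) \<and> (\<forall>c. \<forall>x\<in>F. f (scale c x) = c * f x)"

definition orth :: "'a \<Rightarrow> 'a set \<Rightarrow> bool" where
  "orth x F \<longleftrightarrow> (\<forall>y\<in>F. ip y x = 0)"

lemma linear_fun_zero: 
  assumes "subspace F" "linear_fun F f" shows "f zero = 0"
proof -
  have "zero = scale 0 zero" by (rule eq_by_testing) auto
  then have "f zero = 0 * f zero" using assms by (metis subspace_def linear_fun_def)
  then show ?thesis by simp
qed

text \<open>The Gram-Schmidt step: subtracting from the new vector its projection \<open>p\<close> does not change the span.\<close>

lemma adjoin_orthogonal:
  assumes F: "subspace F" and b: "b \<in> H" and p: "p \<in> F" and orth: "orth (minus b p) F"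
  shows "adjoin F b = adjoin F (minus b p)"
proof -
  have sub: "x \<in> F \<Longrightarrow> x \<in> H" for x using F by (auto simp: subspace_def)
  have "add x (scale c b) = add (add x (scale c p)) (scale c (minus b p))"
    if "x \<in> F" for x c
    using that p b sub by (intro eq_by_testing) (auto simp: algebra_simps)
  moreover have "add x (scale c (minus b p)) = add (add x (scale (-c) p)) (scale c b)"
    if "x \<in> F" for x c
    using that p b sub by (intro eq_by_testing) (auto simp: algebra_simps)
  moreover have "add x (scale c p) \<in> F" if "x \<in> F" for x c
    using that p F by (auto simp: subspace_def)
  ultimately show ?thesis unfolding adjoin_def by blast
qed

lemma adjoin_zero:
  assumes F: "subspace F" shows "adjoin F zero = F"
proof -
  have sub: "x \<in> F \<Longrightarrow> x \<in> H" for x using F by (auto simp: subspace_def)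
  have "add x (scale c zero) = x" if "x \<in> F" for x c
    using that sub by (intro eq_by_testing) auto
  then have "{add x (scale c zero) |x c. x \<in> F} = {x |x. x \<in> F}" by metis
  then show ?thesis unfolding adjoin_def by simp
qed

text \<open>If \<open>r\<close> represents \<open>f\<close> on \<open>F\<close>, then adding the multiple \<open>f e / ip e e\<close> of \<open>e\<close> represents \<open>f\<close> on the
orthogonal sum of \<open>F\<close> and the line through \<open>e\<close>.\<close>

lemma riesz_adjoin:
  assumes F: "subspace F" and e: "e \<in> H" "e \<noteq> zero" "orth e F"
    and r: "r \<in> F" "\<And>y. y \<in> F \<Longrightarrow> ip y r = f y"
    and f: "linear_fun (adjoin F e) f"
  shows "\<exists>r'\<in>adjoin F e. \<forall>y\<in>adjoin F e. ip y r' = f y"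
proof
  have sub: "x \<in> F \<Longrightarrow> x \<in> H" for x using F by (auto simp: subspace_def)
  have zF: "zero \<in> F" and FH: "F \<subseteq> H" using F by (auto simp: subspace_def)
  have inF: "x \<in> F \<Longrightarrow> x \<in> adjoin F e" for x using subset_adjoin[OF FH e(1)] by blast
  note e_in = scale_in_adjoin[OF zF e(1)] and e1 = new_in_adjoin[OF zF e(1)]
  have ee: "ip e e \<noteq> 0" using e eq_zero_iff by auto
  let ?r = "add r (scale (f e / ip e e) e)"
  show "?r \<in> adjoin F e" using r by (rule_tac adjoinI) auto
  show "\<forall>y\<in>adjoin F e. ip y ?r = f y"
  proof
    fix y assume "y \<in> adjoin F e"
    then obtain x c where x: "x \<in> F" "y = add x (scale c e)" by (rule adjoinE)
    have "f y = f x + c * f e"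
      using f x inF e_in e1 by (simp add: linear_fun_def)
    moreover have "ip x e = 0" "ip e r = 0"
      using e x r ip_sym[of e r] sub by (auto simp: orth_def)
    ultimately show "ip y ?r = f y"
      using x r e sub ee by (simp add: algebra_simps)
  qed
qed

text \<open>The induction hypothesis is used twice: for \<open>f\<close> itself, and for the functional \<open>ip _ b\<close>, whose
representative is the projection that makes the adjoined vector orthogonal.\<close>

lemma riesz:
  assumes "fin_dim F" "linear_fun F f"
  shows "\<exists>r\<in>F. \<forall>y\<in>F. ip y r = f y"
  using assms
proof (induction arbitrary: f rule: fin_dim.induct)
  case fin_dim_zero
  have "subspace {zero}" using subspace_fin_dim fin_dim.fin_dim_zero by blast
  then show ?case using linear_fun_zero fin_dim_zero by auto
next
  case (fin_dim_adjoin F b)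
  note F = subspace_fin_dim[OF fin_dim_adjoin.hyps(1)]
  have sub: "x \<in> F \<Longrightarrow> x \<in> H" for x using F by (auto simp: subspace_def)
  have "linear_fun F (\<lambda>y. ip y b)"
    using sub fin_dim_adjoin.hyps by (auto simp: linear_fun_def)
  then obtain p where p: "p \<in> F" "\<And>y. y \<in> F \<Longrightarrow> ip y p = ip y b"
    using fin_dim_adjoin.IH by blast
  let ?e = "minus b p"
  have e: "?e \<in> H" "orth ?e F"
    using p sub fin_dim_adjoin.hyps by (auto simp: orth_def)
  have eq: "adjoin F b = adjoin F ?e"
    using adjoin_orthogonal[OF F _ p(1) e(2)] fin_dim_adjoin.hyps by blast
  show ?case
  proof (cases "?e = zero")
    case True
    then have "adjoin F b = F" using eq adjoin_zero[OF F] by simp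
    then show ?thesis using fin_dim_adjoin.IH fin_dim_adjoin.prems by metis
  next
    case False
    have "linear_fun F f"
    proof -
      have "F \<subseteq> adjoin F b"
        using subset_adjoin[of F b] F fin_dim_adjoin.hyps by (simp add: subspace_def)
      then have "x \<in> F \<Longrightarrow> x \<in> adjoin F b" for x by blast
      then show ?thesis using fin_dim_adjoin.prems by (simp add: linear_fun_def)
    qed
    then obtain r where "r \<in> F" "\<And>y. y \<in> F \<Longrightarrow> ip y r = f y"
      using fin_dim_adjoin.IH by blast
    then show ?thesis
      using riesz_adjoin[OF F e(1) False e(2)] fin_dim_adjoin.prems unfolding eq by blast
  qed
qed

lemma projection_exists:
  assumes F: "fin_dim F" and b: "b \<in> H"
  shows "\<exists>p\<in>F. orth (minus b p) F"
proof -
  have sub: "x \<in> F \<Longrightarrow> x \<in> H" for x using subspace_fin_dim[OF F] by (auto simp: subspace_def)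
  have "linear_fun F (\<lambda>y. ip y b)"
    using sub b by (auto simp: linear_fun_def)
  then obtain p where p: "p \<in> F" "\<And>y. y \<in> F \<Longrightarrow> ip y p = ip y b"
    using riesz[OF F] by blast
  then have "orth (minus b p) F" using sub b by (simp add: orth_def)
  then show ?thesis using p(1) by blast
qed

text \<open>With projections available, every adjoined vector may be assumed to be orthogonal and nonzero.\<close>

lemma fin_dim_orth_induct [consumes 1, case_names zero adjoin]:
  assumes "fin_dim F" and "P {zero}"
    and step: "\<And>F e. fin_dim F \<Longrightarrow> P F \<Longrightarrow> e \<in> H \<Longrightarrow> e \<noteq> zero \<Longrightarrow> orth e F \<Longrightarrow> P (adjoin F e)"
  shows "P F"
  using assms(1)
proof (induction rule: fin_dim.induct)
  case fin_dim_zero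
  show ?case by fact
next
  case (fin_dim_adjoin F b)
  note F = subspace_fin_dim[OF fin_dim_adjoin.hyps(1)]
  obtain p where p: "p \<in> F" "orth (minus b p) F"
    using projection_exists fin_dim_adjoin.hyps by blast
  have "minus b p \<in> H" using p F fin_dim_adjoin.hyps by (auto simp: subspace_def)
  moreover have eq: "adjoin F b = adjoin F (minus b p)"
    using adjoin_orthogonal[OF F _ p] fin_dim_adjoin.hyps by blast
  ultimately show ?case
    using step[OF fin_dim_adjoin.hyps(1) fin_dim_adjoin.IH] p(2) adjoin_zero[OF F] fin_dim_adjoin.IH
    by (cases "minus b p = zero") auto
qed

text \<open>If \<open>S\<close> is not contained in \<open>F\<close>, an element \<open>s\<close> of \<open>S\<close> outside \<open>F\<close> has a nonzero coefficient at
\<open>e\<close>; subtracting a multiple of \<open>s\<close> moves any element of \<open>S\<close> into \<open>F\<close>.\<close>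

lemma fin_dim_subspace:
  assumes "fin_dim F" "subspace S" "S \<subseteq> F"
  shows "fin_dim S"
  using assms
proof (induction arbitrary: S rule: fin_dim_orth_induct)
  case zero
  then have "S = {zero}" by (auto simp: subspace_def)
  then show ?case using fin_dim_zero by simp
next
  case (adjoin F e)
  note F = subspace_fin_dim[OF adjoin.hyps(1)]
  have sub: "x \<in> F \<Longrightarrow> x \<in> H" for x using F by (auto simp: subspace_def)
  have subS: "x \<in> S \<Longrightarrow> x \<in> H" for x using adjoin.prems by (auto simp: subspace_def)
  have "subspace (S \<inter> F)" using F adjoin.prems by (auto simp: subspace_def)
  then have SF: "fin_dim (S \<inter> F)" using adjoin.IH by blast
  show ?case
  proof (cases "S \<subseteq> F")
    case True
    then show ?thesis using SF by (simp add: inf.absorb1)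
  next
    case False
    then obtain s where s: "s \<in> S" "s \<notin> F" by blast
    then obtain x c where x: "x \<in> F" "s = add x (scale c e)" using adjoin.prems by (meson adjoinE subsetD)
    have "c \<noteq> 0"
    proof
      assume "c = 0"
      then have "s = x" using x adjoin.hyps sub by (intro eq_by_testing) auto
      then show False using s x by simp
    qed
    have "t \<in> adjoin (S \<inter> F) s" if t: "t \<in> S" for t
    proof -
      obtain y d where y: "y \<in> F" "t = add y (scale d e)" using adjoin.prems t by (meson adjoinE subsetD)
      let ?u = "add t (scale (- d / c) s)"
      have "?u = add y (scale (- d / c) x)"
        using x y \<open>c \<noteq> 0\<close> sub adjoin.hyps by (intro eq_by_testing) (auto simp: algebra_simps)
      then have "?u \<in> F" using x y F by (simp add: subspace_def)
      moreover have "?u \<in> S" using s t adjoin.prems by (simp add: subspace_def)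
      moreover have "t = add ?u (scale (d / c) s)"
        using s t subS by (intro eq_by_testing) (auto simp: algebra_simps)
      ultimately show ?thesis by (metis IntI adjoinI)
    qed
    moreover have "adjoin (S \<inter> F) s \<subseteq> S"
      using s adjoin.prems by (auto simp: adjoin_def subspace_def)
    ultimately have "S = adjoin (S \<inter> F) s" by blast
    then show ?thesis using fin_dim_adjoin[OF SF subS[OF s(1)]] by simp
  qed
qed

text \<open>In an orthogonal sum the norms of the two components are at most the norm of the vector, so the
constants of the summands add up.\<close>

lemma seminorm_bounded:
  assumes "fin_dim F"
    and "\<And>x y. x \<in> F \<Longrightarrow> y \<in> F \<Longrightarrow> N (add x y) \<le> N x + N y"
    and "\<And>c x. x \<in> F \<Longrightarrow> N (scale c x) = \<bar>c\<bar> * N x"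
  shows "\<exists>C\<ge>0. \<forall>x\<in>F. N x \<le> C * nrm x"
  using assms
proof (induction rule: fin_dim_orth_induct)
  case zero
  have "scale 0 zero = zero" by (rule eq_by_testing) auto
  then have "N zero = 0" using zero(2)[of zero 0] by simp
  then show ?case by (auto simp: nrm_def intro: exI[of _ 0])
next
  case (adjoin F e)
  note F = subspace_fin_dim[OF adjoin.hyps(1)]
  have sub: "x \<in> F \<Longrightarrow> x \<in> H" for x using F by (auto simp: subspace_def)
  have zF: "zero \<in> F" and FH: "F \<subseteq> H" using F by (auto simp: subspace_def)
  have inF: "x \<in> F \<Longrightarrow> x \<in> adjoin F e" for x using subset_adjoin[OF FH adjoin.hyps(2)] by blast
  note e_in = scale_in_adjoin[OF zF adjoin.hyps(2)] and e1 = new_in_adjoin[OF zF adjoin.hyps(2)]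
  obtain C where C: "C \<ge> 0" "\<And>x. x \<in> F \<Longrightarrow> N x \<le> C * nrm x"
    using adjoin.IH[OF adjoin.prems(1)[OF inF inF] adjoin.prems(2)[OF inF]] by blast
  have ee: "0 < nrm e" using adjoin.hyps eq_zero_iff[of e] ip_nonneg[of e] by (auto simp: nrm_def less_le)
  have Ne: "0 \<le> N e"
  proof -
    have "add e (scale (-1) e) = scale 0 e" using adjoin.hyps by (intro eq_by_testing) auto
    then show ?thesis using adjoin.prems(1)[OF e1 e_in, of "-1"] adjoin.prems(2)[OF e1] by simp
  qed
  have "N z \<le> (C + N e / nrm e) * nrm z" if z: "z \<in> adjoin F e" for z
  proof -
    obtain x c where x: "x \<in> F" "z = add x (scale c e)" using z by (rule adjoinE)
    have xe: "ip x e = 0" "ip e x = 0" 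
      using adjoin.hyps x sub ip_sym[of e x] by (auto simp: orth_def)
    have iz: "ip z z = ip x x + c\<^sup>2 * ip e e"
      using x xe adjoin.hyps sub by (simp add: power2_eq_square)
    have "nrm x \<le> nrm z" using iz adjoin.hyps by (simp add: nrm_def)
    have "\<bar>c\<bar> * nrm e \<le> nrm z"
    proof -
      have "\<bar>c\<bar> * nrm e = sqrt (c\<^sup>2 * ip e e)" by (simp add: nrm_def real_sqrt_mult)
      also have "\<dots> \<le> nrm z" using iz sub x unfolding nrm_def by (intro real_sqrt_le_mono) simp
      finally show ?thesis .
    qed
    then have c: "\<bar>c\<bar> \<le> nrm z / nrm e" using ee by (simp add: field_simps)
    have "N z \<le> N x + \<bar>c\<bar> * N e"
      using adjoin.prems(1)[OF inF[OF x(1)] e_in] adjoin.prems(2)[OF e1] x by metis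
    also have "\<dots> \<le> C * nrm z + nrm z / nrm e * N e"
      using C(2)[OF x(1)] mult_left_mono[OF \<open>nrm x \<le> nrm z\<close> C(1)] mult_right_mono[OF c Ne] by linarith
    finally show ?thesis by (simp add: algebra_simps)
  qed
  then show ?case using C(1) Ne ee by (intro exI[of _ "C + N e / nrm e"]) simp
qed

end

section \<open>Hilbert complexes and the mixed projection\<close>

locale hilbert_complex =
  fixes H :: "nat \<Rightarrow> 'a set" and add :: "nat \<Rightarrow> 'a \<Rightarrow> 'a \<Rightarrow> 'a"
    and scale :: "nat \<Rightarrow> real \<Rightarrow> 'a \<Rightarrow> 'a" and zero :: "nat \<Rightarrow> 'a"
    and ip :: "nat \<Rightarrow> 'a \<Rightarrow> 'a \<Rightarrow> real" and d :: "nat \<Rightarrow> 'a \<Rightarrow> 'a"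
  assumes carrier: "ip_carrier (H k) (add k) (scale k) (zero k) (ip k)"
    and d_closed [simp]: "x \<in> H k \<Longrightarrow> d k x \<in> H (Suc k)"
    and d_add [simp]: "x \<in> H k \<Longrightarrow> y \<in> H k \<Longrightarrow> d k (add k x y) = add (Suc k) (d k x) (d k y)"
    and d_scale [simp]: "x \<in> H k \<Longrightarrow> d k (scale k c x) = scale (Suc k) c (d k x)"
    and d_d [simp]: "x \<in> H k \<Longrightarrow> d (Suc k) (d k x) = zero (Suc (Suc k))"
begin

sublocale deg: ip_carrier "H k" "add k" "scale k" "zero k" "ip k" for k
  by (rule carrier)

lemma d_minus: "x \<in> H k \<Longrightarrow> y \<in> H k \<Longrightarrow> d k (deg.minus k x y) = deg.minus (Suc k) (d k x) (d k y)"
  by (simp add: deg.minus_def)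

lemma d_zero [simp]: "d k (zero k) = zero (Suc k)"
proof -
  have "zero k = scale k 0 (zero k)" by (rule deg.eq_by_testing[where k=k]) auto
  then have "d k (zero k) = scale (Suc k) 0 (d k (zero k))" by (metis d_scale deg.zero_closed)
  also have "\<dots> = zero (Suc k)" by (rule deg.eq_by_testing[where k="Suc k"]) auto
  finally show ?thesis .
qed

definition graph_norm :: "nat \<Rightarrow> 'a \<Rightarrow> real" where
  "graph_norm k x = sqrt ((deg.nrm k x)\<^sup>2 + (deg.nrm (Suc k) (d k x))\<^sup>2)"

lemma graph_norm_add_le:
  assumes "x \<in> H k" "y \<in> H k"
  shows "graph_norm k (add k x y) \<le> graph_norm k x + graph_norm k y"
proof -
  have "graph_norm k (add k x y) \<le>
      sqrt ((deg.nrm k x + deg.nrm k y)\<^sup>2 + (deg.nrm (Suc k) (d k x) + deg.nrm (Suc k) (d k y))\<^sup>2)"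
    unfolding graph_norm_def d_add[OF assms]
    by (intro real_sqrt_le_mono add_mono power_mono deg.nrm_add_le deg.nrm_nonneg deg.add_closed d_closed assms)
  also have "\<dots> \<le> graph_norm k x + graph_norm k y"
    unfolding graph_norm_def by (rule real_sqrt_sum_squares_triangle_ineq)
  finally show ?thesis .
qed

lemma graph_norm_scale:
  assumes "x \<in> H k" shows "graph_norm k (scale k c x) = \<bar>c\<bar> * graph_norm k x"
proof -
  have "(deg.nrm k (scale k c x))\<^sup>2 + (deg.nrm (Suc k) (d k (scale k c x)))\<^sup>2 =
      c\<^sup>2 * ((deg.nrm k x)\<^sup>2 + (deg.nrm (Suc k) (d k x))\<^sup>2)"
    using assms by (simp add: deg.nrm_scale power_mult_distrib distrib_left)
  then show ?thesis by (simp add: graph_norm_def real_sqrt_mult)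
qed

lemma nrm_le_graph_norm:
  "x \<in> H k \<Longrightarrow> deg.nrm k x \<le> graph_norm k x"
  "x \<in> H k \<Longrightarrow> deg.nrm (Suc k) (d k x) \<le> graph_norm k x"
  unfolding graph_norm_def by (auto intro: real_le_rsqrt)

end

text \<open>The mixed system for degree \<open>k\<close> involves the coboundaries and harmonic elements of degree \<open>k + 1\<close>;
accordingly \<open>B k\<close> and \<open>harm k\<close> below denote subspaces in degree \<open>k + 1\<close>.\<close>

locale fin_dim_subcomplex = hilbert_complex +
  fixes W :: "nat \<Rightarrow> 'a set"
  assumes W_fin_dim: "deg.fin_dim k (W k)" and d_W: "x \<in> W k \<Longrightarrow> d k x \<in> W (Suc k)"
begin

definition Z :: "nat \<Rightarrow> 'a set" where "Z k = {x \<in> W k. d k x = zero (Suc k)}"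

definition B :: "nat \<Rightarrow> 'a set" where "B k = d k ` W k"

definition harm :: "nat \<Rightarrow> 'a set" where "harm k = {x \<in> Z (Suc k). \<forall>y\<in>B k. ip (Suc k) x y = 0}"

lemma W_subspace: "deg.subspace k (W k)"
  by (rule deg.subspace_fin_dim[OF W_fin_dim])

lemma W_H [simp]: "x \<in> W k \<Longrightarrow> x \<in> H k"
  using W_subspace[of k] by (auto simp: deg.subspace_def)

lemma W_zero [simp]: "zero k \<in> W k"
  and W_add [simp]: "x \<in> W k \<Longrightarrow> y \<in> W k \<Longrightarrow> add k x y \<in> W k"
  and W_scale [simp]: "x \<in> W k \<Longrightarrow> scale k c x \<in> W k"
  using W_subspace[of k] by (auto simp: deg.subspace_def)

lemma W_minus [simp]: "x \<in> W k \<Longrightarrow> y \<in> W k \<Longrightarrow> deg.minus k x y \<in> W k"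
  by (simp add: deg.minus_def)

lemma Z_W [simp]: "x \<in> Z k \<Longrightarrow> x \<in> W k" and Z_d [simp]: "x \<in> Z k \<Longrightarrow> d k x = zero (Suc k)"
  by (auto simp: Z_def)

lemma add_zero_zero [simp]: "add k (zero k) (zero k) = zero k"
  and scale_zero [simp]: "scale k c (zero k) = zero k"
  by (auto intro!: deg.eq_by_testing[where k=k])

lemma Z_subspace: "deg.subspace k (Z k)"
  unfolding deg.subspace_def by (auto simp: Z_def simp del: Z_W Z_d)

lemma Z_fin_dim: "deg.fin_dim k (Z k)"
  by (rule deg.fin_dim_subspace[OF W_fin_dim Z_subspace]) auto

lemma B_Z: "B k \<subseteq> Z (Suc k)"
  by (auto simp: B_def Z_def d_W simp del: Z_W Z_d)

lemma B_I [simp]: "x \<in> W k \<Longrightarrow> d k x \<in> B k"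
  by (simp add: B_def)

lemma B_H: "y \<in> B k \<Longrightarrow> y \<in> H (Suc k)"
  by (auto simp: B_def)

lemma B_subspace: "deg.subspace (Suc k) (B k)"
proof -
  have "add (Suc k) x y \<in> B k" if xy: "x \<in> B k" "y \<in> B k" for x y
  proof -
    obtain u v where uv: "u \<in> W k" "v \<in> W k" "x = d k u" "y = d k v"
      using xy by (auto simp: B_def)
    then have "add (Suc k) x y = d k (add k u v)" by simp
    then show ?thesis using uv by (metis B_I W_add)
  qed
  moreover have "scale (Suc k) c x \<in> B k" if x: "x \<in> B k" for x c
  proof -
    obtain u where u: "u \<in> W k" "x = d k u"
      using x by (auto simp: B_def)
    then have "scale (Suc k) c x = d k (scale k c u)" by simp
    then show ?thesis using u by (metis B_I W_scale)
  qed
  moreover have "zero (Suc k) \<in> B k" using B_I[OF W_zero] by simp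
  ultimately show ?thesis unfolding deg.subspace_def using B_H by blast
qed

lemma B_fin_dim: "deg.fin_dim (Suc k) (B k)"
  by (rule deg.fin_dim_subspace[OF W_fin_dim B_subspace]) (auto simp: B_def d_W)

lemma harm_subspace: "deg.subspace (Suc k) (harm k)"
  using Z_subspace[of "Suc k"] B_H[of _ k]
  unfolding deg.subspace_def harm_def by (auto simp: deg.zero_closed)

lemma harm_fin_dim: "deg.fin_dim (Suc k) (harm k)"
  by (rule deg.fin_dim_subspace[OF W_fin_dim harm_subspace]) (auto simp: harm_def)

lemma orth_lift_exists:
  assumes "y \<in> B k" shows "\<exists>w\<in>W k. deg.orth k w (Z k) \<and> d k w = y"
proof -
  obtain u where u: "u \<in> W k" "y = d k u" using assms by (auto simp: B_def)
  obtain p where p: "p \<in> Z k" "deg.orth k (deg.minus k u p) (Z k)"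
    using deg.projection_exists[OF Z_fin_dim] u by (metis W_H)
  have "d k (deg.minus k u p) = deg.minus (Suc k) (d k u) (zero (Suc k))"
    using u p by (simp add: d_minus)
  also have "\<dots> = y" unfolding u(2) using u(1) by (intro deg.eq_by_testing[where k="Suc k"]) auto
  finally show ?thesis using u p by (metis W_minus Z_W)
qed

lemma orth_lift_unique:
  assumes "u \<in> W k" "v \<in> W k" "deg.orth k u (Z k)" "deg.orth k v (Z k)" "d k u = d k v"
  shows "u = v"
proof -
  let ?x = "deg.minus k u v"
  have "d k ?x = zero (Suc k)"
    using assms by (intro deg.eq_by_testing[where k="Suc k"]) (auto simp: d_minus)
  then have "?x \<in> Z k" using assms by (simp add: Z_def del: Z_W Z_d)
  then have "ip k ?x u = 0" "ip k ?x v = 0" using assms by (auto simp: deg.orth_def)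
  then show ?thesis using assms by (intro deg.ip_separates[where k=k]) (auto simp: deg.ip_sym)
qed

text \<open>This produces the multipliers of the mixed system.  As \<open>r\<close> is orthogonal to the kernel of \<open>d\<close>,
\<open>ip k x r\<close> depends only on \<open>d k x\<close>, so it is a linear functional on the coboundaries.\<close>

lemma solve_for_coboundary:
  assumes r: "r \<in> H k" "deg.orth k r (Z k)"
  shows "\<exists>y\<in>B k. \<forall>x\<in>W k. ip (Suc k) (d k x) y = ip k x r"
proof -
  define T where "T y = (SOME w. w \<in> W k \<and> d k w = y)" for y
  have T: "T y \<in> W k" "d k (T y) = y" if "y \<in> B k" for y
    using someI_ex[of "\<lambda>w. w \<in> W k \<and> d k w = y"] that by (auto simp: B_def T_def)
  have key: "ip k u r = ip k v r" if uv: "u \<in> W k" "v \<in> W k" "d k u = d k v" for u v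
  proof -
    have "d k (deg.minus k u v) = zero (Suc k)"
      using uv by (intro deg.eq_by_testing[where k="Suc k"]) (auto simp: d_minus)
    then have "deg.minus k u v \<in> Z k" using uv by (simp add: Z_def del: Z_W Z_d)
    then have "ip k (deg.minus k u v) r = 0" using r by (auto simp: deg.orth_def)
    then show ?thesis using uv r by simp
  qed
  have "deg.linear_fun (Suc k) (B k) (\<lambda>y. ip k (T y) r)"
    unfolding deg.linear_fun_def
  proof (intro conjI ballI allI)
    fix x y assume xy: "x \<in> B k" "y \<in> B k"
    then have "add (Suc k) x y \<in> B k" using B_subspace by (auto simp: deg.subspace_def)
    then have "ip k (T (add (Suc k) x y)) r = ip k (add k (T x) (T y)) r"
      using T xy by (intro key) auto
    then show "ip k (T (add (Suc k) x y)) r = ip k (T x) r + ip k (T y) r"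
      using T xy r by simp
  next
    fix c x assume x: "x \<in> B k"
    then have "scale (Suc k) c x \<in> B k" using B_subspace by (auto simp: deg.subspace_def)
    then have "ip k (T (scale (Suc k) c x)) r = ip k (scale k c (T x)) r"
      using T x by (intro key) auto
    then show "ip k (T (scale (Suc k) c x)) r = c * ip k (T x) r"
      using T x r by simp
  qed
  then obtain y where y: "y \<in> B k" "\<And>x. x \<in> B k \<Longrightarrow> ip (Suc k) x y = ip k (T x) r"
    using deg.riesz[OF B_fin_dim] by blast
  have "ip (Suc k) (d k x) y = ip k x r" if "x \<in> W k" for x
    using y(2)[of "d k x"] key[of "T (d k x)" x] T[of "d k x"] that by simp
  then show ?thesis using y(1) by blast
qed

text \<open>The two orthogonality conditions that remain of the mixed system after eliminating the multipliers.\<close>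

definition galerkin :: "nat \<Rightarrow> 'a \<Rightarrow> 'a \<Rightarrow> bool" where
  "galerkin k \<phi> l \<longleftrightarrow> l \<in> W k \<and> (\<forall>x\<in>Z k. ip k x l = ip k x \<phi>) \<and>
     (\<forall>x\<in>W k. ip (Suc k) (d k x) (d k l) = ip (Suc k) (d k x) (d k \<phi>))"

text \<open>The derivatives of two solutions have a difference that is a coboundary orthogonal to all
coboundaries; so the difference of the solutions is a cocycle orthogonal to all cocycles.\<close>

lemma galerkin_unique:
  assumes "galerkin k \<phi> l" "galerkin k \<phi> m" shows "l = m"
proof -
  let ?x = "deg.minus k l m"
  have lm: "l \<in> W k" "m \<in> W k" using assms by (auto simp: galerkin_def)
  have "ip (Suc k) (d k ?x) (d k l) = ip (Suc k) (d k ?x) (d k m)"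
    using assms lm by (simp add: galerkin_def)
  then have "d k l = d k m"
    using lm by (intro deg.ip_separates[where k="Suc k"]) (auto simp: d_minus deg.ip_sym)
  then have "d k ?x = zero (Suc k)"
    using lm by (intro deg.eq_by_testing[where k="Suc k"]) (auto simp: d_minus)
  then have "?x \<in> Z k" using lm by (simp add: Z_def del: Z_W Z_d)
  then have "ip k ?x l = ip k ?x m" using assms unfolding galerkin_def by metis
  then show ?thesis
    using lm by (intro deg.ip_separates[where k=k]) (auto simp: deg.ip_sym)
qed

lemma galerkin_exists:
  assumes \<phi>: "\<phi> \<in> H k" shows "\<exists>l. galerkin k \<phi> l"
proof -
  obtain z where z: "z \<in> Z k" "deg.orth k (deg.minus k \<phi> z) (Z k)"
    using deg.projection_exists[OF Z_fin_dim \<phi>] by blast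
  obtain y where y: "y \<in> B k" "deg.orth (Suc k) (deg.minus (Suc k) (d k \<phi>) y) (B k)"
    using deg.projection_exists[OF B_fin_dim d_closed[OF \<phi>]] by blast
  obtain w where w: "w \<in> W k" "deg.orth k w (Z k)" "d k w = y"
    using orth_lift_exists[OF y(1)] by blast
  have "d k (add k z w) = y"
    using z w B_H[OF y(1)] by (intro deg.eq_by_testing[where k="Suc k"]) auto
  moreover have "ip k x (add k z w) = ip k x \<phi>" if "x \<in> Z k" for x
    using that z w \<phi> by (simp add: deg.orth_def)
  moreover have "ip (Suc k) (d k x) y = ip (Suc k) (d k x) (d k \<phi>)" if "x \<in> W k" for x
  proof -
    have "ip (Suc k) (d k x) (deg.minus (Suc k) (d k \<phi>) y) = 0"
      using y(2) B_I[OF that] unfolding deg.orth_def by blast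
    then show ?thesis using that \<phi> B_H[OF y(1)] by simp
  qed
  ultimately have "galerkin k \<phi> (add k z w)" using z w by (simp add: galerkin_def)
  then show ?thesis ..
qed

definition mixed :: "nat \<Rightarrow> 'a \<Rightarrow> 'a \<Rightarrow> 'a \<Rightarrow> 'a \<Rightarrow> 'a \<Rightarrow> bool" where
  "mixed k \<phi> l0 l1 l2 h \<longleftrightarrow>
     l0 \<in> W k \<and> l1 \<in> W (Suc k) \<and> l2 \<in> W (Suc (Suc k)) \<and> h \<in> harm k \<and>
     (\<forall>x\<in>W k. ip k x l0 + ip (Suc k) (d k x) l1 = ip k x \<phi>) \<and>
     (\<forall>x\<in>W (Suc k). ip (Suc k) x (d k l0) + ip (Suc (Suc k)) (d (Suc k) x) l2 + ip (Suc k) x h =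
        ip (Suc k) x (d k \<phi>)) \<and>
     (\<forall>x\<in>W (Suc (Suc k)). ip (Suc (Suc k)) x (d (Suc k) l1) = 0) \<and>
     (\<forall>g\<in>harm k. ip (Suc k) g l1 = 0)"

lemma harm_Z: "h \<in> harm k \<Longrightarrow> h \<in> Z (Suc k)"
  and harm_B: "h \<in> harm k \<Longrightarrow> y \<in> B k \<Longrightarrow> ip (Suc k) y h = 0"
  using B_H[of y k] by (auto simp: harm_def deg.ip_sym)

lemma mixed_imp_galerkin:
  assumes "mixed k \<phi> l0 l1 l2 h" "\<phi> \<in> H k" shows "galerkin k \<phi> l0"
proof -
  have W: "l0 \<in> W k" "l1 \<in> W (Suc k)" "l2 \<in> W (Suc (Suc k))" and h: "h \<in> harm k"
    using assms by (auto simp: mixed_def)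
  have "ip k x l0 = ip k x \<phi>" if "x \<in> Z k" for x
  proof -
    have "ip k x l0 + ip (Suc k) (d k x) l1 = ip k x \<phi>"
      using assms(1) Z_W[OF that] unfolding mixed_def by blast
    then show ?thesis using that W by simp
  qed
  moreover have "ip (Suc k) (d k x) (d k l0) = ip (Suc k) (d k x) (d k \<phi>)" if "x \<in> W k" for x
  proof -
    have "ip (Suc k) (d k x) (d k l0) + ip (Suc (Suc k)) (d (Suc k) (d k x)) l2 + ip (Suc k) (d k x) h =
        ip (Suc k) (d k x) (d k \<phi>)"
      using assms(1) d_W[OF that] unfolding mixed_def by blast
    then show ?thesis using that W harm_B[OF h] by simp
  qed
  ultimately show ?thesis using W by (simp add: galerkin_def)
qed

text \<open>The discrete Hodge decomposition: a cocycle minus its projection onto the coboundaries is harmonic.\<close>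

lemma cocycle_orthogonal:
  assumes r: "r \<in> H (Suc k)" "\<And>y. y \<in> B k \<Longrightarrow> ip (Suc k) y r = 0" "\<And>g. g \<in> harm k \<Longrightarrow> ip (Suc k) g r = 0"
    and x: "x \<in> Z (Suc k)"
  shows "ip (Suc k) x r = 0"
proof -
  have xH: "x \<in> H (Suc k)" using x by simp
  obtain y where y: "y \<in> B k" "deg.orth (Suc k) (deg.minus (Suc k) x y) (B k)"
    using deg.projection_exists[OF B_fin_dim xH] by blast
  let ?g = "deg.minus (Suc k) x y"
  have yH: "y \<in> H (Suc k)" by (rule B_H[OF y(1)])
  have "?g \<in> Z (Suc k)"
    using deg.subspace_minus[OF Z_subspace x] y(1) B_Z by blast
  moreover have "ip (Suc k) ?g b = 0" if "b \<in> B k" for b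
  proof -
    have "ip (Suc k) b ?g = 0" using y(2) that by (auto simp: deg.orth_def)
    then show ?thesis using xH yH B_H[OF that] deg.ip_sym[of b "Suc k" ?g] by simp
  qed
  ultimately have "?g \<in> harm k" by (auto simp: harm_def)
  then have "ip (Suc k) ?g r = 0" by (rule r(3))
  then show ?thesis using r(1) r(2)[OF y(1)] xH yH by simp
qed

lemma galerkin_imp_mixed:
  assumes g: "galerkin k \<phi> l" and \<phi>: "\<phi> \<in> H k"
  shows "\<exists>l1 l2 h. mixed k \<phi> l l1 l2 h"
proof -
  have l: "l \<in> W k" using g by (simp add: galerkin_def)
  have "deg.orth k (deg.minus k \<phi> l) (Z k)"
    using g l \<phi> by (simp add: deg.orth_def galerkin_def)
  (* the multiplier of the first equation absorbs its residual, which vanishes on cocycles *)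
  then obtain l1 where l1: "l1 \<in> B k" "\<And>x. x \<in> W k \<Longrightarrow> ip (Suc k) (d k x) l1 = ip k x (deg.minus k \<phi> l)"
    using solve_for_coboundary[of "deg.minus k \<phi> l" k] l \<phi> by auto
  have l1Z: "l1 \<in> Z (Suc k)" using l1 B_Z by blast
  let ?r = "deg.minus (Suc k) (d k \<phi>) (d k l)"
  have rH: "?r \<in> H (Suc k)" using l \<phi> by simp
  (* h takes the harmonic part of the residual of the second equation; the rest vanishes on cocycles
  and is absorbed by the multiplier l2 *)
  obtain h where h: "h \<in> harm k" "deg.orth (Suc k) (deg.minus (Suc k) ?r h) (harm k)"
    using deg.projection_exists[OF harm_fin_dim rH] by blast
  let ?s = "deg.minus (Suc k) ?r h"
  have hH: "h \<in> H (Suc k)" using harm_Z[OF h(1)] by simp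
  have sH: "?s \<in> H (Suc k)" using rH hH by simp
  have rB: "ip (Suc k) y ?s = 0" if y: "y \<in> B k" for y
  proof -
    obtain x where x: "x \<in> W k" "y = d k x" using y by (auto simp: B_def)
    have "ip (Suc k) y ?r = 0"
      using g x l \<phi> by (simp add: galerkin_def)
    then show ?thesis using rH hH B_H[OF y] harm_B[OF h(1) y] by simp
  qed
  have "deg.orth (Suc k) ?s (Z (Suc k))"
    unfolding deg.orth_def
    using cocycle_orthogonal[OF sH rB] h(2) unfolding deg.orth_def by blast
  then obtain l2 where l2: "l2 \<in> B (Suc k)"
      "\<And>x. x \<in> W (Suc k) \<Longrightarrow> ip (Suc (Suc k)) (d (Suc k) x) l2 = ip (Suc k) x ?s"
    using solve_for_coboundary[OF sH] by blast
  have "mixed k \<phi> l l1 l2 h"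
    unfolding mixed_def
  proof (intro conjI ballI)
    show "l \<in> W k" "h \<in> harm k" by fact+
    show "l1 \<in> W (Suc k)" using l1Z by simp
    show "l2 \<in> W (Suc (Suc k))" using l2 by (auto simp: B_def d_W)
    show "ip k x l + ip (Suc k) (d k x) l1 = ip k x \<phi>" if "x \<in> W k" for x
      using l1(2)[OF that] that l \<phi> by simp
    show "ip (Suc k) x (d k l) + ip (Suc (Suc k)) (d (Suc k) x) l2 + ip (Suc k) x h = ip (Suc k) x (d k \<phi>)"
      if "x \<in> W (Suc k)" for x
      using l2(2)[OF that] that l \<phi> hH by simp
    show "ip (Suc (Suc k)) x (d (Suc k) l1) = 0" if "x \<in> W (Suc (Suc k))" for x
      using that l1Z by simp
    show "ip (Suc k) g l1 = 0" if "g \<in> harm k" for g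
      using that l1 B_H by (auto simp: harm_def)
  qed
  then show ?thesis by blast
qed

lemma ex_mixed_iff_galerkin:
  "\<phi> \<in> H k \<Longrightarrow> (\<exists>l1 l2 h. mixed k \<phi> l l1 l2 h) \<longleftrightarrow> galerkin k \<phi> l"
  using mixed_imp_galerkin galerkin_imp_mixed by blast

lemma galerkin_add:
  assumes "galerkin k \<phi> l" "galerkin k \<psi> m" "\<phi> \<in> H k" "\<psi> \<in> H k"
  shows "galerkin k (add k \<phi> \<psi>) (add k l m)"
  using assms by (simp add: galerkin_def)

lemma galerkin_scale:
  assumes "galerkin k \<phi> l" "\<phi> \<in> H k"
  shows "galerkin k (scale k c \<phi>) (scale k c l)"
  using assms by (simp add: galerkin_def)

lemma galerkin_id: "\<phi> \<in> W k \<Longrightarrow> galerkin k \<phi> \<phi>"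
  by (simp add: galerkin_def)

text \<open>Harmonic elements of the subcomplex being orthogonal to \<^emph>\<open>all\<close> coboundaries of the full complex is
exactly what makes the projections commute with \<open>d\<close>.\<close>

lemma galerkin_commutes:
  assumes harm: "\<And>h \<psi>. h \<in> harm k \<Longrightarrow> \<psi> \<in> H k \<Longrightarrow> ip (Suc k) h (d k \<psi>) = 0"
    and g: "galerkin k \<phi> l" and \<phi>: "\<phi> \<in> H k"
  shows "galerkin (Suc k) (d k \<phi>) (d k l)"
proof -
  have l: "l \<in> W k" using g by (simp add: galerkin_def)
  let ?r = "deg.minus (Suc k) (d k l) (d k \<phi>)"
  have "ip (Suc k) x ?r = 0" if "x \<in> Z (Suc k)" for x
  proof (rule cocycle_orthogonal[OF _ _ _ that])
    show "?r \<in> H (Suc k)" using l \<phi> by simp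
    show "ip (Suc k) y ?r = 0" if "y \<in> B k" for y
      using that g l \<phi> by (auto simp: B_def galerkin_def)
    show "ip (Suc k) h ?r = 0" if "h \<in> harm k" for h
      using harm[OF that] harm_Z[OF that] l \<phi> by simp
  qed
  then show ?thesis using l \<phi> d_W by (simp add: galerkin_def)
qed

text \<open>The seminorm \<open>N\<close> is arbitrary so that the lemma can be applied to the norm of the image under a
further linear map.\<close>

lemma galerkin_bounded:
  assumes N_add: "\<And>x y. x \<in> W k \<Longrightarrow> y \<in> W k \<Longrightarrow> N (add k x y) \<le> N x + N y"
    and N_scale: "\<And>c x. x \<in> W k \<Longrightarrow> N (scale k c x) = \<bar>c\<bar> * N x"
  shows "\<exists>C>0. \<forall>\<phi> l. \<phi> \<in> H k \<longrightarrow> galerkin k \<phi> l \<longrightarrow> N l \<le> C * graph_norm k \<phi>"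
proof -
  (* the linear inverse of d on the orthogonal complement of the cocycles *)
  define T where "T y = (SOME w. w \<in> W k \<and> deg.orth k w (Z k) \<and> d k w = y)" for y
  have T: "T y \<in> W k" "deg.orth k (T y) (Z k)" "d k (T y) = y" if "y \<in> B k" for y
    using someI_ex[of "\<lambda>w. w \<in> W k \<and> deg.orth k w (Z k) \<and> d k w = y"] orth_lift_exists[OF that]
    unfolding T_def by blast+
  obtain C1 where C1: "C1 \<ge> 0" "\<And>z. z \<in> Z k \<Longrightarrow> N z \<le> C1 * deg.nrm k z"
    using deg.seminorm_bounded[OF Z_fin_dim, of k N] N_add N_scale Z_W by metis
  have T_add: "T (add (Suc k) x y) = add k (T x) (T y)" if xy: "x \<in> B k" "y \<in> B k" for x y
  proof -
    have in_B: "add (Suc k) x y \<in> B k" using xy B_subspace by (auto simp: deg.subspace_def)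
    note Tx = T[OF xy(1)] and Ty = T[OF xy(2)] and Txy = T[OF in_B]
    show ?thesis
    proof (rule orth_lift_unique[where k=k])
      show "deg.orth k (add k (T x) (T y)) (Z k)"
        using Tx(1,2) Ty(1,2) unfolding deg.orth_def by (metis add_0 deg.ip_add_right W_H Z_W)
      show "d k (T (add (Suc k) x y)) = d k (add k (T x) (T y))"
        using Tx Ty Txy(3) by simp
    qed (use Tx Ty Txy in auto)
  qed
  have T_scale: "T (scale (Suc k) c x) = scale k c (T x)" if x: "x \<in> B k" for c x
  proof -
    have in_B: "scale (Suc k) c x \<in> B k" using x B_subspace by (auto simp: deg.subspace_def)
    note Tx = T[OF x] and Tcx = T[OF in_B]
    show ?thesis
    proof (rule orth_lift_unique[where k=k])
      show "deg.orth k (scale k c (T x)) (Z k)"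
        using Tx(1,2) unfolding deg.orth_def by simp
      show "d k (T (scale (Suc k) c x)) = d k (scale k c (T x))"
        using Tx Tcx(3) by simp
    qed (use Tx Tcx in auto)
  qed
  have "\<exists>C\<ge>0. \<forall>y\<in>B k. N (T y) \<le> C * deg.nrm (Suc k) y"
    using T by (intro deg.seminorm_bounded[OF B_fin_dim]) (auto simp: T_add T_scale N_add N_scale)
  then obtain C2 where C2: "C2 \<ge> 0" "\<And>y. y \<in> B k \<Longrightarrow> N (T y) \<le> C2 * deg.nrm (Suc k) y"
    by blast
  have "N l \<le> (C1 + C2 + 1) * graph_norm k \<phi>" if \<phi>: "\<phi> \<in> H k" and g: "galerkin k \<phi> l" for \<phi> l
  proof -
    have l: "l \<in> W k" using g by (simp add: galerkin_def)
    let ?w = "T (d k l)"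
    (* l is split into its component z in Z k and its component w orthogonal to Z k *)
    let ?z = "deg.minus k l ?w"
    have w: "?w \<in> W k" "deg.orth k ?w (Z k)" "d k ?w = d k l" using T[of "d k l"] l by auto
    have "d k ?z = zero (Suc k)"
      using l w by (intro deg.eq_by_testing[where k="Suc k"]) (auto simp: d_minus)
    then have z: "?z \<in> Z k" using l w by (simp add: Z_def del: Z_W Z_d)
    have zH: "?z \<in> H k" using z by simp
    have lzw: "l = add k ?z ?w"
      using l w by (intro deg.eq_by_testing[where k=k]) auto
    (* for dividing the Cauchy-Schwarz estimates below by a possibly vanishing norm *)
    have cancel: "a \<le> b" if "a\<^sup>2 \<le> a * b" "0 \<le> a" "0 \<le> b" for a b :: real
      using that by (cases "a = 0") (auto simp: power2_eq_square)
    have "ip k ?z ?w = 0" using w(2) z by (auto simp: deg.orth_def)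
    moreover have "ip k ?z l = ip k ?z \<phi>" using g z unfolding galerkin_def by blast
    ultimately have "ip k ?z ?z = ip k ?z \<phi>"
      using deg.ip_minus_right[OF W_H[OF l] W_H[OF w(1)] zH] by linarith
    also have "\<dots> \<le> deg.nrm k ?z * deg.nrm k \<phi>" using deg.abs_ip_le[OF zH \<phi>] by simp
    finally have "(deg.nrm k ?z)\<^sup>2 \<le> deg.nrm k ?z * deg.nrm k \<phi>"
      using zH by (simp add: deg.nrm_def)
    then have 1: "deg.nrm k ?z \<le> deg.nrm k \<phi>" using cancel zH \<phi> by simp
    have "ip (Suc k) (d k l) (d k l) = ip (Suc k) (d k l) (d k \<phi>)"
      using g l by (simp add: galerkin_def)
    also have "\<dots> \<le> deg.nrm (Suc k) (d k l) * deg.nrm (Suc k) (d k \<phi>)"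
      using deg.abs_ip_le[of "d k l" "Suc k" "d k \<phi>"] l \<phi> by simp
    finally have "(deg.nrm (Suc k) (d k l))\<^sup>2 \<le> deg.nrm (Suc k) (d k l) * deg.nrm (Suc k) (d k \<phi>)"
      using l by (simp add: deg.nrm_def)
    then have 2: "deg.nrm (Suc k) (d k l) \<le> deg.nrm (Suc k) (d k \<phi>)" using cancel l \<phi> by simp
    have 3: "deg.nrm k \<phi> \<le> graph_norm k \<phi>" "deg.nrm (Suc k) (d k \<phi>) \<le> graph_norm k \<phi>"
      using nrm_le_graph_norm[OF \<phi>] by auto
    have 4: "0 \<le> graph_norm k \<phi>" by (simp add: graph_norm_def)
    have "N l \<le> N ?z + N ?w" using N_add[OF Z_W[OF z] w(1)] lzw by simp
    also have "\<dots> \<le> C1 * deg.nrm k ?z + C2 * deg.nrm (Suc k) (d k l)"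
      using C1(2)[OF z] C2(2)[of "d k l"] l by simp
    also have "\<dots> \<le> C1 * graph_norm k \<phi> + C2 * graph_norm k \<phi>"
      using 1 2 3 C1 C2 by (intro add_mono mult_left_mono) auto
    finally show ?thesis using 4 by (simp add: algebra_simps)
  qed
  then show ?thesis using C1(1) C2(1) by (intro exI[of _ "C1 + C2 + 1"]) auto
qed

end

section \<open>Smooth functions and the fundamental lemma of the calculus of variations\<close>

abbreviation dirderiv :: "('a::euclidean_space \<Rightarrow> 'b::real_normed_vector) \<Rightarrow> 'a \<Rightarrow> 'a \<Rightarrow> 'b" where
  "dirderiv u v x \<equiv> frechet_derivative u (at x) v"

lemma smooth_differentiable: "smooth_on UNIV u \<Longrightarrow> u differentiable (at x)"
  unfolding smooth_on_def using Cr_on.simps(2)[of 0 UNIV u] by blast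

lemma smooth_dirderiv: "smooth_on UNIV u \<Longrightarrow> smooth_on UNIV (dirderiv u v)"
  unfolding smooth_on_def using Cr_on.simps(2)[of _ UNIV u] by blast

lemma smooth_continuous: "smooth_on S u \<Longrightarrow> continuous_on S u"
  unfolding smooth_on_def by (metis Cr_on.simps(1))

lemma DERIV_along_line:
  fixes u :: "'a::euclidean_space \<Rightarrow> real"
  assumes "smooth_on UNIV u"
  shows "((\<lambda>s. u (y + s *\<^sub>R v)) has_real_derivative dirderiv u v (y + s *\<^sub>R v)) (at s)"
proof -
  have "(u has_derivative frechet_derivative u (at (y + s *\<^sub>R v))) (at (y + s *\<^sub>R v))"
    using smooth_differentiable[OF assms] frechet_derivative_works by blast
  then have "((\<lambda>s. u (y + s *\<^sub>R v)) has_derivative (\<lambda>t. frechet_derivative u (at (y + s *\<^sub>R v)) (t *\<^sub>R v))) (at s)"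
    by (rule has_derivative_compose[rotated]) (auto intro!: derivative_eq_intros)
  moreover have "frechet_derivative u (at (y + s *\<^sub>R v)) (t *\<^sub>R v) = t * dirderiv u v (y + s *\<^sub>R v)" for t
    using linear_frechet_derivative[OF smooth_differentiable[OF assms]] by (simp add: linear_cmul)
  then have "frechet_derivative u (at (y + s *\<^sub>R v)) (t *\<^sub>R v) = dirderiv u v (y + s *\<^sub>R v) * t" for t
    by (simp add: mult.commute)
  ultimately show ?thesis by (simp add: has_field_derivative_def)
qed

text \<open>Two applications of the mean value theorem.  The left-hand side is symmetric in \<open>v\<close> and \<open>w\<close>, which
gives the symmetry of second derivatives as \<open>h\<close> tends to zero.\<close>

lemma second_difference:
  fixes u :: "'a::euclidean_space \<Rightarrow> real"
  assumes u: "smooth_on UNIV u" and h: "0 < h"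
  shows "\<exists>s t. 0 < s \<and> s < h \<and> 0 < t \<and> t < h \<and>
    u (x + h *\<^sub>R v + h *\<^sub>R w) - u (x + h *\<^sub>R v) - u (x + h *\<^sub>R w) + u x =
      h * h * dirderiv (dirderiv u v) w (x + s *\<^sub>R v + t *\<^sub>R w)"
proof -
  define g where "g s = u ((x + h *\<^sub>R w) + s *\<^sub>R v) - u (x + s *\<^sub>R v)" for s
  have "\<exists>s>0. s < h \<and> g h - g 0 =
      (h - 0) * (dirderiv u v ((x + h *\<^sub>R w) + s *\<^sub>R v) - dirderiv u v (x + s *\<^sub>R v))"
    unfolding g_def
    by (rule MVT2[OF h]) (intro DERIV_diff DERIV_along_line[OF u])
  then obtain s where s: "0 < s" "s < h" "g h - g 0 =
      h * (dirderiv u v ((x + h *\<^sub>R w) + s *\<^sub>R v) - dirderiv u v (x + s *\<^sub>R v))" by auto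
  have "\<exists>t>0. t < h \<and> dirderiv u v ((x + s *\<^sub>R v) + h *\<^sub>R w) - dirderiv u v ((x + s *\<^sub>R v) + 0 *\<^sub>R w) =
      (h - 0) * dirderiv (dirderiv u v) w ((x + s *\<^sub>R v) + t *\<^sub>R w)"
    by (rule MVT2[OF h]) (intro DERIV_along_line[OF smooth_dirderiv[OF u]])
  then obtain t where t: "0 < t" "t < h" "dirderiv u v ((x + s *\<^sub>R v) + h *\<^sub>R w) - dirderiv u v (x + s *\<^sub>R v) =
      h * dirderiv (dirderiv u v) w ((x + s *\<^sub>R v) + t *\<^sub>R w)" by auto
  have "g h - g 0 = h * (h * dirderiv (dirderiv u v) w ((x + s *\<^sub>R v) + t *\<^sub>R w))"
    using s(3) t(3) by (simp add: add_ac)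
  then show ?thesis
    using s(1,2) t(1,2) by (intro exI[of _ s] exI[of _ t]) (simp add: g_def add_ac)
qed

lemma mixed_derivatives_commute:
  fixes u :: "'a::euclidean_space \<Rightarrow> real"
  assumes u: "smooth_on UNIV u"
  shows "dirderiv (dirderiv u v) w x = dirderiv (dirderiv u w) v x"
proof -
  define h where "h n = inverse (real (Suc n))" for n
  have h0: "h n > 0" for n by (simp add: h_def)
  have hlim: "h \<longlonglongrightarrow> 0" unfolding h_def by (rule LIMSEQ_inverse_real_of_nat)
  obtain s t where st: "\<And>n. 0 < s n" "\<And>n. s n < h n" "\<And>n. 0 < t n" "\<And>n. t n < h n"
    and 1: "\<And>n. u (x + h n *\<^sub>R v + h n *\<^sub>R w) - u (x + h n *\<^sub>R v) - u (x + h n *\<^sub>R w) + u x =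
      h n * h n * dirderiv (dirderiv u v) w (x + s n *\<^sub>R v + t n *\<^sub>R w)"
    using second_difference[OF u h0, where x=x and v=v and w=w] by metis
  obtain s' t' where st': "\<And>n. 0 < s' n" "\<And>n. s' n < h n" "\<And>n. 0 < t' n" "\<And>n. t' n < h n"
    and 2: "\<And>n. u (x + h n *\<^sub>R w + h n *\<^sub>R v) - u (x + h n *\<^sub>R w) - u (x + h n *\<^sub>R v) + u x =
      h n * h n * dirderiv (dirderiv u w) v (x + s' n *\<^sub>R w + t' n *\<^sub>R v)"
    using second_difference[OF u h0, where x=x and v=w and w=v] by metis
  have eq: "dirderiv (dirderiv u v) w (x + s n *\<^sub>R v + t n *\<^sub>R w) =
      dirderiv (dirderiv u w) v (x + s' n *\<^sub>R w + t' n *\<^sub>R v)" for n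
  proof -
    have "h n * h n * dirderiv (dirderiv u v) w (x + s n *\<^sub>R v + t n *\<^sub>R w) =
        h n * h n * dirderiv (dirderiv u w) v (x + s' n *\<^sub>R w + t' n *\<^sub>R v)"
      unfolding 1[symmetric] 2[symmetric] by (simp add: add_ac)
    then show ?thesis using h0[of n] by simp
  qed
  have lim0: "f \<longlonglongrightarrow> 0" if "\<And>n. 0 < f n" "\<And>n. f n < h n" for f :: "nat \<Rightarrow> real"
    by (rule tendsto_sandwich[OF _ _ tendsto_const hlim])
       (use that in \<open>auto intro!: always_eventually less_imp_le\<close>)
  have cont: "isCont (dirderiv (dirderiv u v) w) x" for v w
    using smooth_continuous[OF smooth_dirderiv[OF smooth_dirderiv[OF u]]]
    by (simp add: continuous_on_eq_continuous_at)
  have "(\<lambda>n. x + s n *\<^sub>R v + t n *\<^sub>R w) \<longlonglongrightarrow> x + 0 *\<^sub>R v + 0 *\<^sub>R w"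
    by (intro tendsto_intros lim0 st)
  then have "(\<lambda>n. dirderiv (dirderiv u v) w (x + s n *\<^sub>R v + t n *\<^sub>R w)) \<longlonglongrightarrow> dirderiv (dirderiv u v) w x"
    by (intro isCont_tendsto_compose[OF cont]) simp
  moreover have "(\<lambda>n. x + s' n *\<^sub>R w + t' n *\<^sub>R v) \<longlonglongrightarrow> x + 0 *\<^sub>R w + 0 *\<^sub>R v"
    by (intro tendsto_intros lim0 st')
  then have "(\<lambda>n. dirderiv (dirderiv u w) v (x + s' n *\<^sub>R w + t' n *\<^sub>R v)) \<longlonglongrightarrow> dirderiv (dirderiv u w) v x"
    by (intro isCont_tendsto_compose[OF cont]) simp
  ultimately show ?thesis unfolding eq by (rule LIMSEQ_unique)
qed

lemma Cr_on_Suc_imp: "Cr_on (Suc r) UNIV f \<Longrightarrow> Cr_on r UNIV f"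
proof (induction r arbitrary: f)
  case 0
  then show ?case
    by (auto intro!: continuous_at_imp_continuous_on differentiable_imp_continuous_within)
next
  case (Suc r)
  then show ?case by (metis Cr_on.simps(2))
qed

lemma Cr_on_const: "Cr_on r UNIV (\<lambda>x. c)"
proof (induction r arbitrary: c)
  case (Suc r)
  have "frechet_derivative (\<lambda>x. c) (at x) = (\<lambda>h. 0)" for x :: 'a
    by (rule frechet_derivative_at[symmetric]) (rule has_derivative_const)
  then show ?case using Suc by simp
qed simp

lemma Cr_on_add:
  "Cr_on r UNIV f \<Longrightarrow> Cr_on r UNIV g \<Longrightarrow> Cr_on r UNIV (\<lambda>x. f x + g x)"
proof (induction r arbitrary: f g)
  case 0
  then show ?case by (auto intro!: continuous_intros)
next
  case (Suc r)
  have "dirderiv (\<lambda>x. f x + g x) v x = dirderiv f v x + dirderiv g v x" for v x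
  proof -
    have "((\<lambda>x. f x + g x) has_derivative (\<lambda>h. frechet_derivative f (at x) h + frechet_derivative g (at x) h)) (at x)"
      using Suc.prems by (intro has_derivative_add) (auto simp: frechet_derivative_works)
    from frechet_derivative_at[OF this] show ?thesis by metis
  qed
  then have "dirderiv (\<lambda>x. f x + g x) v = (\<lambda>x. dirderiv f v x + dirderiv g v x)" for v by blast
  then show ?case using Suc by (auto intro: differentiable_add)
qed

lemma Cr_on_mult:
  fixes f g :: "'a::euclidean_space \<Rightarrow> real"
  shows "Cr_on r UNIV f \<Longrightarrow> Cr_on r UNIV g \<Longrightarrow> Cr_on r UNIV (\<lambda>x. f x * g x)"
proof (induction r arbitrary: f g)
  case 0
  then show ?case by (auto intro!: continuous_intros)
next
  case (Suc r)
  have "dirderiv (\<lambda>x. f x * g x) v x = f x * dirderiv g v x + dirderiv f v x * g x" for v x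
  proof -
    have "((\<lambda>x. f x * g x) has_derivative (\<lambda>h. f x * frechet_derivative g (at x) h + frechet_derivative f (at x) h * g x)) (at x)"
      using Suc.prems by (intro has_derivative_mult) (auto simp: frechet_derivative_works)
    from frechet_derivative_at[OF this] show ?thesis by metis
  qed
  then have "dirderiv (\<lambda>x. f x * g x) v = (\<lambda>x. f x * dirderiv g v x + dirderiv f v x * g x)" for v by blast
  moreover have "Cr_on r UNIV (\<lambda>x. f x * dirderiv g v x + dirderiv f v x * g x)" for v
    using Suc.prems by (intro Cr_on_add Suc.IH) (auto intro: Cr_on_Suc_imp simp del: Cr_on.simps(2) simp: Cr_on.simps(2)[of r UNIV g] Cr_on.simps(2)[of r UNIV f])
  ultimately show ?case using Suc.prems by (auto intro: differentiable_mult)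
qed

lemma Cr_on_prod:
  fixes f :: "'i \<Rightarrow> 'a::euclidean_space \<Rightarrow> real"
  assumes "\<And>i. i \<in> I \<Longrightarrow> Cr_on r UNIV (f i)"
  shows "Cr_on r UNIV (\<lambda>x. \<Prod>i\<in>I. f i x)"
  using assms by (induction I rule: infinite_finite_induct) (auto intro: Cr_on_const Cr_on_mult)

text \<open>The derivatives of \<open>exp (- 1 / t)\<close>, extended by zero, are linear combinations of these functions;
the family is closed under differentiation up to linear combinations.\<close>

definition flat :: "nat \<Rightarrow> real \<Rightarrow> real" where
  "flat m t = (if 0 < t then exp (- (1 / t)) / t ^ m else 0)"

lemma power_le_fact_exp:
  assumes "0 \<le> (y::real)" shows "y ^ n \<le> fact n * exp y"
proof -
  have "y ^ n / fact n = (\<Sum>k\<in>{n}. y ^ k / fact k)" by simp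
  also have "\<dots> \<le> (\<Sum>k. y ^ k / fact k)"
    using assms summable_exp_generic[of y] by (intro sum_le_suminf) (auto simp: divide_inverse_commute)
  also have "\<dots> = exp y" by (simp add: exp_def divide_inverse_commute)
  finally show ?thesis by (simp add: field_simps)
qed

text \<open>The exponential beats every power.  For \<open>n = 2\<close> this gives differentiability at the origin.\<close>

lemma flat_le_power: "\<bar>flat m t\<bar> \<le> fact (m + n) * \<bar>t\<bar> ^ n"
proof (cases "0 < t")
  case True
  have "(1 / t) ^ (m + n) \<le> fact (m + n) * exp (1 / t)"
    using True by (intro power_le_fact_exp) simp
  then have "exp (- (1 / t)) / t ^ m \<le> fact (m + n) * t ^ n"
    using True by (simp add: exp_minus field_simps power_add)
  then show ?thesis using True by (simp add: flat_def)
qed (simp add: flat_def)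

lemma flat_DERIV:
  "(flat m has_real_derivative (flat (Suc (Suc m)) t - real m * flat (Suc m) t)) (at t)"
proof -
  consider "0 < t" | "t < 0" | "t = 0" by linarith
  then show ?thesis
  proof cases
    case 1
    have "((\<lambda>s. exp (- s) * s ^ m) has_real_derivative
        exp (- s) * (real m * s ^ (m - 1)) - exp (- s) * s ^ m) (at s)" for s :: real
      by (auto intro!: derivative_eq_intros)
    moreover have "((\<lambda>t. 1 / t) has_real_derivative - ((1 / t)\<^sup>2)) (at t)"
      using 1 by (auto intro!: derivative_eq_intros simp: power2_eq_square)
    ultimately have "((\<lambda>t. exp (- (1 / t)) * (1 / t) ^ m) has_real_derivative
        (exp (- (1 / t)) * (real m * (1 / t) ^ (m - 1)) - exp (- (1 / t)) * (1 / t) ^ m) * - ((1 / t)\<^sup>2)) (at t)"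
      by (rule DERIV_chain2)
    moreover have "(exp (- s) * (real m * s ^ (m - 1)) - exp (- s) * s ^ m) * - (s\<^sup>2) =
        exp (- s) * s ^ Suc (Suc m) - real m * (exp (- s) * s ^ Suc m)" for s :: real
      by (cases m) (simp_all add: algebra_simps power2_eq_square)
    ultimately have "((\<lambda>t. exp (- (1 / t)) / t ^ m) has_real_derivative
        (flat (Suc (Suc m)) t - real m * flat (Suc m) t)) (at t)"
      using 1 by (simp add: flat_def divide_inverse flip: power_inverse)
    then show ?thesis
      by (rule has_field_derivative_transform_within_open[where S="{0<..}"]) (use 1 in \<open>auto simp: flat_def\<close>)
  next
    case 2
    have "((\<lambda>t. 0) has_real_derivative (flat (Suc (Suc m)) t - real m * flat (Suc m) t)) (at t)"
      using 2 by (simp add: flat_def)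
    then show ?thesis
      by (rule has_field_derivative_transform_within_open[where S="{..<0}"]) (use 2 in \<open>auto simp: flat_def\<close>)
  next
    case 3
    have "((\<lambda>h. (flat m (0 + h) - flat m 0) / h) \<longlongrightarrow> 0) (at 0)"
    proof (rule Lim_null_comparison)
      show "eventually (\<lambda>h. norm ((flat m (0 + h) - flat m 0) / h) \<le> fact (m + 2) * \<bar>h\<bar>) (at 0)"
      proof (rule always_eventually, rule allI)
        fix h :: real
        show "norm ((flat m (0 + h) - flat m 0) / h) \<le> fact (m + 2) * \<bar>h\<bar>"
        proof (cases "h = 0")
          case False
          have "\<bar>flat m h\<bar> \<le> (fact (m + 2) * \<bar>h\<bar>) * \<bar>h\<bar>"
            using flat_le_power[of m h 2] by (simp only: power2_eq_square mult.assoc)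
          then have "\<bar>flat m h\<bar> / \<bar>h\<bar> \<le> fact (m + 2) * \<bar>h\<bar>"
            using False by (simp only: pos_divide_le_eq zero_less_abs_iff not_False_eq_True)
          then show ?thesis by (simp only: flat_def[of m 0] add_0 real_norm_def abs_divide less_irrefl if_False diff_0_right)
        qed simp
      qed
      show "((\<lambda>h. fact (m + 2) * \<bar>h\<bar>) \<longlongrightarrow> (0::real)) (at 0)"
        by (auto intro!: tendsto_eq_intros)
    qed
    then show ?thesis using 3 by (simp add: DERIV_def flat_def[of _ 0])
  qed
qed

lemma Cr_on_flat_affine:
  fixes e :: "'a::euclidean_space"
  shows "Cr_on r UNIV (\<lambda>x. flat m (x \<bullet> e + c))"
proof (induction r arbitrary: m)
  case 0
  have "continuous_on UNIV (flat m)"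
    using flat_DERIV by (intro continuous_at_imp_continuous_on ballI) (rule DERIV_isCont)
  then show ?case
    by (auto intro!: continuous_on_compose2[of UNIV "flat m"] continuous_intros)
next
  case (Suc r)
  have der: "((\<lambda>x. flat m (x \<bullet> e + c)) has_derivative
     (\<lambda>v. (v \<bullet> e) * (flat (Suc (Suc m)) (x \<bullet> e + c) - real m * flat (Suc m) (x \<bullet> e + c)))) (at x)" for x
  proof -
    have "(flat m has_derivative (\<lambda>h. h * (flat (Suc (Suc m)) (x \<bullet> e + c) - real m * flat (Suc m) (x \<bullet> e + c))))
        (at (x \<bullet> e + c))"
      using flat_DERIV[of m "x \<bullet> e + c"] unfolding has_field_derivative_def
      by (rule has_derivative_eq_rhs) (simp add: fun_eq_iff mult.commute)
    then show ?thesis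
      by (rule has_derivative_compose[rotated]) (auto intro!: derivative_eq_intros)
  qed
  have "dirderiv (\<lambda>x. flat m (x \<bullet> e + c)) v =
     (\<lambda>x. (v \<bullet> e) * (flat (Suc (Suc m)) (x \<bullet> e + c) + (- real m) * flat (Suc m) (x \<bullet> e + c)))" for v
    using frechet_derivative_at[OF der] by (auto simp: fun_eq_iff)
  moreover have "Cr_on r UNIV (\<lambda>x. (v \<bullet> e) * (flat (Suc (Suc m)) (x \<bullet> e + c) + (- real m) * flat (Suc m) (x \<bullet> e + c)))" for v
    by (intro Cr_on_mult Cr_on_add Cr_on_const Suc)
  ultimately show ?case using der by (auto simp: differentiable_def)
qed

text \<open>As \<open>n\<close> grows, \<open>exp (- 1 / (n t))\<close> increases to \<open>1\<close> for every \<open>t > 0\<close>.  So these functions, which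
vanish outside \<open>box a b\<close> and are bounded by \<open>1\<close>, converge to its indicator without any convolution.\<close>

definition bump :: "real ^ 'n \<Rightarrow> real ^ 'n \<Rightarrow> nat \<Rightarrow> real ^ 'n \<Rightarrow> real" where
  "bump a b n x = (\<Prod>i\<in>UNIV. flat 0 (real (Suc n) * (x $ i - a $ i)) * flat 0 (real (Suc n) * (b $ i - x $ i)))"

lemma bump_smooth: "smooth_on UNIV (bump a b n)"
proof -
  have "Cr_on r UNIV (\<lambda>x::real^'a. flat 0 (real (Suc n) * (x $ i - a $ i)))" for r i
    using Cr_on_flat_affine[of r 0 "axis i (real (Suc n))" "- real (Suc n) * a $ i"]
    by (simp add: inner_axis algebra_simps)
  moreover have "Cr_on r UNIV (\<lambda>x::real^'a. flat 0 (real (Suc n) * (b $ i - x $ i)))" for r i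
    using Cr_on_flat_affine[of r 0 "axis i (- real (Suc n))" "real (Suc n) * b $ i"]
    by (simp add: inner_axis algebra_simps)
  ultimately show ?thesis
    unfolding smooth_on_def bump_def by (intro allI Cr_on_prod Cr_on_mult)
qed

lemma flat_0_bounds: "0 \<le> flat 0 t" "flat 0 t \<le> 1"
  by (auto simp: flat_def)

lemma bump_bounds: "0 \<le> bump a b n x" "bump a b n x \<le> 1"
  unfolding bump_def
  by (auto intro!: prod_nonneg prod_le_1 mult_nonneg_nonneg mult_le_one flat_0_bounds)

lemma bump_outside: "x \<notin> box a b \<Longrightarrow> bump a b n x = 0"
proof -
  assume "x \<notin> box a b"
  then obtain i where "\<not> (a $ i < x $ i \<and> x $ i < b $ i)" by (auto simp: mem_box_cart)
  then have "flat 0 (real (Suc n) * (x $ i - a $ i)) * flat 0 (real (Suc n) * (b $ i - x $ i)) = 0"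
    by (auto simp: flat_def zero_less_mult_iff)
  then show ?thesis unfolding bump_def by (intro prod_zero) auto
qed

lemma bump_tendsto: "(\<lambda>n. bump a b n x) \<longlonglongrightarrow> indicator (box a b) x"
proof (cases "x \<in> box a b")
  case False
  then show ?thesis by (simp add: bump_outside)
next
  case True
  have "(\<lambda>n. flat 0 (real (Suc n) * t)) \<longlonglongrightarrow> 1" if "0 < t" for t
  proof -
    have "(\<lambda>n. exp (- (inverse (real (Suc n)) * (1 / t)))) \<longlonglongrightarrow> exp (- (0 * (1 / t)))"
      by (intro tendsto_intros LIMSEQ_inverse_real_of_nat)
    moreover have "flat 0 (real (Suc n) * t) = exp (- (inverse (real (Suc n)) * (1 / t)))" for n
      using that by (simp add: flat_def field_simps zero_less_mult_iff del: of_nat_Suc)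
    ultimately show ?thesis by simp
  qed
  then have "(\<lambda>n. bump a b n x) \<longlonglongrightarrow> (\<Prod>i\<in>(UNIV::'a set). 1 * 1)"
    unfolding bump_def using True by (intro tendsto_prod tendsto_mult) (auto simp: mem_box_cart)
  then show ?thesis using True by simp
qed

lemma bump_test_function: "cbox a b \<subseteq> D \<Longrightarrow> test_function D (bump a b n)"
  unfolding test_function_def
proof (intro conjI exI[of _ "cbox a b"] allI impI)
  show "smooth_on UNIV (bump a b n)" by (rule bump_smooth)
  show "bump a b n x = 0" if "x \<notin> cbox a b" for x
    using that box_subset_cbox[of a b] by (intro bump_outside) auto
qed (auto simp: compact_cbox)

text \<open>The positive and the negative part of \<open>h\<close> are densities of finite measures that agree on the boxes,
an intersection stable generator of the Borel sets.\<close>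

lemma zero_integral_on_boxes_imp_AE_zero:
  fixes h :: "real ^ 'n \<Rightarrow> real"
  assumes h: "integrable lborel h" and box: "\<And>a b. (LINT x : box a b | lborel. h x) = 0"
  shows "AE x in lborel. h x = 0"
proof -
  define p where "p x = max 0 (h x)" for x
  define q where "q x = max 0 (- h x)" for x
  have pq: "integrable lborel p" "integrable lborel q"
    unfolding p_def q_def using h by auto
  have pqm: "(\<lambda>x. ennreal (p x)) \<in> borel_measurable lborel" "(\<lambda>x. ennreal (q x)) \<in> borel_measurable lborel"
    using pq by (auto dest: borel_measurable_integrable)
  have hpq: "h x = p x - q x" for x by (simp add: p_def q_def)
  have eq: "emeasure (density lborel p) (box a b) = emeasure (density lborel q) (box a b)" for a b
  proof -
    have ip: "set_integrable lborel (box a b) p" "set_integrable lborel (box a b) q"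
      unfolding set_integrable_def by (rule integrable_mult_indicator[OF _ pq(1)], simp)
        (rule integrable_mult_indicator[OF _ pq(2)], simp)
    have "(LINT x : box a b | lborel. p x) - (LINT x : box a b | lborel. q x) = 0"
      using set_integral_diff(2)[OF ip] box[of a b] hpq by simp
    moreover have "emeasure (density lborel p) (box a b) = ennreal (LINT x : box a b | lborel. p x)"
    proof -
      have "emeasure (density lborel p) (box a b) = (\<integral>\<^sup>+x. ennreal (indicator (box a b) x *\<^sub>R p x) \<partial>lborel)"
        using pqm by (subst emeasure_density) (auto intro!: nn_integral_cong simp: indicator_def)
      also have "\<dots> = ennreal (LINT x : box a b | lborel. p x)"
        unfolding set_lebesgue_integral_def
        using ip(1) by (intro nn_integral_eq_integral) (auto simp: set_integrable_def p_def indicator_def)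
      finally show ?thesis .
    qed
    moreover have "emeasure (density lborel q) (box a b) = ennreal (LINT x : box a b | lborel. q x)"
    proof -
      have "emeasure (density lborel q) (box a b) = (\<integral>\<^sup>+x. ennreal (indicator (box a b) x *\<^sub>R q x) \<partial>lborel)"
        using pqm by (subst emeasure_density) (auto intro!: nn_integral_cong simp: indicator_def)
      also have "\<dots> = ennreal (LINT x : box a b | lborel. q x)"
        unfolding set_lebesgue_integral_def
        using ip(2) by (intro nn_integral_eq_integral) (auto simp: set_integrable_def q_def indicator_def)
      finally show ?thesis .
    qed
    ultimately show ?thesis by simp
  qed
  have fin: "(\<integral>\<^sup>+x. ennreal (p x) \<partial>lborel) \<noteq> \<infinity>"
    using pq(1) by (subst nn_integral_eq_integral) (auto simp: p_def)
  have "density lborel p = density lborel q"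
  proof (rule measure_eqI_generator_eq)
    let ?E = "range (\<lambda>(a, b). box a b :: (real^'n) set)"
    show "Int_stable ?E" by (auto simp: Int_stable_def box_Int_box)
    show "?E \<subseteq> Pow UNIV" "sets (density lborel p) = sigma_sets UNIV ?E" "sets (density lborel q) = sigma_sets UNIV ?E"
      by (simp_all add: borel_eq_box)
    show "emeasure (density lborel p) X = emeasure (density lborel q) X" if "X \<in> ?E" for X
      using that eq by auto
    let ?A = "\<lambda>n::nat. box (- (real n *\<^sub>R One)) (real n *\<^sub>R One) :: (real^'n) set"
    show "range ?A \<subseteq> ?E" "(\<Union>i. ?A i) = UNIV"
      unfolding UN_box_eq_UNIV by auto
    show "emeasure (density lborel p) (?A i) \<noteq> \<infinity>" for i
    proof -
      have "emeasure (density lborel p) (?A i) \<le> emeasure (density lborel p) (space (density lborel p))"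
        by (rule emeasure_mono) auto
      also have "\<dots> = (\<integral>\<^sup>+x. ennreal (p x) \<partial>lborel)"
        using pqm by (subst emeasure_density) auto
      also have "\<dots> < \<infinity>" using fin by (simp add: less_top)
      finally show ?thesis by simp 
    qed
  qed
  then have "AE x in lborel. ennreal (p x) = ennreal (q x)"
    using finite_density_unique[OF pqm _ _ fin] by auto
  then show ?thesis
    by eventually_elim (auto simp: p_def q_def max_def split: if_splits)
qed

text \<open>Dominated convergence along the bump functions yields that \<open>g\<close> has integral zero over every box whose
closure lies in \<open>D\<close>; countably many of these boxes cover \<open>D\<close>.\<close>

lemma fundamental_lemma:
  fixes g :: "real ^ 'n \<Rightarrow> real"
  assumes D: "open D"
    and g: "\<And>K. compact K \<Longrightarrow> K \<subseteq> D \<Longrightarrow> set_integrable lborel K g"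
    and test: "\<And>u. test_function D u \<Longrightarrow> (LINT x : D | lborel. g x * u x) = 0"
  shows "AE x in lborel. x \<in> D \<longrightarrow> g x = 0"
proof -
  have box0: "(LINT x : box a b | lborel. g x) = 0" if ab: "cbox a b \<subseteq> D" for a b
  proof -
    have gi: "set_integrable lborel (cbox a b) g" by (rule g[OF compact_cbox ab])
    have sub: "indicator D x * bump a b n x = indicator (cbox a b) x * bump a b n x" for n x
      using ab bump_outside[of x a b n] box_subset_cbox[of a b] by (auto simp: indicator_def)
    have "(\<lambda>n. LINT x | lborel. (indicator (cbox a b) x *\<^sub>R g x) * bump a b n x) \<longlonglongrightarrow>
        (LINT x | lborel. (indicator (cbox a b) x *\<^sub>R g x) * indicator (box a b) x)"
    proof (rule integral_dominated_convergence[where w="\<lambda>x. norm (indicator (cbox a b) x *\<^sub>R g x)"])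
      have [measurable]: "(\<lambda>x. indicator (cbox a b) x *\<^sub>R g x) \<in> borel_measurable lborel"
        using gi by (auto simp: set_integrable_def)
      have [measurable]: "bump a b n \<in> borel_measurable lborel" for n
        using borel_measurable_continuous_onI[OF smooth_continuous[OF bump_smooth[of a b n]]] by simp
      show "(\<lambda>x. indicator (cbox a b) x *\<^sub>R g x * indicator (box a b) x) \<in> borel_measurable lborel"
        "\<And>n. (\<lambda>x. indicator (cbox a b) x *\<^sub>R g x * bump a b n x) \<in> borel_measurable lborel"
        by measurable
      show "integrable lborel (\<lambda>x. norm (indicator (cbox a b) x *\<^sub>R g x))"
        using gi by (auto simp: set_integrable_def)
      show "AE x in lborel. (\<lambda>n. indicator (cbox a b) x *\<^sub>R g x * bump a b n x) \<longlonglongrightarrow>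
          indicator (cbox a b) x *\<^sub>R g x * indicator (box a b) x"
        by (intro AE_I2 tendsto_intros bump_tendsto)
      show "AE x in lborel. norm (indicator (cbox a b) x *\<^sub>R g x * bump a b n x)
          \<le> norm (indicator (cbox a b) x *\<^sub>R g x)" for n
        using bump_bounds[of a b n] by (intro AE_I2) (auto simp: abs_mult intro!: mult_left_le)
    qed
    moreover have "(LINT x | lborel. (indicator (cbox a b) x *\<^sub>R g x) * bump a b n x) = 0" for n
    proof -
      have "(LINT x | lborel. (indicator (cbox a b) x *\<^sub>R g x) * bump a b n x) = (LINT x : D | lborel. g x * bump a b n x)"
        unfolding set_lebesgue_integral_def
      proof (intro Bochner_Integration.integral_cong refl)
        fix x
        have "(indicator (cbox a b) x *\<^sub>R g x) * bump a b n x = g x * (indicator (cbox a b) x * bump a b n x)" by simp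
        also have "\<dots> = indicator D x *\<^sub>R (g x * bump a b n x)" unfolding sub[symmetric] by simp
        finally show "(indicator (cbox a b) x *\<^sub>R g x) * bump a b n x = indicator D x *\<^sub>R (g x * bump a b n x)" .
      qed
      then show ?thesis using test[OF bump_test_function[OF ab]] by simp
    qed
    ultimately have "(LINT x | lborel. (indicator (cbox a b) x *\<^sub>R g x) * indicator (box a b) x) = 0"
      by (simp add: LIMSEQ_const_iff)
    moreover have "(indicator (cbox a b) x *\<^sub>R g x) * indicator (box a b) x = indicator (box a b) x *\<^sub>R g x" for x
      using box_subset_cbox[of a b] by (auto simp: indicator_def)
    ultimately show ?thesis unfolding set_lebesgue_integral_def by (simp only:)
  qed
  have cb: "AE x in lborel. x \<in> box c d \<longrightarrow> g x = 0" if cd: "cbox c d \<subseteq> D" for c d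
  proof -
    have "AE x in lborel. indicator (box c d) x *\<^sub>R g x = 0"
    proof (rule zero_integral_on_boxes_imp_AE_zero)
      have "set_integrable lborel (box c d) g"
        by (rule set_integrable_subset[OF g[OF compact_cbox cd]]) (auto simp: box_subset_cbox)
      then show "integrable lborel (\<lambda>x. indicator (box c d) x *\<^sub>R g x)" by (simp add: set_integrable_def)
      fix a b :: "real^'n"
      obtain a' b' where ab: "box a b \<inter> box c d = box a' b'" using box_Int_box[of a b c d] by blast
      have "(LINT x : box a b | lborel. indicator (box c d) x *\<^sub>R g x) = (LINT x : box a' b' | lborel. g x)"
        unfolding set_lebesgue_integral_def ab[symmetric]
        by (intro Bochner_Integration.integral_cong) (auto simp: indicator_def)
      also have "\<dots> = 0"
      proof (cases "box a' b' = {}")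
        case True
        then show ?thesis by (simp add: set_lebesgue_integral_def)
      next
        case False
        then have "cbox a' b' = closure (box a' b')" by (simp add: closure_box)
        also have "\<dots> \<subseteq> closure (box c d)" using ab by (intro closure_mono) auto
        also have "\<dots> \<subseteq> cbox c d" by (intro closure_minimal box_subset_cbox closed_cbox)
        finally show ?thesis using cd by (intro box0) auto
      qed
      finally show "(LINT x : box a b | lborel. indicator (box c d) x *\<^sub>R g x) = 0" .
    qed
    then show ?thesis by eventually_elim (auto simp: indicator_def)
  qed
  have cc: "AE x in lborel. x \<in> cbox c d \<longrightarrow> g x = 0" if cd: "cbox c d \<subseteq> D" for c d
  proof -
    have "cbox c d - box c d \<in> null_sets lborel"
      using negligible_frontier_interval[of c d]
      by (simp add: negligible_iff_null_sets null_sets_completion_iff)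
    then have "AE x in lborel. x \<notin> cbox c d - box c d" by (rule AE_not_in)
    with cb[OF cd] show ?thesis by eventually_elim auto
  qed
  obtain F where F: "countable F" "F \<subseteq> Pow D" "\<And>X. X \<in> F \<Longrightarrow> \<exists>a b. X = cbox a b" "\<Union>F = D"
    using open_countable_Union_open_cbox[OF D] by blast
  have "AE x in lborel. x \<in> X \<longrightarrow> g x = 0" if X: "X \<in> F" for X
  proof -
    obtain a b where "X = cbox a b" using F(3)[OF X] by blast
    then show ?thesis using cc[of a b] F(2) X by blast
  qed
  then have "AE x in lborel. \<forall>X\<in>F. x \<in> X \<longrightarrow> g x = 0"
    using F(1) by (subst AE_ball_countable) auto
  then show ?thesis by eventually_elim (use F in auto)
qed

section \<open>The inner product on tensors induced by a positive definite matrix\<close>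

text \<open>The entries of the \<open>k\<close>-fold tensor power of \<open>A\<close>, indexed by lists of length \<open>k\<close>.\<close>

definition tpow :: "nat \<Rightarrow> real ^ 'n ^ 'm \<Rightarrow> 'm list \<Rightarrow> 'n list \<Rightarrow> real" where
  "tpow k A is js = (\<Prod>l<k. A $ (is ! l) $ (js ! l))"

lemma finite_idx [simp]: "finite (idx k :: 'n::finite list set)"
  using finite_lists_length_eq[of "UNIV :: 'n set" k] by simp

lemma sum_idx_Suc:
  fixes f :: "'n::finite list \<Rightarrow> real"
  shows "(\<Sum>is\<in>idx (Suc k). f is) = (\<Sum>i\<in>UNIV. \<Sum>is\<in>idx k. f (i # is))"
proof -
  have "(\<Sum>is\<in>idx (Suc k). f is) = (\<Sum>(i, is)\<in>UNIV \<times> idx k. f (i # is))"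
    by (rule sum.reindex_bij_witness[of _ "\<lambda>(i, is). i # is" "\<lambda>is. (hd is, tl is)"])
       (auto simp: length_Suc_conv)
  then show ?thesis by (simp add: sum.cartesian_product)
qed

lemma tpow_0 [simp]: "tpow 0 A is js = 1"
  by (simp add: tpow_def)

lemma tpow_Cons [simp]: "tpow (Suc k) A (i # is) (j # js) = A $ i $ j * tpow k A is js"
  by (simp add: tpow_def prod.lessThan_Suc_shift del: prod.lessThan_Suc)

lemma tpow_transpose: "tpow k (transpose A) is js = tpow k A js is"
  by (simp add: tpow_def transpose_def)

lemma tpow_mat_1:
  "is \<in> idx k \<Longrightarrow> js \<in> idx k \<Longrightarrow> tpow k (mat 1 :: real ^ 'n ^ 'n) is js = (if is = js then 1 else 0)"
proof (induction k arbitrary: "is" js)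
  case 0
  then show ?case by simp
next
  case (Suc k)
  obtain i is' where i: "is = i # is'" "is' \<in> idx k" using Suc.prems by (auto simp: length_Suc_conv)
  obtain j js' where j: "js = j # js'" "js' \<in> idx k" using Suc.prems by (auto simp: length_Suc_conv)
  have "(mat 1 :: real ^ 'n ^ 'n) $ i $ j = (if i = j then 1 else 0)" by (simp add: mat_def)
  then show ?case using Suc.IH[OF i(2) j(2)] i(1) j(1) by simp
qed

lemma tpow_matrix_mult:
  fixes A :: "real ^ 'n::finite ^ 'm" and B :: "real ^ 'p ^ 'n"
  assumes "is \<in> idx k" "js \<in> idx k"
  shows "tpow k (A ** B) is js = (\<Sum>ms\<in>idx k. tpow k A is ms * tpow k B ms js)"
  using assms
proof (induction k arbitrary: "is" js)
  case 0
  then show ?case by simp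
next
  case (Suc k)
  obtain i is' where i: "is = i # is'" "is' \<in> idx k" using Suc.prems by (auto simp: length_Suc_conv)
  obtain j js' where j: "js = j # js'" "js' \<in> idx k" using Suc.prems by (auto simp: length_Suc_conv)
  have "tpow (Suc k) (A ** B) is js =
      (\<Sum>m\<in>UNIV. A $ i $ m * B $ m $ j) * (\<Sum>ms\<in>idx k. tpow k A is' ms * tpow k B ms js')"
    using Suc.IH[OF i(2) j(2)] i j by (simp add: matrix_matrix_mult_def)
  also have "\<dots> = (\<Sum>m\<in>UNIV. \<Sum>ms\<in>idx k. (A $ i $ m * B $ m $ j) * (tpow k A is' ms * tpow k B ms js'))"
    by (rule sum_product)
  also have "\<dots> = (\<Sum>ms\<in>idx (Suc k). tpow (Suc k) A is ms * tpow (Suc k) B ms js)"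
    unfolding sum_idx_Suc i(1) j(1) by (simp add: mult_ac)
  finally show ?case .
qed

definition tinner :: "nat \<Rightarrow> real ^ 'n ^ 'n \<Rightarrow> ('n list \<Rightarrow> real) \<Rightarrow> ('n list \<Rightarrow> real) \<Rightarrow> real" where
  "tinner k G a b = (\<Sum>is\<in>idx k. \<Sum>js\<in>idx k. tpow k G is js * a is * b js)"

text \<open>The transformation rule of a contravariant tensor when the components of the forms are pulled back
along \<open>A\<close>.\<close>

lemma tinner_change_basis:
  fixes A :: "real ^ 'n::finite ^ 'm::finite" and G :: "real ^ 'n ^ 'n"
  shows "tinner k G (\<lambda>is. \<Sum>ps\<in>idx k. tpow k A ps is * a ps) (\<lambda>js. \<Sum>qs\<in>idx k. tpow k A qs js * b qs) =
    tinner k (A ** G ** transpose A) a b"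
proof -
  have "tinner k G (\<lambda>is. \<Sum>ps\<in>idx k. tpow k A ps is * a ps) (\<lambda>js. \<Sum>qs\<in>idx k. tpow k A qs js * b qs)
     = (\<Sum>is\<in>idx k. \<Sum>js\<in>idx k. \<Sum>ps\<in>idx k. \<Sum>qs\<in>idx k.
          (tpow k A ps is * tpow k G is js * tpow k A qs js) * a ps * b qs)"
    unfolding tinner_def
    by (intro sum.cong refl) (simp add: sum_product sum_distrib_left sum_distrib_right mult_ac)
  also have "\<dots> = (\<Sum>ps\<in>idx k. \<Sum>qs\<in>idx k. \<Sum>is\<in>idx k. \<Sum>js\<in>idx k.
          (tpow k A ps is * tpow k G is js * tpow k A qs js) * a ps * b qs)"
  proof -
    have "(\<Sum>is\<in>idx k. \<Sum>js\<in>idx k. \<Sum>ps\<in>idx k. \<Sum>qs\<in>idx k. f is js ps qs) =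
        (\<Sum>ps\<in>idx k. \<Sum>qs\<in>idx k. \<Sum>is\<in>idx k. \<Sum>js\<in>idx k. f is js ps qs)"
      for f :: "'n list \<Rightarrow> 'n list \<Rightarrow> 'm list \<Rightarrow> 'm list \<Rightarrow> real"
    proof -
      have "(\<Sum>is\<in>idx k. \<Sum>js\<in>idx k. \<Sum>ps\<in>idx k. \<Sum>qs\<in>idx k. f is js ps qs) =
          (\<Sum>is\<in>idx k. \<Sum>ps\<in>idx k. \<Sum>js\<in>idx k. \<Sum>qs\<in>idx k. f is js ps qs)"
        by (rule sum.cong[OF refl], rule sum.swap)
      also have "\<dots> = (\<Sum>ps\<in>idx k. \<Sum>is\<in>idx k. \<Sum>js\<in>idx k. \<Sum>qs\<in>idx k. f is js ps qs)"
        by (rule sum.swap)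
      also have "\<dots> = (\<Sum>ps\<in>idx k. \<Sum>is\<in>idx k. \<Sum>qs\<in>idx k. \<Sum>js\<in>idx k. f is js ps qs)"
        by (rule sum.cong[OF refl], rule sum.cong[OF refl], rule sum.swap)
      also have "\<dots> = (\<Sum>ps\<in>idx k. \<Sum>qs\<in>idx k. \<Sum>is\<in>idx k. \<Sum>js\<in>idx k. f is js ps qs)"
        by (rule sum.cong[OF refl], rule sum.swap)
      finally show ?thesis .
    qed
    then show ?thesis .
  qed
  also have "\<dots> = tinner k (A ** G ** transpose A) a b"
    unfolding tinner_def
  proof (intro sum.cong refl)
    fix ps qs :: "'m list" assume pq: "ps \<in> idx k" "qs \<in> idx k"
    have "tpow k (A ** G ** transpose A) ps qs =
        (\<Sum>js\<in>idx k. (\<Sum>is\<in>idx k. tpow k A ps is * tpow k G is js) * tpow k A qs js)"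
      using pq by (simp add: tpow_matrix_mult[of _ k qs] tpow_matrix_mult[of ps k _ A G] tpow_transpose)
    also have "\<dots> = (\<Sum>is\<in>idx k. \<Sum>js\<in>idx k. tpow k A ps is * tpow k G is js * tpow k A qs js)"
      by (subst sum.swap) (simp add: sum_distrib_right)
    finally show "(\<Sum>is\<in>idx k. \<Sum>js\<in>idx k. (tpow k A ps is * tpow k G is js * tpow k A qs js) * a ps * b qs) =
        tpow k (A ** G ** transpose A) ps qs * a ps * b qs"
      by (simp add: sum_distrib_right)
  qed
  finally show ?thesis .
qed

text \<open>Cholesky factorization, by induction on the index set: removing the index \<open>s\<close> leaves the Schur
complement, which is again positive definite.\<close>

lemma gram_factorization:
  fixes G :: "'i \<Rightarrow> 'i \<Rightarrow> real"
  assumes "finite S" "\<And>i j. G i j = G j i"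
    and "\<And>v. (\<exists>i\<in>S. v i \<noteq> 0) \<Longrightarrow> 0 < (\<Sum>i\<in>S. \<Sum>j\<in>S. G i j * v i * v j)"
  shows "\<exists>b. \<forall>i\<in>S. \<forall>j\<in>S. G i j = (\<Sum>m\<in>S. b m i * b m j)"
  using assms
proof (induction S arbitrary: G rule: finite_induct)
  case empty
  then show ?case by simp
next
  case (insert s S)
  note sym = insert.prems(1)
  have split: "(\<Sum>i\<in>insert s S. \<Sum>j\<in>insert s S. G i j * v i * v j) =
      G s s * (v s)\<^sup>2 + 2 * v s * (\<Sum>j\<in>S. G s j * v j) + (\<Sum>i\<in>S. \<Sum>j\<in>S. G i j * v i * v j)" for v
  proof -
    have "(\<Sum>i\<in>S. G i s * v i * v s) = v s * (\<Sum>j\<in>S. G s j * v j)"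
      by (simp add: sum_distrib_left sym[of _ s] mult_ac)
    moreover have "(\<Sum>j\<in>S. G s j * v s * v j) = v s * (\<Sum>j\<in>S. G s j * v j)"
      by (simp add: sum_distrib_left mult_ac)
    ultimately show ?thesis
      using insert.hyps by (simp add: sum.distrib power2_eq_square)
  qed
  define g where "g = G s s"
  have g: "g > 0"
  proof -
    define v where "v i = (if i = s then 1 else 0 :: real)" for i
    have "v j = 0" if "j \<in> S" for j using insert.hyps that by (auto simp: v_def)
    then have "(\<Sum>j\<in>S. G s j * v j) = 0" "(\<Sum>i\<in>S. \<Sum>j\<in>S. G i j * v i * v j) = 0"
      by (simp_all add: sum.neutral)
    moreover have "0 < (\<Sum>i\<in>insert s S. \<Sum>j\<in>insert s S. G i j * v i * v j)"
      by (rule insert.prems(2)) (simp add: v_def)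
    ultimately show ?thesis unfolding split by (simp add: g_def v_def)
  qed
  define G' where "G' i j = G i j - G s i * G s j / g" for i j
  have "\<exists>b. \<forall>i\<in>S. \<forall>j\<in>S. G' i j = (\<Sum>m\<in>S. b m i * b m j)"
  proof (rule insert.IH)
    show "G' i j = G' j i" for i j by (simp add: G'_def sym[of i j] mult.commute)
    fix v :: "'i \<Rightarrow> real" assume v: "\<exists>i\<in>S. v i \<noteq> 0"
    define p where "p = (\<Sum>j\<in>S. G s j * v j)"
    (* the value at s that minimizes the quadratic form and leaves the Schur complement *)
    define v' where "v' = v(s := - p / g)"
    have agree: "i \<in> S \<Longrightarrow> v' i = v i" for i using insert.hyps by (auto simp: v'_def)
    have "0 < (\<Sum>i\<in>insert s S. \<Sum>j\<in>insert s S. G i j * v' i * v' j)"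
      using v agree by (intro insert.prems(2)) auto
    also have "\<dots> = g * (- p / g)\<^sup>2 + 2 * (- p / g) * p + (\<Sum>i\<in>S. \<Sum>j\<in>S. G i j * v i * v j)"
      unfolding split g_def[symmetric] using agree
      by (simp add: p_def v'_def cong: sum.cong) 
    also have "\<dots> = (\<Sum>i\<in>S. \<Sum>j\<in>S. G i j * v i * v j) - p * p / g"
      using g by (simp add: field_simps power2_eq_square)
    also have "p * p = (\<Sum>i\<in>S. \<Sum>j\<in>S. (G s i * v i) * (G s j * v j))"
      unfolding p_def by (rule sum_product)
    also have "(\<Sum>i\<in>S. \<Sum>j\<in>S. G i j * v i * v j) - \<dots> / g = (\<Sum>i\<in>S. \<Sum>j\<in>S. G' i j * v i * v j)"
      unfolding sum_divide_distrib sum_subtractf[symmetric]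
      by (intro sum.cong refl) (simp add: G'_def algebra_simps)
    finally show "0 < (\<Sum>i\<in>S. \<Sum>j\<in>S. G' i j * v i * v j)" .
  qed
  then obtain b where b: "\<And>i j. i \<in> S \<Longrightarrow> j \<in> S \<Longrightarrow> G' i j = (\<Sum>m\<in>S. b m i * b m j)" by blast
  define b' where "b' m i = (if m = s then G s i / sqrt g else if i = s then 0 else b m i)" for m i
  have "G i j = (\<Sum>m\<in>insert s S. b' m i * b' m j)" if ij: "i \<in> insert s S" "j \<in> insert s S" for i j
  proof -
    have "(\<Sum>m\<in>insert s S. b' m i * b' m j) = G s i * G s j / g + (\<Sum>m\<in>S. b' m i * b' m j)"
      using insert.hyps g by (simp add: b'_def)
    moreover have "(\<Sum>m\<in>S. b' m i * b' m j) = (if i = s \<or> j = s then 0 else G' i j)"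
    proof (cases "i = s \<or> j = s")
      case True
      have "b' m i * b' m j = 0" if "m \<in> S" for m
        using True that insert.hyps by (auto simp: b'_def)
      then show ?thesis using True by (simp add: sum.neutral)
    next
      case False
      have "b' m i * b' m j = b m i * b m j" if "m \<in> S" for m
        using False that insert.hyps by (auto simp: b'_def)
      then show ?thesis using False b[of i j] ij by simp
    qed
    moreover have "G i s = G s i" by (rule sym)
    ultimately show ?thesis
      using g by (cases "i = s"; cases "j = s") (simp_all add: G'_def g_def)
  qed
  then show ?case by blast
qed

definition posdef :: "real ^ 'n ^ 'n \<Rightarrow> bool" where
  "posdef G \<longleftrightarrow> transpose G = G \<and> (\<forall>v. v \<noteq> 0 \<longrightarrow> 0 < v \<bullet> (G *v v))"

lemma posdef_factorization:
  fixes G :: "real ^ 'n::finite ^ 'n"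
  assumes "posdef G" shows "\<exists>B :: real ^ 'n ^ 'n. G = transpose B ** B"
proof -
  have sym: "G $ i $ j = G $ j $ i" for i j
    using assms unfolding posdef_def by (metis transpose_def vec_lambda_beta)
  have "\<exists>b. \<forall>i\<in>UNIV. \<forall>j\<in>UNIV. G $ i $ j = (\<Sum>m\<in>(UNIV :: 'n set). b m i * b m j)"
  proof (rule gram_factorization[of UNIV "\<lambda>i j. G $ i $ j"])
    fix v :: "'n \<Rightarrow> real" assume "\<exists>i\<in>UNIV. v i \<noteq> 0"
    then have "(\<chi> i. v i) \<noteq> 0" by (auto simp: vec_eq_iff)
    then have "0 < (\<chi> i. v i) \<bullet> (G *v (\<chi> i. v i))" using assms by (auto simp: posdef_def)
    also have "\<dots> = (\<Sum>i\<in>UNIV. \<Sum>j\<in>UNIV. G $ i $ j * v i * v j)"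
      by (simp add: inner_vec_def matrix_vector_mult_def sum_distrib_left mult_ac)
    finally show "0 < (\<Sum>i\<in>UNIV. \<Sum>j\<in>UNIV. G $ i $ j * v i * v j)" .
  qed (use sym in auto)
  then obtain b where "\<And>i j. G $ i $ j = (\<Sum>m\<in>(UNIV :: 'n set). b m i * b m j)" by blast
  then have "G = transpose (\<chi> m i. b m i) ** (\<chi> m i. b m i)"
    by (simp add: vec_eq_iff matrix_matrix_mult_def transpose_def)
  then show ?thesis by blast
qed

lemma tinner_mat_1: "tinner k (mat 1) a b = (\<Sum>is\<in>idx k. a is * b is)"
proof -
  have "(\<Sum>js\<in>idx k. tpow k (mat 1) is js * a is * b js) = a is * b is" if "is \<in> idx k" for "is" :: "'a list"
  proof -
    have "(\<Sum>js\<in>idx k. tpow k (mat 1) is js * a is * b js) = (\<Sum>js\<in>idx k. if is = js then a is * b js else 0)"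
      using that by (intro sum.cong refl) (simp add: tpow_mat_1)
    then show ?thesis using that by simp
  qed
  then show ?thesis by (simp add: tinner_def)
qed

text \<open>From \<open>G = B\<^sup>T B\<close> the induced form on tensors is the standard inner product of images under the
tensor power of \<open>B\<close>, so all facts about sums of squares apply to it.\<close>

lemma tinner_posdef:
  fixes G :: "real ^ 'n::finite ^ 'n"
  assumes "posdef G"
  obtains T :: "('n list \<Rightarrow> real) \<Rightarrow> 'n list \<Rightarrow> real"
  where "\<And>a b. tinner k G a b = (\<Sum>is\<in>idx k. T a is * T b is)"
proof -
  obtain B :: "real ^ 'n ^ 'n" where B: "G = transpose B ** B" using posdef_factorization[OF assms] by blast
  have "tinner k G a b = (\<Sum>is\<in>idx k. (\<Sum>ps\<in>idx k. tpow k (transpose B) ps is * a ps) * (\<Sum>qs\<in>idx k. tpow k (transpose B) qs is * b qs))"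
    for a b
    using tinner_change_basis[of k "mat 1" "transpose B" a b] B by (simp add: tinner_mat_1)
  then show ?thesis by (rule that)
qed

lemma tinner_nonneg: "posdef G \<Longrightarrow> 0 \<le> tinner k G a a"
  by (rule tinner_posdef[of G k]) (auto intro!: sum_nonneg)

lemma tinner_cauchy_schwarz: "posdef G \<Longrightarrow> (tinner k G a b)\<^sup>2 \<le> tinner k G a a * tinner k G b b"
  by (rule tinner_posdef[of G k]) (use Cauchy_Schwarz_ineq_sum in \<open>auto simp: power2_eq_square\<close>)

lemma tinner_abs_le:
  assumes "posdef G" shows "2 * \<bar>tinner k G a b\<bar> \<le> tinner k G a a + tinner k G b b"
proof -
  obtain T :: "('a list \<Rightarrow> real) \<Rightarrow> 'a list \<Rightarrow> real"
    where T: "\<And>a b. tinner k G a b = (\<Sum>is\<in>idx k. T a is * T b is)"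
    using tinner_posdef[OF assms] by blast
  have "2 * \<bar>tinner k G a b\<bar> \<le> 2 * (\<Sum>is\<in>idx k. \<bar>T a is * T b is\<bar>)"
    unfolding T by (intro mult_left_mono sum_abs) simp
  also have "\<dots> \<le> (\<Sum>is\<in>idx k. T a is * T a is + T b is * T b is)"
  proof (unfold sum_distrib_left, rule sum_mono)
    fix "is"
    have "0 \<le> (\<bar>T a is\<bar> - \<bar>T b is\<bar>)\<^sup>2" by simp
    then show "2 * \<bar>T a is * T b is\<bar> \<le> T a is * T a is + T b is * T b is"
      by (simp add: power2_diff abs_mult) (simp add: power2_eq_square)
  qed
  finally show ?thesis by (simp add: T sum.distrib)
qed

lemma tinner_sym:
  assumes "transpose G = G" shows "tinner k G a b = tinner k G b a"
proof -
  have "tpow k G js is = tpow k G is js" for "is" js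
    using tpow_transpose[of k G] assms by simp
  then show ?thesis
    unfolding tinner_def by (subst sum.swap) (intro sum.cong refl, simp)
qed

lemma matrix_inv_invertible:
  assumes "invertible A" shows "A ** matrix_inv A = mat 1" "matrix_inv A ** A = mat 1"
  using someI_ex[of "\<lambda>A'. A ** A' = mat 1 \<and> A' ** A = mat 1"] assms
  unfolding matrix_inv_def invertible_def by blast+

lemma posdef_invertible:
  fixes G :: "real ^ 'n::finite ^ 'n"
  assumes "posdef G" shows "invertible G"
proof -
  have "v = 0" if "G *v v = 0" for v using assms that unfolding posdef_def by fastforce
  then show ?thesis
    using invertible_left_inverse matrix_left_invertible_ker by blast
qed

lemma posdef_matrix_inv:
  fixes G :: "real ^ 'n::finite ^ 'n"
  assumes "posdef G" shows "posdef (matrix_inv G)"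
proof -
  note inv = matrix_inv_invertible[OF posdef_invertible[OF assms]]
  have tG: "transpose G = G" using assms by (simp add: posdef_def)
  have "transpose (matrix_inv G) ** G = mat 1"
    using arg_cong[OF inv(1), of transpose] by (simp add: matrix_transpose_mul tG)
  then have sym: "transpose (matrix_inv G) = matrix_inv G"
    by (metis inv(1) matrix_mul_assoc matrix_mul_lid matrix_mul_rid)
  moreover have "0 < v \<bullet> (matrix_inv G *v v)" if "v \<noteq> 0" for v
  proof -
    let ?w = "matrix_inv G *v v"
    have v: "G *v ?w = v" by (simp add: matrix_vector_mul_assoc inv)
    then have "?w \<noteq> 0" using that by (metis matrix_vector_mult_0_right)
    then have "0 < ?w \<bullet> (G *v ?w)" using assms by (simp add: posdef_def)
    then show ?thesis by (simp add: v inner_commute)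
  qed
  ultimately show ?thesis by (simp add: posdef_def)
qed

text \<open>A component of a tensor is its inner product with the dual element \<open>tpow k G _ is\<close>, whose squared
norm is \<open>tpow k G is is\<close>; the claim is the Cauchy-Schwarz inequality.  It serves both as definiteness
of the inner product and as a bound that is locally uniform in the base point.\<close>

lemma component_bound:
  fixes G :: "real ^ 'n::finite ^ 'n"
  assumes G: "posdef G" and "is": "is \<in> idx k"
  shows "(a is)\<^sup>2 \<le> tpow k G is is * tinner k (matrix_inv G) a a"
proof -
  note inv = matrix_inv_invertible[OF posdef_invertible[OF G]]
  (* lowering the indices of the basis tensor with multi-index is *)
  let ?e = "\<lambda>js. tpow k G js is"
  have pick: "tinner k (matrix_inv G) b ?e = b is" for b
  proof -
    have "tinner k (matrix_inv G) b ?e = (\<Sum>ps\<in>idx k. b ps * tpow k (matrix_inv G ** G) ps is)"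
      unfolding tinner_def
      by (intro sum.cong refl) (simp add: tpow_matrix_mult "is"[simplified] sum_distrib_left mult_ac)
    also have "\<dots> = (\<Sum>ps\<in>idx k. if ps = is then b ps else 0)"
      using "is" by (intro sum.cong refl) (simp add: inv tpow_mat_1)
    finally show ?thesis using "is" by simp
  qed
  show ?thesis
    using tinner_cauchy_schwarz[OF posdef_matrix_inv[OF G], of k a ?e] unfolding pick
    by (simp add: mult.commute)
qed

lemma congruent_metric_inverse:
  fixes J G' :: "real ^ 'n::finite ^ 'n"
  assumes G: "posdef G" "posdef G'" and eq: "G = transpose J ** G' ** J"
  shows "J ** matrix_inv G ** transpose J = matrix_inv G'"
proof -
  note inv = matrix_inv_invertible[OF posdef_invertible[OF G(1)]]
  note inv' = matrix_inv_invertible[OF posdef_invertible[OF G(2)]]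
  have "(matrix_inv G ** transpose J ** G') ** J = mat 1"
    using inv(2) unfolding eq by (simp add: matrix_mul_assoc)
  then have "J ** (matrix_inv G ** transpose J ** G') = mat 1"
    using matrix_left_right_inverse by blast
  then have "(J ** matrix_inv G ** transpose J) ** G' = mat 1" by (simp add: matrix_mul_assoc)
  then show ?thesis by (metis inv'(1) matrix_mul_assoc matrix_mul_lid matrix_mul_rid)
qed

section \<open>Charts, the Riemannian volume and the pointwise inner product\<close>

lemma continuous_on_det:
  fixes f :: "'a::topological_space \<Rightarrow> real ^ 'n::finite ^ 'n"
  assumes "\<And>i j. continuous_on S (\<lambda>x. f x $ i $ j)" shows "continuous_on S (\<lambda>x. det (f x))"
  unfolding det_def by (intro continuous_intros assms)

lemma posdef_det_pos:
  fixes G :: "real ^ 'n::finite ^ 'n"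
  assumes "posdef G" shows "0 < det G"
proof -
  obtain B :: "real ^ 'n ^ 'n" where "G = transpose B ** B" using posdef_factorization[OF assms] by blast
  then have "det G = det B * det B" by (simp add: det_mul)
  then have "0 \<le> det G" by simp
  moreover have "det G \<noteq> 0" using posdef_invertible[OF assms] invertible_det_nz by blast
  ultimately show ?thesis by simp
qed

text \<open>Cramer's rule shows that the inverse metric depends continuously on the point.\<close>

lemma matrix_inv_entry:
  fixes G :: "real ^ 'n::finite ^ 'n"
  assumes "posdef G"
  shows "matrix_inv G $ i $ j = det (\<chi> r s. if s = i then (if r = j then 1 else 0) else G $ r $ s) / det G"
proof -
  note inv = matrix_inv_invertible[OF posdef_invertible[OF assms]]
  have "det G \<noteq> 0" using posdef_det_pos[OF assms] by simp
  moreover have "G *v (matrix_inv G *v axis j 1) = axis j 1"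
    by (simp add: matrix_vector_mul_assoc inv)
  ultimately have "matrix_inv G *v axis j 1 =
      (\<chi> k. det (\<chi> r s. if s = k then axis j 1 $ r else G $ r $ s) / det G)"
    by (simp add: cramer)
  moreover have "(matrix_inv G *v axis j 1) $ i = matrix_inv G $ i $ j"
    by (simp add: matrix_vector_mul_component axis_def inner_vec_def if_distrib cong: if_cong)
  ultimately show ?thesis by (simp add: axis_def eq_commute cong: if_cong)
qed

lemma tinner_cong:
  "(\<And>is. is \<in> idx k \<Longrightarrow> a is = a' is) \<Longrightarrow> (\<And>is. is \<in> idx k \<Longrightarrow> b is = b' is) \<Longrightarrow>
    tinner k G a b = tinner k G a' b'"
  unfolding tinner_def by (intro sum.cong refl) auto

locale riem_domain =
  fixes M :: "('m, 'n::finite) riem_mfd" and \<Omega> :: "'m set"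
  assumes mfd: "riemannian_manifold M" and open_domain: "openin (mtop M) \<Omega>"
begin

abbreviation chart_image :: "('m, 'n) chart \<Rightarrow> (real ^ 'n) set" where
  "chart_image c \<equiv> snd c ` fst c"

abbreviation chart_domain :: "('m, 'n) chart \<Rightarrow> (real ^ 'n) set" where
  "chart_domain c \<equiv> snd c ` (fst c \<inter> \<Omega>)"

text \<open>The density of the Riemannian volume with respect to Lebesgue measure in the chart \<open>c\<close>.\<close>

definition vol_density :: "('m, 'n) chart \<Rightarrow> real ^ 'n \<Rightarrow> real" where
  "vol_density c x = sqrt (det (metric M c x))"

lemma charts:
  assumes "c \<in> atlas M"
  shows chart_open: "openin (mtop M) (fst c)"
    and chart_image_open: "open (chart_image c)"
    and chart_homeo: "homeomorphic_map (subtopology (mtop M) (fst c)) (top_of_set (chart_image c)) (snd c)"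
  using mfd assms by (auto simp: riemannian_manifold_def smooth_manifold_def is_chart_def)

lemma charts_cover: "(\<Union>c\<in>atlas M. fst c) = topspace (mtop M)"
  using mfd by (auto simp: riemannian_manifold_def smooth_manifold_def)

lemma chart_subset: "c \<in> atlas M \<Longrightarrow> fst c \<subseteq> topspace (mtop M)"
  using charts_cover by blast

lemma domain_subset: "\<Omega> \<subseteq> topspace (mtop M)"
  by (rule openin_subset[OF open_domain])

lemma topspace_chart: "c \<in> atlas M \<Longrightarrow> topspace (subtopology (mtop M) (fst c)) = fst c"
  by (simp add: topspace_subtopology Int_absorb1 chart_subset)

lemma chart_inj: "c \<in> atlas M \<Longrightarrow> inj_on (snd c) (fst c)"
  using homeomorphic_imp_injective_map[OF chart_homeo] topspace_chart by metis

lemma open_chart_image: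
  assumes "c \<in> atlas M" "openin (mtop M) U" shows "open (snd c ` (fst c \<inter> U))"
proof -
  have "openin (subtopology (mtop M) (fst c)) (fst c \<inter> U)"
    using assms by (simp add: openin_subtopology_Int2)
  then have "openin (top_of_set (chart_image c)) (snd c ` (fst c \<inter> U))"
    using homeomorphic_imp_open_map[OF chart_homeo[OF assms(1)]] by (simp add: open_map_def)
  then show ?thesis using openin_open_trans chart_image_open[OF assms(1)] by blast
qed

lemma open_chart_domain: "c \<in> atlas M \<Longrightarrow> open (chart_domain c)"
  by (rule open_chart_image[OF _ open_domain])

lemma openin_chart_preimage:
  assumes "c \<in> atlas M" "open B" shows "openin (mtop M) {p \<in> fst c. snd c p \<in> B}"
proof -
  have "openin (top_of_set (chart_image c)) (chart_image c \<inter> B)"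
    using assms(2) by (auto simp: openin_open)
  then have "openin (subtopology (mtop M) (fst c)) {p \<in> fst c. snd c p \<in> chart_image c \<inter> B}"
    using openin_continuous_map_preimage[OF homeomorphic_imp_continuous_map[OF chart_homeo[OF assms(1)]]]
    unfolding topspace_chart[OF assms(1)] by blast
  then have "openin (mtop M) {p \<in> fst c. snd c p \<in> chart_image c \<inter> B}"
    using openin_trans_full chart_open[OF assms(1)] by blast
  moreover have "{p \<in> fst c. snd c p \<in> chart_image c \<inter> B} = {p \<in> fst c. snd c p \<in> B}" by auto
  ultimately show ?thesis by simp
qed

lemma sets_vol: "sets (vol M) = sigma_sets (topspace (mtop M)) {U. openin (mtop M) U}"
  using mfd by (simp add: riemannian_manifold_def riemannian_volume_def)

lemma space_vol: "space (vol M) = topspace (mtop M)"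
proof -
  have "{U. openin (mtop M) U} \<subseteq> Pow (topspace (mtop M))" using openin_subset by blast
  then show ?thesis
    using sets_eq_imp_space_eq[of "vol M" "sigma (topspace (mtop M)) {U. openin (mtop M) U}"]
    by (simp add: sets_vol sets_measure_of space_measure_of)
qed

lemma open_in_sets_vol: "openin (mtop M) U \<Longrightarrow> U \<in> sets (vol M)"
  by (simp add: sets_vol)

lemma chart_in_sets: "c \<in> atlas M \<Longrightarrow> fst c \<in> sets (vol M)"
  by (rule open_in_sets_vol[OF chart_open])

lemma space_restrict_chart: "c \<in> atlas M \<Longrightarrow> space (restrict_space (vol M) (fst c)) = fst c"
  by (simp add: space_restrict_space space_vol Int_absorb2 chart_subset)

lemma sets_restrict_chart:
  assumes "c \<in> atlas M" "A \<subseteq> fst c"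
  shows "A \<in> sets (restrict_space (vol M) (fst c)) \<longleftrightarrow> A \<in> sets (vol M)"
proof -
  have "fst c \<inter> space (vol M) \<in> sets (vol M)" using chart_in_sets[OF assms(1)] by simp
  then show ?thesis using assms(2) by (simp add: sets_restrict_space_iff)
qed

lemma chart_measurable:
  assumes c: "c \<in> atlas M" shows "snd c \<in> borel_measurable (restrict_space (vol M) (fst c))"
proof (rule borel_measurableI)
  fix S :: "(real^'n) set" assume "open S"
  have "snd c -` S \<inter> fst c = {p \<in> fst c. snd c p \<in> S}" by auto
  then have "snd c -` S \<inter> fst c \<in> sets (vol M)"
    using openin_chart_preimage[OF c \<open>open S\<close>] open_in_sets_vol by simp
  then show "snd c -` S \<inter> space (restrict_space (vol M) (fst c)) \<in> sets (restrict_space (vol M) (fst c))"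
    unfolding space_restrict_chart[OF c] by (subst sets_restrict_chart[OF c]) auto
qed

lemma chart_preimage_in_sets:
  assumes "c \<in> atlas M" "B \<in> sets borel" shows "{p \<in> fst c. snd c p \<in> B} \<in> sets (vol M)"
proof -
  have "snd c -` B \<inter> fst c \<in> sets (restrict_space (vol M) (fst c))"
    using measurable_sets[OF chart_measurable[OF assms(1)] assms(2)] space_restrict_chart[OF assms(1)] by simp
  then have "snd c -` B \<inter> fst c \<in> sets (vol M)"
    by (subst (asm) sets_restrict_chart[OF assms(1)]) auto
  moreover have "snd c -` B \<inter> fst c = {p \<in> fst c. snd c p \<in> B}" by auto
  ultimately show ?thesis by simp
qed

lemma chart_image_in_sets:
  assumes c: "c \<in> atlas M" and A: "A \<in> sets (vol M)" shows "snd c ` (fst c \<inter> A) \<in> sets borel"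
proof -
  have "A \<in> sigma_sets (topspace (mtop M)) {U. openin (mtop M) U}" using A sets_vol by simp
  then show ?thesis
  proof (induction rule: sigma_sets.induct)
    case (Basic U)
    then show ?case using open_chart_image[OF c] by simp
  next
    case Empty
    then show ?case by simp
  next
    case (Compl A)
    have "snd c ` (fst c \<inter> (topspace (mtop M) - A)) = chart_image c - snd c ` (fst c \<inter> A)"
      using chart_inj[OF c] chart_subset[OF c] by (auto simp: inj_on_def)
    then show ?case using Compl chart_image_open[OF c] by auto
  next
    case (Union A)
    have "snd c ` (fst c \<inter> (\<Union>i. A i)) = (\<Union>i. snd c ` (fst c \<inter> A i))" by auto
    then show ?case using Union by auto
  qed
qed

lemma metric_posdef: "c \<in> atlas M \<Longrightarrow> x \<in> chart_image c \<Longrightarrow> posdef (metric M c x)"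
  using mfd unfolding riemannian_manifold_def riemannian_metric_def posdef_def by blast

lemma metric_continuous:
  assumes "c \<in> atlas M" shows "continuous_on (chart_image c) (\<lambda>x. metric M c x $ i $ j)"
proof -
  have "continuous_on (chart_image c) (metric M c)"
    using mfd assms by (intro smooth_continuous) (simp add: riemannian_manifold_def riemannian_metric_def)
  then show ?thesis by (intro continuous_on_component)
qed

lemma vol_density_pos: "c \<in> atlas M \<Longrightarrow> x \<in> chart_image c \<Longrightarrow> 0 < vol_density c x"
  using posdef_det_pos[OF metric_posdef] by (simp add: vol_density_def)

lemma vol_density_continuous: "c \<in> atlas M \<Longrightarrow> continuous_on (chart_image c) (vol_density c)"
  unfolding vol_density_def by (intro continuous_intros continuous_on_det metric_continuous)

lemma vol_density_measurable:
  assumes "c \<in> atlas M"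
  shows "(\<lambda>x. ennreal (vol_density c x) * indicator (chart_image c) x) \<in> borel_measurable borel"
proof -
  have [measurable]: "(\<lambda>x. indicator (chart_image c) x *\<^sub>R vol_density c x) \<in> borel_measurable borel"
    using chart_image_open[OF assms] vol_density_continuous[OF assms]
    by (intro borel_measurable_continuous_on_indicator) auto
  have "(\<lambda>x. ennreal (indicator (chart_image c) x *\<^sub>R vol_density c x)) \<in> borel_measurable borel" by measurable
  then show ?thesis
    by (rule measurable_cong[THEN iffD1, rotated]) (auto simp: indicator_def)
qed

lemma emeasure_vol_chart:
  assumes "c \<in> atlas M" "A \<in> sets (vol M)" "A \<subseteq> fst c"
  shows "emeasure (vol M) A = (\<integral>\<^sup>+ x. ennreal (vol_density c x) * indicator (snd c ` A) x \<partial>lborel)"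
  using mfd assms by (simp add: riemannian_manifold_def riemannian_volume_def vol_density_def)

text \<open>The volume of sets inside one chart is prescribed; as an equality of measures it becomes available
for integrals.\<close>

lemma distr_vol_chart:
  assumes c: "c \<in> atlas M"
  shows "distr (restrict_space (vol M) (fst c)) borel (snd c) =
     density lborel (\<lambda>x. ennreal (vol_density c x) * indicator (chart_image c) x)"
proof (rule measure_eqI)
  fix B assume "B \<in> sets (distr (restrict_space (vol M) (fst c)) borel (snd c))"
  then have B: "B \<in> sets borel" by simp
  let ?A = "{p \<in> fst c. snd c p \<in> B}"
  have A: "?A \<in> sets (vol M)" by (rule chart_preimage_in_sets[OF c B])
  have "emeasure (distr (restrict_space (vol M) (fst c)) borel (snd c)) B =
      emeasure (restrict_space (vol M) (fst c)) (snd c -` B \<inter> fst c)"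
    using chart_measurable[OF c] B by (subst emeasure_distr) (auto simp: space_restrict_chart[OF c])
  also have "snd c -` B \<inter> fst c = ?A" by auto
  also have "emeasure (restrict_space (vol M) (fst c)) ?A = emeasure (vol M) ?A"
    using chart_in_sets[OF c] by (intro emeasure_restrict_space) auto
  also have "\<dots> = (\<integral>\<^sup>+ x. ennreal (vol_density c x) * indicator (snd c ` ?A) x \<partial>lborel)"
    by (rule emeasure_vol_chart[OF c A]) auto
  also have "\<dots> = (\<integral>\<^sup>+ x. (ennreal (vol_density c x) * indicator (chart_image c) x) * indicator B x \<partial>lborel)"
    by (intro nn_integral_cong) (auto simp: indicator_def)
  also have "\<dots> = emeasure (density lborel (\<lambda>x. ennreal (vol_density c x) * indicator (chart_image c) x)) B"
    using vol_density_measurable[OF c] B by (subst emeasure_density) auto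
  finally show "emeasure (distr (restrict_space (vol M) (fst c)) borel (snd c)) B = \<dots>" .
qed simp

lemma nn_integral_vol_chart:
  assumes c: "c \<in> atlas M" and f [measurable]: "f \<in> borel_measurable borel"
  shows "(\<integral>\<^sup>+ p. f (snd c p) * indicator (fst c) p \<partial>vol M) =
     (\<integral>\<^sup>+ x. ennreal (vol_density c x) * indicator (chart_image c) x * f x \<partial>lborel)"
proof -
  have "(\<integral>\<^sup>+ p. f (snd c p) * indicator (fst c) p \<partial>vol M) = (\<integral>\<^sup>+ p. f (snd c p) \<partial>restrict_space (vol M) (fst c))"
    using chart_in_sets[OF c] by (subst nn_integral_restrict_space) auto
  also have "\<dots> = (\<integral>\<^sup>+ x. f x \<partial>distr (restrict_space (vol M) (fst c)) borel (snd c))"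
    using chart_measurable[OF c] by (subst nn_integral_distr) auto
  also have "\<dots> = (\<integral>\<^sup>+ x. ennreal (vol_density c x) * indicator (chart_image c) x * f x \<partial>lborel)"
    unfolding distr_vol_chart[OF c] using vol_density_measurable[OF c] by (subst nn_integral_density) auto
  finally show ?thesis .
qed

text \<open>Positivity of the density excludes that a set of positive Lebesgue measure has volume zero.\<close>

lemma null_set_to_chart:
  assumes c: "c \<in> atlas M" and N: "N \<in> null_sets (vol M)"
  shows "snd c ` (fst c \<inter> N) \<in> null_sets lborel"
proof -
  let ?A = "fst c \<inter> N"
  have A: "?A \<in> sets (vol M)" using N chart_in_sets[OF c] by auto
  have B [measurable]: "snd c ` ?A \<in> sets borel" using chart_image_in_sets[OF c] N by blast
  have m: "(\<lambda>x. ennreal (vol_density c x) * indicator (snd c ` ?A) x) \<in> borel_measurable lborel"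
  proof -
    have "(\<lambda>x. (ennreal (vol_density c x) * indicator (chart_image c) x) * indicator (snd c ` ?A) x) \<in> borel_measurable lborel"
      using vol_density_measurable[OF c] by simp
    then show ?thesis by (rule measurable_cong[THEN iffD1, rotated]) (auto simp: indicator_def)
  qed
  have "emeasure (vol M) ?A = 0"
    using null_set_Int1[OF N chart_in_sets[OF c]] by (rule null_setsD1)
  then have "(\<integral>\<^sup>+ x. ennreal (vol_density c x) * indicator (snd c ` ?A) x \<partial>lborel) = 0"
    using emeasure_vol_chart[OF c A] by simp
  then have "AE x in lborel. ennreal (vol_density c x) * indicator (snd c ` ?A) x = 0"
    using nn_integral_0_iff_AE[OF m] by simp
  then have "AE x in lborel. x \<notin> snd c ` ?A"
  proof eventually_elim
    case (elim x)
    show ?case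
    proof
      assume x: "x \<in> snd c ` ?A"
      then have "0 < vol_density c x" using vol_density_pos[OF c, of x] by blast
      then show False using elim x by (simp add: ennreal_eq_0_iff)
    qed
  qed
  then show ?thesis using B by (subst AE_iff_null_sets) auto
qed

lemma null_set_from_chart:
  assumes c: "c \<in> atlas M" and N: "N \<in> null_sets lborel"
  shows "{p \<in> fst c. snd c p \<in> N} \<in> null_sets (vol M)"
proof -
  let ?A = "{p \<in> fst c. snd c p \<in> N}"
  have A: "?A \<in> sets (vol M)" using chart_preimage_in_sets[OF c] N by auto
  have "emeasure (vol M) ?A = (\<integral>\<^sup>+ x. ennreal (vol_density c x) * indicator (snd c ` ?A) x \<partial>lborel)"
    by (rule emeasure_vol_chart[OF c A]) auto
  also have "\<dots> = (\<integral>\<^sup>+ (x :: real ^ 'n). 0 \<partial>lborel)"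
  proof (rule nn_integral_cong_AE)
    show "AE x in lborel. ennreal (vol_density c x) * indicator (snd c ` ?A) x = 0"
      using AE_not_in[OF N] by eventually_elim (auto simp: indicator_def)
  qed
  finally show ?thesis using A by auto
qed

lemma AE_to_chart:
  assumes c: "c \<in> atlas M" and P: "AE p in vol M. p \<in> fst c \<inter> \<Omega> \<longrightarrow> P (snd c p)"
  shows "AE x in lborel. x \<in> chart_domain c \<longrightarrow> P x"
proof -
  obtain N where N: "\<And>p. p \<in> space (vol M) - N \<Longrightarrow> p \<in> fst c \<inter> \<Omega> \<longrightarrow> P (snd c p)" "N \<in> null_sets (vol M)"
    by (rule AE_E3[OF P]) (rule that; blast)
  have "AE x in lborel. x \<notin> snd c ` (fst c \<inter> N)"
    by (rule AE_not_in[OF null_set_to_chart[OF c N(2)]])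
  then show ?thesis
  proof eventually_elim
    case (elim x)
    show ?case
    proof
      assume "x \<in> chart_domain c"
      then obtain p where p: "p \<in> fst c" "p \<in> \<Omega>" "x = snd c p" by blast
      then have "p \<in> space (vol M) - N" using elim domain_subset space_vol by blast
      then show "P x" using N(1) p by blast
    qed
  qed
qed

lemma AE_from_chart:
  assumes c: "c \<in> atlas M" and P: "AE x in lborel. x \<in> chart_domain c \<longrightarrow> P x"
  shows "AE p in vol M. p \<in> fst c \<inter> \<Omega> \<longrightarrow> P (snd c p)"
proof -
  obtain N where N: "\<And>x. x \<in> space lborel - N \<Longrightarrow> x \<in> chart_domain c \<longrightarrow> P x" "N \<in> null_sets lborel"
    by (rule AE_E3[OF P]) (rule that; blast)
  have "AE p in vol M. p \<notin> {p \<in> fst c. snd c p \<in> N}"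
    by (rule AE_not_in[OF null_set_from_chart[OF c N(2)]])
  then show ?thesis
    by eventually_elim (use N(1) in auto)
qed

lemma countable_charts:
  obtains C where "countable C" "C \<subseteq> atlas M" "(\<Union>c\<in>C. fst c) = topspace (mtop M)"
proof -
  have "Lindelof_space (mtop M)"
    using mfd by (intro second_countable_imp_Lindelof_space)
      (simp add: riemannian_manifold_def smooth_manifold_def)
  then obtain V where V: "countable V" "V \<subseteq> fst ` atlas M" "\<Union>V = topspace (mtop M)"
    using Lindelof_spaceD[of "mtop M" "fst ` atlas M"] chart_open charts_cover by (metis imageE)
  obtain C where "C \<subseteq> atlas M" "countable C" "V = fst ` C"
    using countable_subset_image[THEN iffD1, OF conjI[OF V(1,2)]] by blast
  then show ?thesis using V(3) that by simp
qed

lemma transition_eq: "c \<in> atlas M \<Longrightarrow> p \<in> fst c \<Longrightarrow> transition c c' (snd c p) = snd c' p"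
  by (simp add: transition_def inv_into_f_f[OF chart_inj])

lemma form_change_chart:
  assumes "is_form M \<Omega> k \<alpha>" "c \<in> atlas M" "c' \<in> atlas M" "p \<in> \<Omega>" "p \<in> fst c" "p \<in> fst c'" "is \<in> idx k"
  shows "\<alpha> c (snd c p) is = (\<Sum>js\<in>idx k. tpow k (jacobian c c' (snd c p)) js is * \<alpha> c' (snd c' p) js)"
proof -
  have "snd c p \<in> snd c ` (fst c \<inter> fst c' \<inter> \<Omega>)" using assms by blast
  then have "\<alpha> c (snd c p) is = (\<Sum>js\<in>idx k. (\<Prod>l<k. jacobian c c' (snd c p) $ (js ! l) $ (is ! l)) *
      \<alpha> c' (transition c c' (snd c p)) js)"
    using assms unfolding is_form_def by blast
  then show ?thesis
    using assms transition_eq[of c p c'] unfolding tpow_def by simp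
qed

text \<open>The pointwise inner product computed in a given chart, whereas \<open>form_inner_at\<close> picks a chart for
every point separately, possibly in a non-measurable way.\<close>

definition chart_inner :: "nat \<Rightarrow> ('m, 'n) form \<Rightarrow> ('m, 'n) form \<Rightarrow> ('m, 'n) chart \<Rightarrow> real ^ 'n \<Rightarrow> real" where
  "chart_inner k \<alpha> \<beta> c x = tinner k (matrix_inv (metric M c x)) (\<alpha> c x) (\<beta> c x) / fact k"

definition some_chart :: "'m \<Rightarrow> ('m, 'n) chart" where
  "some_chart p = (SOME c. c \<in> atlas M \<and> p \<in> fst c)"

lemma some_chart:
  assumes "p \<in> \<Omega>" shows "some_chart p \<in> atlas M" "p \<in> fst (some_chart p)"
proof -
  have "\<exists>c. c \<in> atlas M \<and> p \<in> fst c" using assms domain_subset charts_cover by blast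
  from someI_ex[OF this] show "some_chart p \<in> atlas M" "p \<in> fst (some_chart p)"
    unfolding some_chart_def by auto
qed

lemma form_inner_some_chart:
  "form_inner_at M k \<alpha> \<beta> p = chart_inner k \<alpha> \<beta> (some_chart p) (snd (some_chart p) p)"
  by (simp add: form_inner_at_def chart_inner_def some_chart_def tinner_def tpow_def Let_def)

lemma chart_inner_change:
  assumes "is_form M \<Omega> k \<alpha>" "is_form M \<Omega> k \<beta>" "c \<in> atlas M" "c' \<in> atlas M"
    "p \<in> \<Omega>" "p \<in> fst c" "p \<in> fst c'"
  shows "chart_inner k \<alpha> \<beta> c (snd c p) = chart_inner k \<alpha> \<beta> c' (snd c' p)"
proof -
  let ?x = "snd c p" and ?y = "snd c' p"
  let ?J = "jacobian c c' ?x" and ?G = "metric M c ?x" and ?G' = "metric M c' ?y"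
  have "?x \<in> snd c ` (fst c \<inter> fst c')" using assms by blast
  then have "?G = transpose ?J ** metric M c' (transition c c' ?x) ** ?J"
    using mfd assms(3,4) unfolding riemannian_manifold_def riemannian_metric_def by blast
  then have "?G = transpose ?J ** ?G' ** ?J" using transition_eq assms by simp
  then have "?J ** matrix_inv ?G ** transpose ?J = matrix_inv ?G'"
    using assms by (intro congruent_metric_inverse metric_posdef) auto
  moreover have "tinner k (matrix_inv ?G) (\<alpha> c ?x) (\<beta> c ?x) =
      tinner k (matrix_inv ?G) (\<lambda>is. \<Sum>ps\<in>idx k. tpow k ?J ps is * \<alpha> c' ?y ps) (\<lambda>js. \<Sum>qs\<in>idx k. tpow k ?J qs js * \<beta> c' ?y qs)"
    using assms by (intro tinner_cong form_change_chart) auto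
  ultimately show ?thesis by (simp add: chart_inner_def tinner_change_basis)
qed

lemma form_inner_chart:
  assumes "is_form M \<Omega> k \<alpha>" "is_form M \<Omega> k \<beta>" "c \<in> atlas M" "p \<in> \<Omega>" "p \<in> fst c"
  shows "form_inner_at M k \<alpha> \<beta> p = chart_inner k \<alpha> \<beta> c (snd c p)"
  unfolding form_inner_some_chart using some_chart[OF assms(4)] assms by (intro chart_inner_change)

lemma some_chart_posdef: "p \<in> \<Omega> \<Longrightarrow> posdef (matrix_inv (metric M (some_chart p) (snd (some_chart p) p)))"
  using some_chart by (intro posdef_matrix_inv metric_posdef) auto

lemma form_inner_sym: "p \<in> \<Omega> \<Longrightarrow> form_inner_at M k \<alpha> \<beta> p = form_inner_at M k \<beta> \<alpha> p"
  unfolding form_inner_some_chart chart_inner_def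
  using some_chart_posdef[of p] by (subst tinner_sym) (auto simp: posdef_def)

lemma form_inner_nonneg: "p \<in> \<Omega> \<Longrightarrow> 0 \<le> form_inner_at M k \<alpha> \<alpha> p"
  unfolding form_inner_some_chart chart_inner_def using tinner_nonneg[OF some_chart_posdef] by simp

lemma form_inner_abs_le:
  "p \<in> \<Omega> \<Longrightarrow> 2 * \<bar>form_inner_at M k \<alpha> \<beta> p\<bar> \<le> form_inner_at M k \<alpha> \<alpha> p + form_inner_at M k \<beta> \<beta> p"
  unfolding form_inner_some_chart chart_inner_def
  using tinner_abs_le[OF some_chart_posdef, of p k] by (simp add: divide_right_mono abs_divide flip: add_divide_distrib)

lemma form_inner_add_left:
  "form_inner_at M k (\<lambda>c x is. \<alpha> c x is + \<alpha>' c x is) \<beta> p = form_inner_at M k \<alpha> \<beta> p + form_inner_at M k \<alpha>' \<beta> p"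
  by (simp add: form_inner_at_def Let_def algebra_simps sum.distrib add_divide_distrib)

lemma form_inner_scale_left:
  "form_inner_at M k (\<lambda>c x is. a * \<alpha> c x is) \<beta> p = a * form_inner_at M k \<alpha> \<beta> p"
  by (simp add: form_inner_at_def Let_def sum_distrib_left mult_ac)

lemma chart_inner_component_bound:
  assumes "c \<in> atlas M" "x \<in> chart_image c" "is \<in> idx k"
  shows "(\<alpha> c x is)\<^sup>2 \<le> fact k * tpow k (metric M c x) is is * chart_inner k \<alpha> \<alpha> c x"
  using component_bound[OF metric_posdef[OF assms(1,2)] assms(3), of "\<alpha> c x"]
  by (simp add: chart_inner_def)

lemma form_inner_zero_imp:
  assumes "is_form M \<Omega> k \<alpha>" "form_inner_at M k \<alpha> \<alpha> p = 0" "p \<in> \<Omega>" "c \<in> atlas M" "p \<in> fst c" "is \<in> idx k"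
  shows "\<alpha> c (snd c p) is = 0"
proof -
  have "chart_inner k \<alpha> \<alpha> c (snd c p) = 0" using form_inner_chart[OF assms(1,1,4,3,5)] assms(2) by simp
  then show ?thesis
    using chart_inner_component_bound[OF assms(4) _ assms(6), of "snd c p" \<alpha>] assms(5) by auto
qed

lemma metric_inv_measurable:
  assumes "c \<in> atlas M"
  shows "(\<lambda>x. indicator (chart_domain c) x * matrix_inv (metric M c x) $ i $ j) \<in> borel_measurable borel"
proof -
  have sub: "chart_domain c \<subseteq> chart_image c" by auto
  have m: "continuous_on (chart_domain c) (\<lambda>x. metric M c x $ i $ j)" for i j
    using continuous_on_subset[OF metric_continuous[OF assms] sub] .
  have "continuous_on (chart_domain c)
     (\<lambda>x. det (\<chi> r s. if s = i then (if r = j then 1 else 0) else metric M c x $ r $ s) / det (metric M c x))"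
  proof (intro continuous_on_divide continuous_on_det m ballI)
    show "det (metric M c x) \<noteq> 0" if "x \<in> chart_domain c" for x
      using posdef_det_pos[OF metric_posdef[OF assms, of x]] that by auto
    show "continuous_on (chart_domain c) (\<lambda>x. (\<chi> r s. if s = i then (if r = j then 1 else 0) else metric M c x $ r $ s) $ a $ b)" for a b
      by (cases "b = i") (auto intro!: continuous_intros m)
  qed
  then have "(\<lambda>x. indicator (chart_domain c) x *\<^sub>R
     (det (\<chi> r s. if s = i then (if r = j then 1 else 0) else metric M c x $ r $ s) / det (metric M c x))) \<in> borel_measurable borel"
    using open_chart_domain[OF assms] by (intro borel_measurable_continuous_on_indicator) auto
  then show ?thesis
    by (rule measurable_cong[THEN iffD1, rotated])
       (use matrix_inv_entry[OF metric_posdef[OF assms]] in \<open>auto simp: indicator_def\<close>)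
qed

text \<open>The part of \<open>l2_form\<close> that does not involve the volume.\<close>

definition measurable_form :: "nat \<Rightarrow> ('m, 'n) form \<Rightarrow> bool" where
  "measurable_form k \<alpha> \<longleftrightarrow> is_form M \<Omega> k \<alpha> \<and>
    (\<forall>c\<in>atlas M. \<forall>is\<in>idx k. (\<lambda>x. indicator (chart_domain c) x * \<alpha> c x is) \<in> borel_measurable borel)"

lemma chart_inner_measurable:
  assumes "measurable_form k \<alpha>" "measurable_form k \<beta>" "c \<in> atlas M"
  shows "(\<lambda>x. indicator (chart_domain c) x * chart_inner k \<alpha> \<beta> c x) \<in> borel_measurable borel"
proof -
  let ?I = "\<lambda>x. indicator (chart_domain c) x :: real"
  have a: "(\<lambda>x. ?I x * \<alpha> c x is) \<in> borel_measurable borel" "(\<lambda>x. ?I x * \<beta> c x is) \<in> borel_measurable borel"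
    if "is \<in> idx k" for "is"
    using assms that by (auto simp: measurable_form_def)
  have "(\<lambda>x. (\<Sum>is\<in>idx k. \<Sum>js\<in>idx k. (\<Prod>l<k. ?I x * matrix_inv (metric M c x) $ (is ! l) $ (js ! l)) *
      (?I x * \<alpha> c x is) * (?I x * \<beta> c x js)) / fact k) \<in> borel_measurable borel"
    by (intro borel_measurable_divide borel_measurable_sum borel_measurable_times borel_measurable_prod
        metric_inv_measurable[OF assms(3)] a borel_measurable_const)
  then show ?thesis
    by (rule measurable_cong[THEN iffD1, rotated])
       (auto simp: indicator_def chart_inner_def tinner_def tpow_def)
qed

text \<open>On each chart domain the inner product agrees with \<open>chart_inner\<close> of that chart, and countably many
chart domains cover the manifold.\<close>

lemma form_inner_measurable:
  assumes "measurable_form k \<alpha>" "measurable_form k \<beta>"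
  shows "(\<lambda>p. indicator \<Omega> p * form_inner_at M k \<alpha> \<beta> p) \<in> borel_measurable (vol M)"
proof -
  obtain C where C: "countable C" "C \<subseteq> atlas M" "(\<Union>c\<in>C. fst c) = topspace (mtop M)" by (rule countable_charts)
  show ?thesis
  proof (rule measurable_piecewise_restrict[of "fst ` C"])
    show "countable (fst ` C)" using C by simp
    show "space (vol M) \<subseteq> \<Union> (fst ` C)" using C space_vol by simp
    fix U assume "U \<in> fst ` C"
    then obtain c where c: "c \<in> atlas M" "U = fst c" using C by blast
    show "U \<inter> space (vol M) \<in> sets (vol M)" using chart_in_sets[OF c(1)] c by auto
    have "(\<lambda>p. indicator (chart_domain c) (snd c p) * chart_inner k \<alpha> \<beta> c (snd c p))
        \<in> borel_measurable (restrict_space (vol M) (fst c))"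
      by (rule measurable_compose[OF chart_measurable[OF c(1)] chart_inner_measurable[OF assms c(1)]])
    moreover have "indicator (chart_domain c) (snd c p) * chart_inner k \<alpha> \<beta> c (snd c p) =
        indicator \<Omega> p * form_inner_at M k \<alpha> \<beta> p" if "p \<in> space (restrict_space (vol M) (fst c))" for p
    proof -
      have p: "p \<in> fst c" using that space_restrict_chart[OF c(1)] by simp
      have "snd c p \<in> chart_domain c \<longleftrightarrow> p \<in> \<Omega>"
        using p chart_inj[OF c(1)] by (auto simp: inj_on_def)
      then show ?thesis
        using form_inner_chart[of k \<alpha> \<beta> c p] assms c p by (auto simp: indicator_def measurable_form_def)
    qed
    ultimately show "(\<lambda>p. indicator \<Omega> p * form_inner_at M k \<alpha> \<beta> p) \<in> borel_measurable (restrict_space (vol M) U)"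
      unfolding c(2) by (rule measurable_cong[THEN iffD1, rotated])
  qed
qed

end

section \<open>Square integrable forms and their classes\<close>

text \<open>The multi-index without its \<open>j\<close>-th entry, as it occurs in the exterior derivative.\<close>

definition delete_at :: "nat \<Rightarrow> 'a list \<Rightarrow> 'a list" where
  "delete_at j xs = take j xs @ drop (Suc j) xs"

lemma length_delete_at: "j < length xs \<Longrightarrow> length (delete_at j xs) = length xs - 1"
  by (simp add: delete_at_def)

lemma nth_delete_at:
  "j < length xs \<Longrightarrow> i < length xs - 1 \<Longrightarrow> delete_at j xs ! i = (if i < j then xs ! i else xs ! Suc i)"
  by (simp add: delete_at_def nth_append min_def)

lemma delete_at_commute:
  assumes "l < j" "j < length xs"
  shows "delete_at l (delete_at j xs) = delete_at (j - 1) (delete_at l xs)"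
proof (rule nth_equalityI)
  show "length (delete_at l (delete_at j xs)) = length (delete_at (j - 1) (delete_at l xs))"
    using assms by (simp add: length_delete_at)
  fix i assume "i < length (delete_at l (delete_at j xs))"
  then have "i < length xs - 2" using assms by (simp add: length_delete_at)
  then show "delete_at l (delete_at j xs) ! i = delete_at (j - 1) (delete_at l xs) ! i"
    using assms by (auto simp: nth_delete_at length_delete_at)
qed

text \<open>The cancellation behind \<open>d d = 0\<close>: the terms with \<open>l < j\<close> are matched with those with \<open>l \<ge> j\<close> by
\<open>(j, l) \<mapsto> (l, j - 1)\<close>, which changes the sign.\<close>

lemma alternating_double_sum_zero:
  fixes F :: "nat \<Rightarrow> nat \<Rightarrow> real"
  assumes F: "\<And>l j. l < j \<Longrightarrow> j \<le> Suc k \<Longrightarrow> F j l = F l (j - 1)"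
  shows "(\<Sum>j\<le>Suc k. (-1) ^ j * (\<Sum>l\<le>k. (-1) ^ l * F j l)) = 0"
proof -
  let ?f = "\<lambda>(j, l). (-1) ^ (j + l) * F j l"
  let ?A = "{(j, l). j \<le> Suc k \<and> l < j}" and ?B = "{(j, l). j \<le> l \<and> l \<le> k}"
  have "(\<Sum>j\<le>Suc k. (-1) ^ j * (\<Sum>l\<le>k. (-1) ^ l * F j l)) = (\<Sum>j\<le>Suc k. \<Sum>l\<le>k. ?f (j, l))"
    by (simp only: sum_distrib_left power_add mult.assoc prod.case)
  also have "\<dots> = sum ?f ({..Suc k} \<times> {..k})"
    by (subst sum.cartesian_product) (simp only: prod.case)
  also have "{..Suc k} \<times> {..k} = ?A \<union> ?B" by auto
  also have "sum ?f (?A \<union> ?B) = sum ?f ?A + sum ?f ?B"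
  proof (rule sum.union_disjoint)
    show "finite ?A" by (rule finite_subset[of _ "{..Suc k} \<times> {..k}"]) auto
    show "finite ?B" by (rule finite_subset[of _ "{..Suc k} \<times> {..k}"]) auto
  qed auto
  also have "sum ?f ?A = sum (\<lambda>x. - ?f x) ?B"
  proof (rule sum.reindex_bij_witness[of _ "\<lambda>(j, l). (Suc l, j)" "\<lambda>(j, l). (l, j - 1)"])
    fix x assume "x \<in> ?A"
    then obtain j l where x: "x = (j, l)" "j \<le> Suc k" "l < j" by auto
    then obtain i where i: "j = Suc i" by (cases j) auto
    show "- ?f (case x of (j, l) \<Rightarrow> (l, j - 1)) = ?f x"
      using F[of l j] x i by (simp add: add.commute)
  qed auto
  finally show ?thesis by (simp add: sum_negf)
qed

lemma test_function_dirderiv: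
  assumes "test_function D u" shows "test_function D (dirderiv u v)"
proof -
  obtain K where K: "compact K" "K \<subseteq> D" "\<And>x. x \<notin> K \<Longrightarrow> u x = 0" and u: "smooth_on UNIV u"
    using assms by (auto simp: test_function_def)
  have "dirderiv u v x = 0" if x: "x \<notin> K" for x
  proof -
    have "open (- K)" using compact_imp_closed[OF K(1)] by (simp add: open_Compl)
    then have "(u has_derivative (\<lambda>h. 0)) (at x)"
      by (rule has_derivative_transform_within_open[where f = "\<lambda>x. 0", OF has_derivative_const]) (use x K(3) in auto)
    then have "frechet_derivative u (at x) = (\<lambda>h. 0)" by (rule frechet_derivative_at[symmetric])
    then show ?thesis by simp
  qed
  then show ?thesis using K smooth_dirderiv[OF u] unfolding test_function_def by blast
qed

context riem_domain
begin

definition form_product :: "nat \<Rightarrow> ('m, 'n) form \<Rightarrow> ('m, 'n) form \<Rightarrow> real" where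
  "form_product k \<alpha> \<beta> = (LINT p : \<Omega> | vol M. form_inner_at M k \<alpha> \<beta> p)"

lemma l2_form_iff:
  "l2_form M \<Omega> k \<alpha> \<longleftrightarrow> measurable_form k \<alpha> \<and> integrable (vol M) (\<lambda>p. indicator \<Omega> p * form_inner_at M k \<alpha> \<alpha> p)"
  by (simp add: l2_form_def measurable_form_def set_borel_measurable_def set_integrable_def)

lemma l2_is_form: "l2_form M \<Omega> k \<alpha> \<Longrightarrow> is_form M \<Omega> k \<alpha>"
  by (simp add: l2_form_def)

lemma l2_inner_integrable:
  assumes "l2_form M \<Omega> k \<alpha>" "l2_form M \<Omega> k \<beta>"
  shows "set_integrable (vol M) \<Omega> (form_inner_at M k \<alpha> \<beta>)"
  unfolding set_integrable_def
proof (rule Bochner_Integration.integrable_bound)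
  show "integrable (vol M) (\<lambda>p. indicator \<Omega> p * form_inner_at M k \<alpha> \<alpha> p + indicator \<Omega> p * form_inner_at M k \<beta> \<beta> p)"
    using assms by (intro Bochner_Integration.integrable_add) (auto simp: l2_form_iff)
  show "(\<lambda>p. indicator \<Omega> p *\<^sub>R form_inner_at M k \<alpha> \<beta> p) \<in> borel_measurable (vol M)"
    using form_inner_measurable[of k \<alpha> \<beta>] assms by (simp add: l2_form_iff)
  show "AE p in vol M. norm (indicator \<Omega> p *\<^sub>R form_inner_at M k \<alpha> \<beta> p)
      \<le> norm (indicator \<Omega> p * form_inner_at M k \<alpha> \<alpha> p + indicator \<Omega> p * form_inner_at M k \<beta> \<beta> p)"
  proof (rule AE_I2)
    fix p
    show "norm (indicator \<Omega> p *\<^sub>R form_inner_at M k \<alpha> \<beta> p)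
      \<le> norm (indicator \<Omega> p * form_inner_at M k \<alpha> \<alpha> p + indicator \<Omega> p * form_inner_at M k \<beta> \<beta> p)"
      using form_inner_abs_le[of p k \<alpha> \<beta>] by (cases "p \<in> \<Omega>") auto
  qed
qed

lemma is_form_add:
  assumes "is_form M \<Omega> k \<alpha>" "is_form M \<Omega> k \<beta>"
  shows "is_form M \<Omega> k (\<lambda>c x is. \<alpha> c x is + \<beta> c x is)"
  unfolding is_form_def
proof (intro conjI ballI allI impI)
  fix c x \<sigma> and "is" :: "'n list" assume *: "c \<in> atlas M" "x \<in> chart_domain c" "is \<in> idx k" "\<sigma> permutes {..<k}"
  have "\<alpha> c x (permute_list \<sigma> is) = of_int (sign \<sigma>) * \<alpha> c x is" "\<beta> c x (permute_list \<sigma> is) = of_int (sign \<sigma>) * \<beta> c x is"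
    using assms * unfolding is_form_def by blast+
  then show "\<alpha> c x (permute_list \<sigma> is) + \<beta> c x (permute_list \<sigma> is) = of_int (sign \<sigma>) * (\<alpha> c x is + \<beta> c x is)"
    by (simp only: distrib_left)
next
  fix c c' x and "is" :: "'n list" assume *: "c \<in> atlas M" "c' \<in> atlas M" "x \<in> snd c ` (fst c \<inter> fst c' \<inter> \<Omega>)" "is \<in> idx k"
  have "\<alpha> c x is = (\<Sum>js\<in>idx k. (\<Prod>l<k. jacobian c c' x $ (js ! l) $ (is ! l)) * \<alpha> c' (transition c c' x) js)"
    "\<beta> c x is = (\<Sum>js\<in>idx k. (\<Prod>l<k. jacobian c c' x $ (js ! l) $ (is ! l)) * \<beta> c' (transition c c' x) js)"
    using assms * unfolding is_form_def by blast+
  then show "\<alpha> c x is + \<beta> c x is = (\<Sum>js\<in>idx k. (\<Prod>l<k. jacobian c c' x $ (js ! l) $ (is ! l)) *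
      (\<alpha> c' (transition c c' x) js + \<beta> c' (transition c c' x) js))"
    by (simp only: distrib_left sum.distrib)
qed

lemma is_form_scale:
  assumes "is_form M \<Omega> k \<alpha>"
  shows "is_form M \<Omega> k (\<lambda>c x is. a * \<alpha> c x is)"
  unfolding is_form_def
proof (intro conjI ballI allI impI)
  fix c x \<sigma> and "is" :: "'n list" assume *: "c \<in> atlas M" "x \<in> chart_domain c" "is \<in> idx k" "\<sigma> permutes {..<k}"
  have "\<alpha> c x (permute_list \<sigma> is) = of_int (sign \<sigma>) * \<alpha> c x is"
    using assms * unfolding is_form_def by blast
  then show "a * \<alpha> c x (permute_list \<sigma> is) = of_int (sign \<sigma>) * (a * \<alpha> c x is)"
    by (simp only: mult.left_commute)
next
  fix c c' x and "is" :: "'n list" assume *: "c \<in> atlas M" "c' \<in> atlas M" "x \<in> snd c ` (fst c \<inter> fst c' \<inter> \<Omega>)" "is \<in> idx k"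
  have "\<alpha> c x is = (\<Sum>js\<in>idx k. (\<Prod>l<k. jacobian c c' x $ (js ! l) $ (is ! l)) * \<alpha> c' (transition c c' x) js)"
    using assms * unfolding is_form_def by blast
  then show "a * \<alpha> c x is = (\<Sum>js\<in>idx k. (\<Prod>l<k. jacobian c c' x $ (js ! l) $ (is ! l)) *
      (a * \<alpha> c' (transition c c' x) js))"
    by (simp only: sum_distrib_left mult.left_commute)
qed

lemma form_inner_add_right:
  "p \<in> \<Omega> \<Longrightarrow> form_inner_at M k \<alpha> (\<lambda>c x is. \<beta> c x is + \<beta>' c x is) p = form_inner_at M k \<alpha> \<beta> p + form_inner_at M k \<alpha> \<beta>' p"
  by (simp add: form_inner_sym[of p k \<alpha>] form_inner_add_left)

lemma form_inner_scale_right: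
  "p \<in> \<Omega> \<Longrightarrow> form_inner_at M k \<alpha> (\<lambda>c x is. a * \<beta> c x is) p = a * form_inner_at M k \<alpha> \<beta> p"
  by (simp add: form_inner_sym[of p k \<alpha>] form_inner_scale_left)

lemma l2_add:
  assumes "l2_form M \<Omega> k \<alpha>" "l2_form M \<Omega> k \<beta>"
  shows "l2_form M \<Omega> k (\<lambda>c x is. \<alpha> c x is + \<beta> c x is)"
  unfolding l2_form_iff
proof
  show "measurable_form k (\<lambda>c x is. \<alpha> c x is + \<beta> c x is)"
    unfolding measurable_form_def
  proof (intro conjI ballI)
    fix c and "is" :: "'n list" assume *: "c \<in> atlas M" "is \<in> idx k"
    have "(\<lambda>x. indicator (chart_domain c) x * \<alpha> c x is + indicator (chart_domain c) x * \<beta> c x is) \<in> borel_measurable borel"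
      using assms * by (intro borel_measurable_add) (auto simp: l2_form_iff measurable_form_def)
    then show "(\<lambda>x. indicator (chart_domain c) x * (\<alpha> c x is + \<beta> c x is)) \<in> borel_measurable borel"
      by (simp only: distrib_left)
  qed (use assms is_form_add l2_is_form in blast)
  have "integrable (vol M) (\<lambda>p. (indicator \<Omega> p * form_inner_at M k \<alpha> \<alpha> p + indicator \<Omega> p * form_inner_at M k \<alpha> \<beta> p) +
      (indicator \<Omega> p * form_inner_at M k \<alpha> \<beta> p + indicator \<Omega> p * form_inner_at M k \<beta> \<beta> p))"
    using l2_inner_integrable[OF assms] l2_inner_integrable[OF assms(1,1)] l2_inner_integrable[OF assms(2,2)]
    by (intro Bochner_Integration.integrable_add) (auto simp: set_integrable_def)
  then show "integrable (vol M) (\<lambda>p. indicator \<Omega> p * form_inner_at M k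
      (\<lambda>c x is. \<alpha> c x is + \<beta> c x is) (\<lambda>c x is. \<alpha> c x is + \<beta> c x is) p)"
    by (rule Bochner_Integration.integrable_cong[THEN iffD1, rotated -1])
       (auto simp: indicator_def form_inner_add_left form_inner_add_right form_inner_sym[of _ k \<beta> \<alpha>])
qed

lemma l2_scale:
  assumes "l2_form M \<Omega> k \<alpha>"
  shows "l2_form M \<Omega> k (\<lambda>c x is. a * \<alpha> c x is)"
  unfolding l2_form_iff
proof
  show "measurable_form k (\<lambda>c x is. a * \<alpha> c x is)"
    unfolding measurable_form_def
  proof (intro conjI ballI)
    fix c and "is" :: "'n list" assume *: "c \<in> atlas M" "is \<in> idx k"
    have "(\<lambda>x. indicator (chart_domain c) x * \<alpha> c x is) \<in> borel_measurable borel"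
      using assms * by (auto simp: l2_form_iff measurable_form_def)
    then have "(\<lambda>x. a * (indicator (chart_domain c) x * \<alpha> c x is)) \<in> borel_measurable borel"
      by (rule borel_measurable_times[OF borel_measurable_const])
    then show "(\<lambda>x. indicator (chart_domain c) x * (a * \<alpha> c x is)) \<in> borel_measurable borel"
      by (simp only: mult.left_commute)
  qed (use assms is_form_scale l2_is_form in blast)
  have "integrable (vol M) (\<lambda>p. (a * a) * (indicator \<Omega> p * form_inner_at M k \<alpha> \<alpha> p))"
    using assms by (simp add: l2_form_iff)
  then show "integrable (vol M) (\<lambda>p. indicator \<Omega> p * form_inner_at M k (\<lambda>c x is. a * \<alpha> c x is) (\<lambda>c x is. a * \<alpha> c x is) p)"
    by (rule Bochner_Integration.integrable_cong[THEN iffD1, rotated -1])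
       (auto simp: indicator_def form_inner_scale_left form_inner_scale_right)
qed

lemma l2_zero: "l2_form M \<Omega> k (\<lambda>c x is. 0)"
  unfolding l2_form_iff measurable_form_def is_form_def by (simp add: form_inner_at_def Let_def)

lemma form_product_sym: "form_product k \<alpha> \<beta> = form_product k \<beta> \<alpha>"
  unfolding form_product_def set_lebesgue_integral_def
  by (intro Bochner_Integration.integral_cong) (auto simp: indicator_def form_inner_sym)

lemma form_product_add_left:
  assumes "l2_form M \<Omega> k \<alpha>" "l2_form M \<Omega> k \<alpha>'" "l2_form M \<Omega> k \<beta>"
  shows "form_product k (\<lambda>c x is. \<alpha> c x is + \<alpha>' c x is) \<beta> = form_product k \<alpha> \<beta> + form_product k \<alpha>' \<beta>"
  unfolding form_product_def form_inner_add_left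
  by (rule set_integral_add(2)) (use assms l2_inner_integrable in blast)+

lemma form_product_scale_left:
  "form_product k (\<lambda>c x is. a * \<alpha> c x is) \<beta> = a * form_product k \<alpha> \<beta>"
  unfolding form_product_def form_inner_scale_left by (rule set_integral_mult_right)

lemma form_product_nonneg: "0 \<le> form_product k \<alpha> \<alpha>"
  unfolding form_product_def set_lebesgue_integral_def
  by (intro Bochner_Integration.integral_nonneg) (auto simp: indicator_def form_inner_nonneg)

lemma ae_eq_refl: "ae_eq M \<Omega> k \<alpha> \<alpha>"
  by (simp add: ae_eq_def)

lemma ae_eq_sym: "ae_eq M \<Omega> k \<alpha> \<beta> \<Longrightarrow> ae_eq M \<Omega> k \<beta> \<alpha>"
  unfolding ae_eq_def by (auto elim!: eventually_mono)

lemma ae_eq_trans: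
  assumes "ae_eq M \<Omega> k \<alpha> \<beta>" "ae_eq M \<Omega> k \<beta> \<gamma>" shows "ae_eq M \<Omega> k \<alpha> \<gamma>"
  using assms unfolding ae_eq_def by eventually_elim auto

lemma ae_eq_add:
  assumes "ae_eq M \<Omega> k \<alpha> \<alpha>'" "ae_eq M \<Omega> k \<beta> \<beta>'"
  shows "ae_eq M \<Omega> k (\<lambda>c x is. \<alpha> c x is + \<beta> c x is) (\<lambda>c x is. \<alpha>' c x is + \<beta>' c x is)"
  using assms unfolding ae_eq_def by eventually_elim auto

lemma ae_eq_scale:
  assumes "ae_eq M \<Omega> k \<alpha> \<alpha>'"
  shows "ae_eq M \<Omega> k (\<lambda>c x is. a * \<alpha> c x is) (\<lambda>c x is. a * \<alpha>' c x is)"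
  using assms unfolding ae_eq_def by eventually_elim auto

lemma form_product_cong:
  assumes l2: "l2_form M \<Omega> k \<alpha>" "l2_form M \<Omega> k \<alpha>'" "l2_form M \<Omega> k \<beta>" "l2_form M \<Omega> k \<beta>'"
    and ae: "ae_eq M \<Omega> k \<alpha> \<alpha>'" "ae_eq M \<Omega> k \<beta> \<beta>'"
  shows "form_product k \<alpha> \<beta> = form_product k \<alpha>' \<beta>'"
  unfolding form_product_def set_lebesgue_integral_def
proof (rule integral_cong_AE)
  show "(\<lambda>p. indicator \<Omega> p *\<^sub>R form_inner_at M k \<alpha> \<beta> p) \<in> borel_measurable (vol M)"
    "(\<lambda>p. indicator \<Omega> p *\<^sub>R form_inner_at M k \<alpha>' \<beta>' p) \<in> borel_measurable (vol M)"
    using form_inner_measurable[of k \<alpha> \<beta>] form_inner_measurable[of k \<alpha>' \<beta>'] l2 by (simp_all add: l2_form_iff)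
  show "AE p in vol M. indicator \<Omega> p *\<^sub>R form_inner_at M k \<alpha> \<beta> p = indicator \<Omega> p *\<^sub>R form_inner_at M k \<alpha>' \<beta>' p"
    using ae unfolding ae_eq_def
  proof eventually_elim
    case (elim p)
    show ?case
    proof (cases "p \<in> \<Omega>")
      case True
      then have "form_inner_at M k \<alpha> \<beta> p = form_inner_at M k \<alpha>' \<beta>' p"
        unfolding form_inner_some_chart chart_inner_def
        using elim some_chart[OF True] by (intro arg_cong2[where f="(/)"] refl tinner_cong) auto
      then show ?thesis by simp
    qed simp
  qed
qed

text \<open>The hypothesis says that \<open>\<alpha> - \<beta>\<close> has norm zero.\<close>

lemma form_product_separates:
  assumes l2: "l2_form M \<Omega> k \<alpha>" "l2_form M \<Omega> k \<beta>"
    and 0: "form_product k \<alpha> \<alpha> - 2 * form_product k \<alpha> \<beta> + form_product k \<beta> \<beta> = 0"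
  shows "ae_eq M \<Omega> k \<alpha> \<beta>"
proof -
  define \<delta> where "\<delta> = (\<lambda>c x is. \<alpha> c x is + (- 1) * \<beta> c x is)"
  have m\<beta>: "l2_form M \<Omega> k (\<lambda>c x is. (- 1) * \<beta> c x is)" by (rule l2_scale[OF l2(2)])
  have \<delta>: "l2_form M \<Omega> k \<delta>" unfolding \<delta>_def by (rule l2_add[OF l2(1) m\<beta>])
  have left: "form_product k \<delta> \<gamma> = form_product k \<alpha> \<gamma> - form_product k \<beta> \<gamma>" if "l2_form M \<Omega> k \<gamma>" for \<gamma>
    unfolding \<delta>_def form_product_add_left[OF l2(1) m\<beta> that] form_product_scale_left by simp
  have "form_product k \<delta> \<delta> = 0"
    using left[OF \<delta>] left[OF l2(1)] left[OF l2(2)] 0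
      form_product_sym[of k \<alpha> \<delta>] form_product_sym[of k \<beta> \<delta>] form_product_sym[of k \<alpha> \<beta>] by linarith
  then have "AE p in vol M. indicator \<Omega> p *\<^sub>R form_inner_at M k \<delta> \<delta> p = 0"
    unfolding form_product_def set_lebesgue_integral_def
    by (subst (asm) integral_nonneg_eq_0_iff_AE)
       (use l2_inner_integrable[OF \<delta> \<delta>] form_inner_nonneg in \<open>auto simp: set_integrable_def indicator_def\<close>)
  then show ?thesis
    unfolding ae_eq_def
  proof eventually_elim
    case (elim p)
    show ?case
    proof (intro impI ballI)
      fix c and "is" :: "'n list" assume *: "p \<in> \<Omega>" "c \<in> atlas M" "p \<in> fst c" "is \<in> idx k"
      then have "\<delta> c (snd c p) is = 0"
        using form_inner_zero_imp[OF l2_is_form[OF \<delta>] _ *] elim by simp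
      then show "\<alpha> c (snd c p) is = \<beta> c (snd c p) is" by (simp add: \<delta>_def)
    qed
  qed
qed

lemma rep_cls:
  assumes "l2_form M \<Omega> k \<alpha>"
  shows "l2_form M \<Omega> k (rep (cls M \<Omega> k \<alpha>))" "ae_eq M \<Omega> k \<alpha> (rep (cls M \<Omega> k \<alpha>))"
proof -
  have "\<alpha> \<in> cls M \<Omega> k \<alpha>" using assms by (simp add: cls_def ae_eq_refl)
  then have "rep (cls M \<Omega> k \<alpha>) \<in> cls M \<Omega> k \<alpha>" unfolding rep_def by (rule someI[where P = "\<lambda>\<omega>. \<omega> \<in> cls M \<Omega> k \<alpha>"])
  then show "l2_form M \<Omega> k (rep (cls M \<Omega> k \<alpha>))" "ae_eq M \<Omega> k \<alpha> (rep (cls M \<Omega> k \<alpha>))"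
    by (auto simp: cls_def)
qed

lemma cls_eqI: "ae_eq M \<Omega> k \<alpha> \<beta> \<Longrightarrow> cls M \<Omega> k \<alpha> = cls M \<Omega> k \<beta>"
  unfolding cls_def using ae_eq_trans ae_eq_sym by blast

lemma cadd_cls:
  assumes "l2_form M \<Omega> k \<alpha>" "l2_form M \<Omega> k \<beta>"
  shows "cadd M \<Omega> k (cls M \<Omega> k \<alpha>) (cls M \<Omega> k \<beta>) = cls M \<Omega> k (\<lambda>c x is. \<alpha> c x is + \<beta> c x is)"
  unfolding cadd_def by (intro cls_eqI ae_eq_add ae_eq_sym[OF rep_cls(2)] assms)

lemma cscale_cls:
  assumes "l2_form M \<Omega> k \<alpha>"
  shows "cscale M \<Omega> k a (cls M \<Omega> k \<alpha>) = cls M \<Omega> k (\<lambda>c x is. a * \<alpha> c x is)"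
  unfolding cscale_def by (intro cls_eqI ae_eq_scale ae_eq_sym[OF rep_cls(2)] assms)

lemma l2_inner_cls:
  assumes "l2_form M \<Omega> k \<alpha>" "l2_form M \<Omega> k \<beta>"
  shows "l2_inner M \<Omega> k (cls M \<Omega> k \<alpha>) (cls M \<Omega> k \<beta>) = form_product k \<alpha> \<beta>"
proof -
  have "form_product k \<alpha> \<beta> = form_product k (rep (cls M \<Omega> k \<alpha>)) (rep (cls M \<Omega> k \<beta>))"
    by (intro form_product_cong assms rep_cls)
  then show ?thesis by (simp add: l2_inner_def form_product_def)
qed

end

section \<open>The weak exterior derivative\<close>

context riem_domain
begin

text \<open>On a compact subset of the chart the squared components are bounded by a constant multiple of the
pointwise norm times the volume density, whose integral is at most the squared norm of the form.\<close>

lemma l2_square_integrable_chart: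
  assumes \<alpha>: "l2_form M \<Omega> k \<alpha>" and c: "c \<in> atlas M" and K: "compact K" "K \<subseteq> chart_domain c" and "is": "is \<in> idx k"
  shows "integrable lborel (\<lambda>x. indicator K x * (\<alpha> c x is)\<^sup>2)"
proof -
  have KD: "K \<subseteq> chart_image c" using K(2) by auto
  have "continuous_on K (\<lambda>x. fact k * tpow k (metric M c x) is is / vol_density c x)"
    unfolding tpow_def
    by (intro continuous_intros continuous_on_subset[OF metric_continuous[OF c] KD]
        continuous_on_subset[OF vol_density_continuous[OF c] KD])
       (use vol_density_pos[OF c] KD in force)
  then have "compact ((\<lambda>x. fact k * tpow k (metric M c x) is is / vol_density c x) ` K)"
    using K(1) by (rule compact_continuous_image)
  then have "bounded ((\<lambda>x. fact k * tpow k (metric M c x) is is / vol_density c x) ` K)"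
    by (rule compact_imp_bounded)
  then obtain B where B: "\<And>x. x \<in> K \<Longrightarrow> \<bar>fact k * tpow k (metric M c x) is is / vol_density c x\<bar> \<le> B"
    unfolding bounded_iff by auto
  define B' where "B' = max B 0"
  (* the pointwise squared norm in the chart, extended by zero *)
  define f where "f x = indicator (chart_domain c) x * chart_inner k \<alpha> \<alpha> c x" for x
  have m: "measurable_form k \<alpha>" using \<alpha> by (simp add: l2_form_iff)
  have f [measurable]: "f \<in> borel_measurable borel"
    unfolding f_def by (rule chart_inner_measurable[OF m m c])
  have f_nonneg: "0 \<le> f x" for x
  proof (cases "x \<in> chart_domain c")
    case True
    then have "posdef (matrix_inv (metric M c x))" by (intro posdef_matrix_inv metric_posdef[OF c]) auto
    then show ?thesis using True tinner_nonneg[of "matrix_inv (metric M c x)" k "\<alpha> c x"]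
      by (simp add: f_def chart_inner_def)
  qed (simp add: f_def)
  have fp: "ennreal (f (snd c p)) * indicator (fst c) p \<le> ennreal (indicator \<Omega> p * form_inner_at M k \<alpha> \<alpha> p)" for p
  proof (cases "p \<in> fst c")
    case True
    have "snd c p \<in> chart_domain c \<longleftrightarrow> p \<in> \<Omega>"
      using True chart_inj[OF c] by (auto simp: inj_on_def)
    then show ?thesis
      using True form_inner_chart[OF l2_is_form[OF \<alpha>] l2_is_form[OF \<alpha>] c _ True]
      by (cases "p \<in> \<Omega>") (auto simp: f_def)
  qed simp
  have "(\<integral>\<^sup>+ x. ennreal (vol_density c x) * indicator (chart_image c) x * ennreal (f x) \<partial>lborel) =
      (\<integral>\<^sup>+ p. ennreal (f (snd c p)) * indicator (fst c) p \<partial>vol M)"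
    by (rule nn_integral_vol_chart[OF c, symmetric]) measurable
  also have "\<dots> \<le> (\<integral>\<^sup>+ p. ennreal (indicator \<Omega> p * form_inner_at M k \<alpha> \<alpha> p) \<partial>vol M)"
    by (rule nn_integral_mono) (rule fp)
  also have "\<dots> < \<infinity>"
  proof -
    have "integrable (vol M) (\<lambda>p. indicator \<Omega> p * form_inner_at M k \<alpha> \<alpha> p)" using \<alpha> by (simp add: l2_form_iff)
    then have "(\<integral>\<^sup>+ p. ennreal (norm (indicator \<Omega> p * form_inner_at M k \<alpha> \<alpha> p)) \<partial>vol M) < \<infinity>"
      by (simp add: integrable_iff_bounded)
    moreover have "norm (indicator \<Omega> p * form_inner_at M k \<alpha> \<alpha> p) = indicator \<Omega> p * form_inner_at M k \<alpha> \<alpha> p" for p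
      using form_inner_nonneg by (auto simp: indicator_def)
    ultimately show ?thesis by simp
  qed
  finally have fin: "(\<integral>\<^sup>+ x. ennreal (vol_density c x) * indicator (chart_image c) x * ennreal (f x) \<partial>lborel) < \<infinity>" .
  have bound: "ennreal (norm (indicator K x * (\<alpha> c x is)\<^sup>2)) \<le>
      ennreal B' * (ennreal (vol_density c x) * indicator (chart_image c) x * ennreal (f x))" for x
  proof (cases "x \<in> K")
    case True
    then have x: "x \<in> chart_domain c" "x \<in> chart_image c" using K(2) by auto
    have d: "0 < vol_density c x" by (rule vol_density_pos[OF c x(2)])
    have ci: "0 \<le> chart_inner k \<alpha> \<alpha> c x" using f_nonneg[of x] x by (simp add: f_def)
    have "fact k * tpow k (metric M c x) is is / vol_density c x \<le> B'" using abs_le_D1[OF B[OF True]] by (simp add: B'_def le_max_iff_disj)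
    then have "fact k * tpow k (metric M c x) is is \<le> B' * vol_density c x" using d by (simp add: pos_divide_le_eq)
    then have "(\<alpha> c x is)\<^sup>2 \<le> (B' * vol_density c x) * chart_inner k \<alpha> \<alpha> c x"
      using chart_inner_component_bound[OF c x(2) "is", of \<alpha>] ci
      by (meson mult_right_mono order_trans)
    then have "ennreal ((\<alpha> c x is)\<^sup>2) \<le> ennreal (B' * (vol_density c x * f x))"
      using x by (intro ennreal_leI) (simp add: f_def mult.assoc)
    also have "\<dots> = ennreal B' * (ennreal (vol_density c x) * ennreal (f x))"
      using d f_nonneg[of x] by (simp add: ennreal_mult B'_def)
    finally show ?thesis using True x by simp
  qed simp
  show ?thesis
    unfolding integrable_iff_bounded
  proof
    have "(\<lambda>x. indicator K x * (indicator (chart_domain c) x * \<alpha> c x is)\<^sup>2) \<in> borel_measurable borel"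
    proof (rule borel_measurable_times)
      show "indicator K \<in> borel_measurable borel" using compact_imp_closed[OF K(1)] by simp
      have "(\<lambda>x. indicator (chart_domain c) x * \<alpha> c x is) \<in> borel_measurable borel"
        using m c "is" unfolding measurable_form_def by blast
      then show "(\<lambda>x. (indicator (chart_domain c) x * \<alpha> c x is)\<^sup>2) \<in> borel_measurable borel"
        by (rule borel_measurable_power)
    qed
    moreover have "indicator K x * (indicator (chart_domain c) x * \<alpha> c x is)\<^sup>2 = indicator K x * (\<alpha> c x is)\<^sup>2" for x
      using K(2) by (auto simp: indicator_def)
    ultimately show "(\<lambda>x. indicator K x * (\<alpha> c x is)\<^sup>2) \<in> borel_measurable lborel" by simp
    have "(\<integral>\<^sup>+ x. ennreal (norm (indicator K x * (\<alpha> c x is)\<^sup>2)) \<partial>lborel) \<le>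
        (\<integral>\<^sup>+ x. ennreal B' * (ennreal (vol_density c x) * indicator (chart_image c) x * ennreal (f x)) \<partial>lborel)"
      by (rule nn_integral_mono) (rule bound)
    also have "\<dots> = ennreal B' * (\<integral>\<^sup>+ x. ennreal (vol_density c x) * indicator (chart_image c) x * ennreal (f x) \<partial>lborel)"
    proof (rule nn_integral_cmult)
      have "(\<lambda>x. ennreal (f x)) \<in> borel_measurable lborel" using f by simp
      then show "(\<lambda>x. ennreal (vol_density c x) * indicator (chart_image c) x * ennreal (f x)) \<in> borel_measurable lborel"
        using vol_density_measurable[OF c] by (intro borel_measurable_times_ennreal[of "\<lambda>x. ennreal (vol_density c x) * indicator (chart_image c) x"]) simp_all
    qed
    also have "\<dots> < \<infinity>" using fin by (simp add: ennreal_mult_less_top)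
    finally show "(\<integral>\<^sup>+ x. ennreal (norm (indicator K x * (\<alpha> c x is)\<^sup>2)) \<partial>lborel) < \<infinity>" .
  qed
qed

lemma l2_locally_integrable:
  assumes \<alpha>: "l2_form M \<Omega> k \<alpha>" and c: "c \<in> atlas M" and K: "compact K" "K \<subseteq> chart_domain c" and "is": "is \<in> idx k"
  shows "set_integrable lborel K (\<lambda>x. \<alpha> c x is)"
  unfolding set_integrable_def
proof (rule Bochner_Integration.integrable_bound)
  have "integrable lborel (indicator K :: _ \<Rightarrow> real)"
    using K(1) by (intro integrable_real_indicator emeasure_compact_finite) (auto simp: compact_imp_closed)
  then show "integrable lborel (\<lambda>x. indicator K x + indicator K x * (\<alpha> c x is)\<^sup>2)"
    using l2_square_integrable_chart[OF assms] by (rule Bochner_Integration.integrable_add)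
  have "(\<lambda>x. indicator K x * (indicator (chart_domain c) x * \<alpha> c x is)) \<in> borel_measurable borel"
  proof (rule borel_measurable_times)
    show "indicator K \<in> borel_measurable borel" using compact_imp_closed[OF K(1)] by simp
    show "(\<lambda>x. indicator (chart_domain c) x * \<alpha> c x is) \<in> borel_measurable borel"
      using \<alpha> c "is" unfolding l2_form_iff measurable_form_def by blast
  qed
  moreover have "indicator K x * (indicator (chart_domain c) x * \<alpha> c x is) = indicator K x *\<^sub>R \<alpha> c x is" for x
    using K(2) by (auto simp: indicator_def)
  ultimately show "(\<lambda>x. indicator K x *\<^sub>R \<alpha> c x is) \<in> borel_measurable lborel" by simp
  have "\<bar>t\<bar> \<le> 1 + t\<^sup>2" for t :: real
  proof -
    have "0 \<le> (\<bar>t\<bar> - 1)\<^sup>2" by simp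
    then have "2 * \<bar>t\<bar> \<le> 1 + t\<^sup>2" by (simp add: power2_diff)
    then show ?thesis by simp
  qed
  then show "AE x in lborel. norm (indicator K x *\<^sub>R \<alpha> c x is) \<le> norm (indicator K x + indicator K x * (\<alpha> c x is)\<^sup>2)"
    by (intro AE_I2) (auto simp: indicator_def)
qed

text \<open>Without this the integrals in \<open>weak_ext_deriv\<close> could have the default value \<open>0\<close>, and would not be
additive.\<close>

lemma l2_test_integrable:
  assumes \<alpha>: "l2_form M \<Omega> k \<alpha>" and c: "c \<in> atlas M" and "is": "is \<in> idx k"
    and u: "test_function (chart_domain c) u"
  shows "set_integrable lborel (chart_domain c) (\<lambda>x. \<alpha> c x is * u x)"
proof -
  obtain K where K: "compact K" "K \<subseteq> chart_domain c" "\<And>x. x \<notin> K \<Longrightarrow> u x = 0" and smooth: "smooth_on UNIV u"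
    using u by (auto simp: test_function_def)
  have cont: "continuous_on UNIV u" by (rule smooth_continuous[OF smooth])
  have "bounded (u ` K)"
    using compact_continuous_image[OF continuous_on_subset[OF cont] K(1)] by (auto intro: compact_imp_bounded)
  then obtain B where B: "\<And>x. x \<in> K \<Longrightarrow> \<bar>u x\<bar> \<le> B" unfolding bounded_iff by auto
  have um [measurable]: "u \<in> borel_measurable borel" by (rule borel_measurable_continuous_onI[OF cont])
  have int: "integrable lborel (\<lambda>x. indicator K x *\<^sub>R \<alpha> c x is)"
    using l2_locally_integrable[OF \<alpha> c K(1,2) "is"] by (simp add: set_integrable_def)
  have "integrable lborel (\<lambda>x. (indicator K x *\<^sub>R \<alpha> c x is) * u x)"
  proof (rule Bochner_Integration.integrable_bound)
    show "integrable lborel (\<lambda>x. B * (indicator K x *\<^sub>R \<alpha> c x is))" using int by simp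
    show "(\<lambda>x. (indicator K x *\<^sub>R \<alpha> c x is) * u x) \<in> borel_measurable lborel"
      using borel_measurable_integrable[OF int] by measurable
    show "AE x in lborel. norm ((indicator K x *\<^sub>R \<alpha> c x is) * u x) \<le> norm (B * (indicator K x *\<^sub>R \<alpha> c x is))"
    proof (rule AE_I2)
      fix x
      show "norm ((indicator K x *\<^sub>R \<alpha> c x is) * u x) \<le> norm (B * (indicator K x *\<^sub>R \<alpha> c x is))"
      proof (cases "x \<in> K")
        case True
        then have "\<bar>\<alpha> c x is\<bar> * \<bar>u x\<bar> \<le> \<bar>\<alpha> c x is\<bar> * \<bar>B\<bar>" using B[OF True] by (intro mult_left_mono) auto
        then show ?thesis using True by (simp add: abs_mult mult.commute)
      qed simp
    qed
  qed
  moreover have "(indicator K x *\<^sub>R \<alpha> c x is) * u x = indicator (chart_domain c) x *\<^sub>R (\<alpha> c x is * u x)" for x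
    using K by (cases "x \<in> K") (auto simp: indicator_def)
  ultimately show ?thesis unfolding set_integrable_def by (simp only:)
qed

abbreviation pairing :: "('m, 'n) chart \<Rightarrow> (real ^ 'n \<Rightarrow> real) \<Rightarrow> (real ^ 'n \<Rightarrow> real) \<Rightarrow> real" where
  "pairing c a u \<equiv> (LINT x : chart_domain c | lborel. a x * u x)"

lemma weak_ext_deriv_iff:
  "weak_ext_deriv M \<Omega> k \<omega> \<eta> \<longleftrightarrow> (\<forall>c\<in>atlas M. \<forall>u. test_function (chart_domain c) u \<longrightarrow> (\<forall>is\<in>idx (Suc k).
     pairing c (\<lambda>x. \<eta> c x is) u =
       - (\<Sum>j\<le>k. (-1) ^ j * pairing c (\<lambda>x. \<omega> c x (delete_at j is)) (dirderiv u (axis (is ! j) 1)))))"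
  by (simp add: weak_ext_deriv_def delete_at_def)

lemma pairing_add:
  assumes "l2_form M \<Omega> k \<alpha>" "l2_form M \<Omega> k \<beta>" "c \<in> atlas M" "is \<in> idx k" "test_function (chart_domain c) u"
  shows "pairing c (\<lambda>x. \<alpha> c x is + \<beta> c x is) u = pairing c (\<lambda>x. \<alpha> c x is) u + pairing c (\<lambda>x. \<beta> c x is) u"
  using set_integral_add(2)[OF l2_test_integrable[OF assms(1,3,4,5)] l2_test_integrable[OF assms(2,3,4,5)]]
  by (simp only: distrib_right)

lemma pairing_scale: "pairing c (\<lambda>x. a * f x) u = a * pairing c f u"
  by (simp only: mult.assoc set_integral_mult_right)

lemma pairing_cong:
  assumes "l2_form M \<Omega> k \<alpha>" "l2_form M \<Omega> k \<beta>" "ae_eq M \<Omega> k \<alpha> \<beta>" "c \<in> atlas M" "is \<in> idx k"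
    "test_function (chart_domain c) u"
  shows "pairing c (\<lambda>x. \<alpha> c x is) u = pairing c (\<lambda>x. \<beta> c x is) u"
  unfolding set_lebesgue_integral_def
proof (rule integral_cong_AE)
  show "(\<lambda>x. indicator (chart_domain c) x *\<^sub>R (\<alpha> c x is * u x)) \<in> borel_measurable lborel"
    "(\<lambda>x. indicator (chart_domain c) x *\<^sub>R (\<beta> c x is * u x)) \<in> borel_measurable lborel"
    using l2_test_integrable[OF assms(1,4,5,6)] l2_test_integrable[OF assms(2,4,5,6)]
    unfolding set_integrable_def by (auto dest: borel_measurable_integrable)
  have "AE p in vol M. p \<in> fst c \<inter> \<Omega> \<longrightarrow> \<alpha> c (snd c p) is = \<beta> c (snd c p) is"
    using assms(3) unfolding ae_eq_def by eventually_elim (use assms(4,5) in auto)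
  then have "AE x in lborel. x \<in> chart_domain c \<longrightarrow> \<alpha> c x is = \<beta> c x is"
    by (rule AE_to_chart[OF assms(4)])
  then show "AE x in lborel. indicator (chart_domain c) x *\<^sub>R (\<alpha> c x is * u x) = indicator (chart_domain c) x *\<^sub>R (\<beta> c x is * u x)"
    by eventually_elim (auto simp: indicator_def)
qed

lemma delete_at_idx: "is \<in> idx (Suc k) \<Longrightarrow> j \<le> k \<Longrightarrow> delete_at j is \<in> idx k"
  by (simp add: length_delete_at)

lemma weak_ext_deriv_add:
  assumes l2: "l2_form M \<Omega> k \<omega>" "l2_form M \<Omega> k \<omega>'" "l2_form M \<Omega> (Suc k) \<eta>" "l2_form M \<Omega> (Suc k) \<eta>'"
    and w: "weak_ext_deriv M \<Omega> k \<omega> \<eta>" "weak_ext_deriv M \<Omega> k \<omega>' \<eta>'"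
  shows "weak_ext_deriv M \<Omega> k (\<lambda>c x is. \<omega> c x is + \<omega>' c x is) (\<lambda>c x is. \<eta> c x is + \<eta>' c x is)"
  unfolding weak_ext_deriv_iff
proof (intro ballI allI impI)
  fix c u and "is" :: "'n list"
  assume c: "c \<in> atlas M" and u: "test_function (chart_domain c) u" and "is": "is \<in> idx (Suc k)"
  have "pairing c (\<lambda>x. \<omega> c x (delete_at j is) + \<omega>' c x (delete_at j is)) (dirderiv u (axis (is ! j) 1)) =
      pairing c (\<lambda>x. \<omega> c x (delete_at j is)) (dirderiv u (axis (is ! j) 1)) +
      pairing c (\<lambda>x. \<omega>' c x (delete_at j is)) (dirderiv u (axis (is ! j) 1))" if "j \<le> k" for j
    using pairing_add[OF l2(1,2) c delete_at_idx[OF "is" that] test_function_dirderiv[OF u]] .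
  then have "(\<Sum>j\<le>k. (-1) ^ j * pairing c (\<lambda>x. \<omega> c x (delete_at j is) + \<omega>' c x (delete_at j is)) (dirderiv u (axis (is ! j) 1))) =
      (\<Sum>j\<le>k. (-1) ^ j * pairing c (\<lambda>x. \<omega> c x (delete_at j is)) (dirderiv u (axis (is ! j) 1))) +
      (\<Sum>j\<le>k. (-1) ^ j * pairing c (\<lambda>x. \<omega>' c x (delete_at j is)) (dirderiv u (axis (is ! j) 1)))"
    unfolding sum.distrib[symmetric] by (intro sum.cong refl) (simp add: distrib_left)
  moreover have "pairing c (\<lambda>x. \<eta> c x is) u =
       - (\<Sum>j\<le>k. (-1) ^ j * pairing c (\<lambda>x. \<omega> c x (delete_at j is)) (dirderiv u (axis (is ! j) 1)))"
    using w(1) c u "is" unfolding weak_ext_deriv_iff by blast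
  moreover have "pairing c (\<lambda>x. \<eta>' c x is) u =
       - (\<Sum>j\<le>k. (-1) ^ j * pairing c (\<lambda>x. \<omega>' c x (delete_at j is)) (dirderiv u (axis (is ! j) 1)))"
    using w(2) c u "is" unfolding weak_ext_deriv_iff by blast
  ultimately show "pairing c (\<lambda>x. \<eta> c x is + \<eta>' c x is) u =
      - (\<Sum>j\<le>k. (-1) ^ j * pairing c (\<lambda>x. \<omega> c x (delete_at j is) + \<omega>' c x (delete_at j is)) (dirderiv u (axis (is ! j) 1)))"
    unfolding pairing_add[OF l2(3,4) c "is" u] by linarith
qed

lemma weak_ext_deriv_scale:
  assumes w: "weak_ext_deriv M \<Omega> k \<omega> \<eta>"
  shows "weak_ext_deriv M \<Omega> k (\<lambda>c x is. a * \<omega> c x is) (\<lambda>c x is. a * \<eta> c x is)"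
  unfolding weak_ext_deriv_iff pairing_scale
proof (intro ballI allI impI)
  fix c u and "is" :: "'n list"
  assume c: "c \<in> atlas M" and u: "test_function (chart_domain c) u" and "is": "is \<in> idx (Suc k)"
  have "pairing c (\<lambda>x. \<eta> c x is) u =
       - (\<Sum>j\<le>k. (-1) ^ j * pairing c (\<lambda>x. \<omega> c x (delete_at j is)) (dirderiv u (axis (is ! j) 1)))"
    using w c u "is" unfolding weak_ext_deriv_iff by blast
  then show "a * pairing c (\<lambda>x. \<eta> c x is) u =
       - (\<Sum>j\<le>k. (-1) ^ j * (a * pairing c (\<lambda>x. \<omega> c x (delete_at j is)) (dirderiv u (axis (is ! j) 1))))"
    by (simp only: mult.left_commute[of _ a] sum_distrib_left[symmetric] mult_minus_right)
qed

lemma weak_ext_deriv_zero: "weak_ext_deriv M \<Omega> k (\<lambda>c x is. 0) (\<lambda>c x is. 0)"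
  by (simp add: weak_ext_deriv_iff set_lebesgue_integral_def)

lemma weak_ext_deriv_cong:
  assumes l2: "l2_form M \<Omega> k \<omega>" "l2_form M \<Omega> k \<omega>'" and ae: "ae_eq M \<Omega> k \<omega> \<omega>'"
    and w: "weak_ext_deriv M \<Omega> k \<omega> \<eta>"
  shows "weak_ext_deriv M \<Omega> k \<omega>' \<eta>"
  unfolding weak_ext_deriv_iff
proof (intro ballI allI impI)
  fix c u and "is" :: "'n list"
  assume c: "c \<in> atlas M" and u: "test_function (chart_domain c) u" and "is": "is \<in> idx (Suc k)"
  have "pairing c (\<lambda>x. \<omega> c x (delete_at j is)) (dirderiv u (axis (is ! j) 1)) =
      pairing c (\<lambda>x. \<omega>' c x (delete_at j is)) (dirderiv u (axis (is ! j) 1))" if "j \<le> k" for j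
    using pairing_cong[OF l2 ae c delete_at_idx[OF "is" that] test_function_dirderiv[OF u]] .
  then have "(\<Sum>j\<le>k. (-1) ^ j * pairing c (\<lambda>x. \<omega> c x (delete_at j is)) (dirderiv u (axis (is ! j) 1))) =
      (\<Sum>j\<le>k. (-1) ^ j * pairing c (\<lambda>x. \<omega>' c x (delete_at j is)) (dirderiv u (axis (is ! j) 1)))"
    by (intro sum.cong refl arg_cong2[where f="(*)"]) auto
  moreover have "pairing c (\<lambda>x. \<eta> c x is) u =
       - (\<Sum>j\<le>k. (-1) ^ j * pairing c (\<lambda>x. \<omega> c x (delete_at j is)) (dirderiv u (axis (is ! j) 1)))"
    using w c u "is" unfolding weak_ext_deriv_iff by blast
  ultimately show "pairing c (\<lambda>x. \<eta> c x is) u =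
       - (\<Sum>j\<le>k. (-1) ^ j * pairing c (\<lambda>x. \<omega>' c x (delete_at j is)) (dirderiv u (axis (is ! j) 1)))"
    by (simp only:)
qed

text \<open>The atlas may be uncountable, so null sets are collected over a countable subatlas only; the
transformation law carries equality at a point to every other chart around that point.\<close>

lemma ae_eq_of_charts:
  assumes f: "is_form M \<Omega> k \<alpha>" "is_form M \<Omega> k \<beta>"
    and eq: "\<And>c is. c \<in> atlas M \<Longrightarrow> is \<in> idx k \<Longrightarrow> AE x in lborel. x \<in> chart_domain c \<longrightarrow> \<alpha> c x is = \<beta> c x is"
  shows "ae_eq M \<Omega> k \<alpha> \<beta>"
proof -
  obtain C where C: "countable C" "C \<subseteq> atlas M" "(\<Union>c\<in>C. fst c) = topspace (mtop M)" by (rule countable_charts)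
  have "AE p in vol M. p \<in> fst c \<inter> \<Omega> \<longrightarrow> (\<forall>is\<in>idx k. \<alpha> c (snd c p) is = \<beta> c (snd c p) is)" if c: "c \<in> C" for c
  proof (rule AE_from_chart)
    show "c \<in> atlas M" using C c by blast
    then have "AE x in lborel. \<forall>is\<in>idx k. x \<in> chart_domain c \<longrightarrow> \<alpha> c x is = \<beta> c x is"
      using eq by (subst AE_ball_countable) (auto intro: countable_finite)
    then show "AE x in lborel. x \<in> chart_domain c \<longrightarrow> (\<forall>is\<in>idx k. \<alpha> c x is = \<beta> c x is)"
      by eventually_elim blast
  qed
  then have "AE p in vol M. \<forall>c\<in>C. p \<in> fst c \<inter> \<Omega> \<longrightarrow> (\<forall>is\<in>idx k. \<alpha> c (snd c p) is = \<beta> c (snd c p) is)"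
    using C(1) by (subst AE_ball_countable) auto
  then show ?thesis
    unfolding ae_eq_def
  proof eventually_elim
    case (elim p)
    show ?case
    proof (intro impI ballI)
      fix c' and "is" :: "'n list" assume *: "p \<in> \<Omega>" "c' \<in> atlas M" "p \<in> fst c'" "is \<in> idx k"
      obtain c where c: "c \<in> C" "p \<in> fst c" using *(1) domain_subset C(3) by blast
      then have c': "c \<in> atlas M" using C(2) by blast
      show "\<alpha> c' (snd c' p) is = \<beta> c' (snd c' p) is"
        unfolding form_change_chart[OF f(1) *(2) c' *(1) *(3) c(2) *(4)] form_change_chart[OF f(2) *(2) c' *(1) *(3) c(2) *(4)]
        using elim c *(1) by (intro sum.cong refl) auto
    qed
  qed
qed

lemma weak_ext_deriv_unique:
  assumes l2: "l2_form M \<Omega> (Suc k) \<eta>" "l2_form M \<Omega> (Suc k) \<eta>'"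
    and w: "weak_ext_deriv M \<Omega> k \<omega> \<eta>" "weak_ext_deriv M \<Omega> k \<omega> \<eta>'"
  shows "ae_eq M \<Omega> (Suc k) \<eta> \<eta>'"
proof (rule ae_eq_of_charts[OF l2_is_form[OF l2(1)] l2_is_form[OF l2(2)]])
  fix c and "is" :: "'n list" assume c: "c \<in> atlas M" and "is": "is \<in> idx (Suc k)"
  have "AE x in lborel. x \<in> chart_domain c \<longrightarrow> \<eta> c x is - \<eta>' c x is = 0"
  proof (rule fundamental_lemma[OF open_chart_domain[OF c]])
    show "set_integrable lborel K (\<lambda>x. \<eta> c x is - \<eta>' c x is)" if "compact K" "K \<subseteq> chart_domain c" for K
      by (intro set_integral_diff(1) l2_locally_integrable[OF l2(1) c that "is"] l2_locally_integrable[OF l2(2) c that "is"])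
    fix u assume u: "test_function (chart_domain c) u"
    have "pairing c (\<lambda>x. \<eta> c x is) u = pairing c (\<lambda>x. \<eta>' c x is) u"
      using w c u "is" unfolding weak_ext_deriv_iff by auto
    moreover have "pairing c (\<lambda>x. \<eta> c x is - \<eta>' c x is) u = pairing c (\<lambda>x. \<eta> c x is) u - pairing c (\<lambda>x. \<eta>' c x is) u"
      using set_integral_diff(2)[OF l2_test_integrable[OF l2(1) c "is" u] l2_test_integrable[OF l2(2) c "is" u]]
      by (simp only: left_diff_distrib)
    ultimately show "pairing c (\<lambda>x. \<eta> c x is - \<eta>' c x is) u = 0" by simp
  qed
  then show "AE x in lborel. x \<in> chart_domain c \<longrightarrow> \<eta> c x is = \<eta>' c x is" by simp
qed

text \<open>Testing the relation between \<open>\<omega>\<close> and \<open>\<eta>\<close> with derivatives of a test function turns the derivative of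
\<open>\<eta>\<close> into an alternating double sum of second derivatives.\<close>

lemma weak_ext_deriv_twice:
  assumes w: "weak_ext_deriv M \<Omega> k \<omega> \<eta>"
  shows "weak_ext_deriv M \<Omega> (Suc k) \<eta> (\<lambda>c x is. 0)"
  unfolding weak_ext_deriv_iff
proof (intro ballI allI impI)
  fix c u and "is" :: "'n list"
  assume c: "c \<in> atlas M" and u: "test_function (chart_domain c) u" and "is": "is \<in> idx (Suc (Suc k))"
  let ?e = "\<lambda>i. axis i (1::real) :: real ^ 'n"
  define F where "F j l = pairing c (\<lambda>x. \<omega> c x (delete_at l (delete_at j is)))
      (dirderiv (dirderiv u (?e (is ! j))) (?e (delete_at j is ! l)))" for j l
  have step: "pairing c (\<lambda>x. \<eta> c x (delete_at j is)) (dirderiv u (?e (is ! j))) = - (\<Sum>l\<le>k. (-1) ^ l * F j l)"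
    if j: "j \<le> Suc k" for j
    using w c test_function_dirderiv[OF u] delete_at_idx[OF "is" j] unfolding weak_ext_deriv_iff F_def by blast
  have "F j l = F l (j - 1)" if "l < j" "j \<le> Suc k" for l j
  proof -
    have len: "length is = Suc (Suc k)" using "is" by simp
    have "delete_at j is ! l = is ! l" "delete_at l is ! (j - 1) = is ! j"
      using that len by (auto simp: nth_delete_at)
    moreover have "dirderiv (dirderiv u (?e (is ! j))) (?e (is ! l)) x = dirderiv (dirderiv u (?e (is ! l))) (?e (is ! j)) x" for x
      using u by (intro mixed_derivatives_commute) (simp add: test_function_def)
    ultimately show ?thesis
      unfolding F_def using delete_at_commute[of l j "is"] that len by (simp only:)
  qed
  then have "(\<Sum>j\<le>Suc k. (-1) ^ j * (\<Sum>l\<le>k. (-1) ^ l * F j l)) = 0"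
    by (rule alternating_double_sum_zero)
  moreover have "(\<Sum>j\<le>Suc k. (-1) ^ j * pairing c (\<lambda>x. \<eta> c x (delete_at j is)) (dirderiv u (?e (is ! j)))) =
      - (\<Sum>j\<le>Suc k. (-1) ^ j * (\<Sum>l\<le>k. (-1) ^ l * F j l))"
    unfolding sum_negf[symmetric] by (intro sum.cong refl) (simp only: atMost_iff step mult_minus_right)
  ultimately show "pairing c (\<lambda>x. 0) u =
      - (\<Sum>j\<le>Suc k. (-1) ^ j * pairing c (\<lambda>x. \<eta> c x (delete_at j is)) (dirderiv u (?e (is ! j))))"
    by (simp add: set_lebesgue_integral_def)
qed

end

section \<open>The Hilbert complex of differential forms\<close>

context riem_domain
begin

lemma ext_d_cls:
  assumes l2: "l2_form M \<Omega> k \<omega>" "l2_form M \<Omega> (Suc k) \<eta>" and w: "weak_ext_deriv M \<Omega> k \<omega> \<eta>"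
  shows "ext_d M \<Omega> k (cls M \<Omega> k \<omega>) = cls M \<Omega> (Suc k) \<eta>"
proof -
  let ?r = "rep (cls M \<Omega> k \<omega>)"
  let ?P = "\<lambda>\<eta>. l2_form M \<Omega> (Suc k) \<eta> \<and> weak_ext_deriv M \<Omega> k ?r \<eta>"
  have wr: "weak_ext_deriv M \<Omega> k ?r \<eta>"
    by (rule weak_ext_deriv_cong[OF l2(1) rep_cls[OF l2(1)] w])
  then have "?P (SOME \<eta>. ?P \<eta>)" using l2(2) by (intro someI[of ?P \<eta>]) simp
  then have "ae_eq M \<Omega> (Suc k) (SOME \<eta>. ?P \<eta>) \<eta>"
    using weak_ext_deriv_unique[OF _ l2(2) _ wr] by blast
  then show ?thesis unfolding ext_d_def by (rule cls_eqI)
qed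

lemma HL_E:
  assumes "X \<in> HL M \<Omega> k"
  obtains \<omega> \<eta> where "l2_form M \<Omega> k \<omega>" "l2_form M \<Omega> (Suc k) \<eta>" "weak_ext_deriv M \<Omega> k \<omega> \<eta>"
    "X = cls M \<Omega> k \<omega>" "ext_d M \<Omega> k X = cls M \<Omega> (Suc k) \<eta>"
  using assms ext_d_cls unfolding HL_def by blast

lemma HL_I:
  "l2_form M \<Omega> k \<omega> \<Longrightarrow> l2_form M \<Omega> (Suc k) \<eta> \<Longrightarrow> weak_ext_deriv M \<Omega> k \<omega> \<eta> \<Longrightarrow> cls M \<Omega> k \<omega> \<in> HL M \<Omega> k"
  unfolding HL_def by blast

lemma ip_carrier_HL:
  "ip_carrier (HL M \<Omega> k) (cadd M \<Omega> k) (cscale M \<Omega> k) (czero M \<Omega> k) (l2_inner M \<Omega> k)"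
proof
  show "czero M \<Omega> k \<in> HL M \<Omega> k"
    unfolding czero_def by (rule HL_I[OF l2_zero l2_zero weak_ext_deriv_zero])
next
  fix X Y assume "X \<in> HL M \<Omega> k" "Y \<in> HL M \<Omega> k"
  then show "cadd M \<Omega> k X Y \<in> HL M \<Omega> k"
    by (elim HL_E) (simp add: cadd_cls HL_I[OF l2_add l2_add weak_ext_deriv_add])
next
  fix X c assume "X \<in> HL M \<Omega> k"
  then show "cscale M \<Omega> k c X \<in> HL M \<Omega> k"
    by (elim HL_E) (simp add: cscale_cls HL_I[OF l2_scale l2_scale weak_ext_deriv_scale])
next
  fix X Y assume "X \<in> HL M \<Omega> k" "Y \<in> HL M \<Omega> k"
  then show "l2_inner M \<Omega> k X Y = l2_inner M \<Omega> k Y X"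
    by (elim HL_E) (simp add: l2_inner_cls form_product_sym)
next
  fix X assume "X \<in> HL M \<Omega> k"
  then show "l2_inner M \<Omega> k (czero M \<Omega> k) X = 0"
  proof (elim HL_E)
    fix \<omega> assume "l2_form M \<Omega> k \<omega>" "X = cls M \<Omega> k \<omega>"
    then show ?thesis
      using form_product_scale_left[of k 0 \<omega> \<omega>] by (simp add: czero_def l2_inner_cls l2_zero)
  qed
next
  fix X Y Z assume "X \<in> HL M \<Omega> k" "Y \<in> HL M \<Omega> k" "Z \<in> HL M \<Omega> k"
  then show "l2_inner M \<Omega> k (cadd M \<Omega> k X Y) Z = l2_inner M \<Omega> k X Z + l2_inner M \<Omega> k Y Z"
    by (elim HL_E) (simp add: cadd_cls l2_inner_cls l2_add form_product_add_left)
next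
  fix X Z c assume "X \<in> HL M \<Omega> k" "Z \<in> HL M \<Omega> k"
  then show "l2_inner M \<Omega> k (cscale M \<Omega> k c X) Z = c * l2_inner M \<Omega> k X Z"
    by (elim HL_E) (simp add: cscale_cls l2_inner_cls l2_scale form_product_scale_left)
next
  fix X assume "X \<in> HL M \<Omega> k"
  then show "0 \<le> l2_inner M \<Omega> k X X"
    by (elim HL_E) (simp add: l2_inner_cls form_product_nonneg)
next
  fix X Y assume "X \<in> HL M \<Omega> k" "Y \<in> HL M \<Omega> k"
    and 0: "l2_inner M \<Omega> k X X - 2 * l2_inner M \<Omega> k X Y + l2_inner M \<Omega> k Y Y = 0"
  then show "X = Y"
  proof (elim HL_E)
    fix \<alpha> \<beta> assume "l2_form M \<Omega> k \<alpha>" "X = cls M \<Omega> k \<alpha>" "l2_form M \<Omega> k \<beta>" "Y = cls M \<Omega> k \<beta>"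
    then show ?thesis
      using 0 by (auto simp: l2_inner_cls intro!: cls_eqI form_product_separates)
  qed
qed

sublocale forms: hilbert_complex "HL M \<Omega>" "cadd M \<Omega>" "cscale M \<Omega>" "czero M \<Omega>" "l2_inner M \<Omega>" "ext_d M \<Omega>"
proof (rule hilbert_complex.intro)
  show "ip_carrier (HL M \<Omega> k) (cadd M \<Omega> k) (cscale M \<Omega> k) (czero M \<Omega> k) (l2_inner M \<Omega> k)" for k
    by (rule ip_carrier_HL)
next
  fix X k assume "X \<in> HL M \<Omega> k"
  then show "ext_d M \<Omega> k X \<in> HL M \<Omega> (Suc k)"
  proof (rule HL_E)
    fix \<omega> \<eta> assume "l2_form M \<Omega> (Suc k) \<eta>" "weak_ext_deriv M \<Omega> k \<omega> \<eta>" "ext_d M \<Omega> k X = cls M \<Omega> (Suc k) \<eta>"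
    then show ?thesis using HL_I[OF _ l2_zero weak_ext_deriv_twice] by simp
  qed
next
  fix X Y k assume "X \<in> HL M \<Omega> k" "Y \<in> HL M \<Omega> k"
  then show "ext_d M \<Omega> k (cadd M \<Omega> k X Y) = cadd M \<Omega> (Suc k) (ext_d M \<Omega> k X) (ext_d M \<Omega> k Y)"
    by (elim HL_E) (simp add: cadd_cls ext_d_cls[OF l2_add l2_add weak_ext_deriv_add])
next
  fix X c k assume "X \<in> HL M \<Omega> k"
  then show "ext_d M \<Omega> k (cscale M \<Omega> k c X) = cscale M \<Omega> (Suc k) c (ext_d M \<Omega> k X)"
    by (elim HL_E) (simp add: cscale_cls ext_d_cls[OF l2_scale l2_scale weak_ext_deriv_scale])
next
  fix X k assume "X \<in> HL M \<Omega> k"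
  then show "ext_d M \<Omega> (Suc k) (ext_d M \<Omega> k X) = czero M \<Omega> (Suc (Suc k))"
    by (elim HL_E) (simp add: czero_def ext_d_cls[OF _ l2_zero weak_ext_deriv_twice])
qed

lemma cls_rep: "X \<in> HL M \<Omega> k \<Longrightarrow> cls M \<Omega> k (rep X) = X" "X \<in> HL M \<Omega> k \<Longrightarrow> l2_form M \<Omega> k (rep X)"
  by (elim HL_E; simp add: rep_cls cls_eqI[OF rep_cls(2), symmetric])+

lemma cdiff_eq_minus:
  assumes "X \<in> HL M \<Omega> k" "Y \<in> HL M \<Omega> k"
  shows "cdiff M \<Omega> k X Y = forms.deg.minus k X Y"
proof -
  have "forms.deg.minus k X Y = cadd M \<Omega> k (cls M \<Omega> k (rep X)) (cscale M \<Omega> k (- 1) (cls M \<Omega> k (rep Y)))"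
    using assms by (simp add: forms.deg.minus_def cls_rep(1))
  also have "\<dots> = cls M \<Omega> k (\<lambda>c x is. rep X c x is + (- 1) * rep Y c x is)"
    unfolding cscale_cls[OF cls_rep(2)[OF assms(2)]]
    by (rule cadd_cls[OF cls_rep(2)[OF assms(1)] l2_scale[OF cls_rep(2)[OF assms(2)]]])
  finally show ?thesis by (simp add: cdiff_def)
qed

lemma H_norm_eq: "H_norm M \<Omega> k X = forms.graph_norm k X"
  by (simp add: H_norm_def l2_norm_def forms.graph_norm_def forms.deg.nrm_def)

text \<open>The linear combinations of the generators are obtained by adjoining the generators one by one.\<close>

lemma fin_dim_subspace_imp_fin_dim:
  assumes "fin_dim_subspace M \<Omega> k V" shows "forms.deg.fin_dim k V"
proof -
  have "\<exists>B. finite B \<and> B \<subseteq> V \<and> (\<forall>X\<in>V. \<exists>a. X = cls M \<Omega> k (\<lambda>c x is. \<Sum>b\<in>B. a b * rep b c x is))"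
    using assms unfolding fin_dim_subspace_def by (elim conjE)
  then obtain B where B: "finite B" "B \<subseteq> V"
    and span: "\<forall>X\<in>V. \<exists>a. X = cls M \<Omega> k (\<lambda>c x is. \<Sum>b\<in>B. a b * rep b c x is)"
    by (elim exE conjE)
  have V: "forms.deg.subspace k V"
    using assms unfolding fin_dim_subspace_def forms.deg.subspace_def by (elim conjE) (intro conjI)
  then have BH: "B \<subseteq> HL M \<Omega> k" using B(2) unfolding forms.deg.subspace_def by blast
  define S where "S B = range (\<lambda>a. cls M \<Omega> k (\<lambda>c x is. \<Sum>b\<in>B. a b * rep b c x is))" for B
  have "forms.deg.fin_dim k (S B)"
    using B(1) BH
  proof (induction B rule: finite_induct)
    case empty
    have "S {} = {czero M \<Omega> k}" by (simp add: S_def czero_def)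
    then show ?case using forms.deg.fin_dim_zero by simp
  next
    case (insert b B)
    have bH: "b \<in> HL M \<Omega> k" using insert.prems by simp
    have lb: "l2_form M \<Omega> k (rep b)" by (rule cls_rep(2)[OF bH])
    have l2: "l2_form M \<Omega> k (\<lambda>c x is. \<Sum>b\<in>B. a b * rep b c x is)" for a
    proof -
      have "B \<subseteq> HL M \<Omega> k" using insert.prems by simp
      with insert.hyps(1) show ?thesis
      proof (induction B rule: finite_induct)
        case (insert b' B')
        have "l2_form M \<Omega> k (\<lambda>c x is. a b' * rep b' c x is + (\<Sum>b\<in>B'. a b * rep b c x is))"
          using insert by (intro l2_add l2_scale cls_rep(2)) auto
        then show ?case using insert.hyps by simp
      qed (simp add: l2_zero)
    qed
    have eq: "cadd M \<Omega> k (cls M \<Omega> k (\<lambda>c x is. \<Sum>b\<in>B. a b * rep b c x is)) (cscale M \<Omega> k r b) =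
        cls M \<Omega> k (\<lambda>c x is. \<Sum>b'\<in>insert b B. (a(b := r)) b' * rep b' c x is)" for a r
    proof -
      have sum_eq: "(\<Sum>b'\<in>B. (a(b := r)) b' * rep b' c x is) = (\<Sum>b\<in>B. a b * rep b c x is)" for c x "is"
        using insert.hyps(2) by (intro sum.cong) auto
      have "cscale M \<Omega> k r b = cls M \<Omega> k (\<lambda>c x is. r * rep b c x is)"
        using cscale_cls[OF lb, of r] cls_rep(1)[OF bH] by simp
      then have "cadd M \<Omega> k (cls M \<Omega> k (\<lambda>c x is. \<Sum>b\<in>B. a b * rep b c x is)) (cscale M \<Omega> k r b) =
          cls M \<Omega> k (\<lambda>c x is. (\<Sum>b\<in>B. a b * rep b c x is) + r * rep b c x is)"
        using cadd_cls[OF l2 l2_scale[OF lb]] by simp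
      also have "(\<lambda>c x is. (\<Sum>b\<in>B. a b * rep b c x is) + r * rep b c x is) =
          (\<lambda>c x is. \<Sum>b'\<in>insert b B. (a(b := r)) b' * rep b' c x is)"
        using insert.hyps sum_eq by (simp add: add.commute del: fun_upd_apply) simp
      finally show ?thesis .
    qed
    have "S (insert b B) = forms.deg.adjoin k (S B) b"
    proof
      show "S (insert b B) \<subseteq> forms.deg.adjoin k (S B) b"
      proof
        fix X assume "X \<in> S (insert b B)"
        then obtain a where a: "X = cls M \<Omega> k (\<lambda>c x is. \<Sum>b\<in>insert b B. a b * rep b c x is)"
          unfolding S_def by (elim rangeE)
        then have "X = cadd M \<Omega> k (cls M \<Omega> k (\<lambda>c x is. \<Sum>b\<in>B. a b * rep b c x is)) (cscale M \<Omega> k (a b) b)"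
          unfolding eq by simp
        then show "X \<in> forms.deg.adjoin k (S B) b"
          unfolding S_def by (simp only:) (rule forms.deg.adjoinI, rule rangeI)
      qed
      show "forms.deg.adjoin k (S B) b \<subseteq> S (insert b B)"
      proof
        fix X assume "X \<in> forms.deg.adjoin k (S B) b"
        then obtain a r where "X = cadd M \<Omega> k (cls M \<Omega> k (\<lambda>c x is. \<Sum>b\<in>B. a b * rep b c x is)) (cscale M \<Omega> k r b)"
          unfolding S_def by (elim forms.deg.adjoinE rangeE) (rule that, simp only:)
        then show "X \<in> S (insert b B)" unfolding eq S_def by (rule range_eqI[where x = "a(b := r)"])
      qed
    qed
    then show ?case using forms.deg.fin_dim_adjoin[OF insert.IH bH] insert.prems by simp
  qed
  moreover have "V \<subseteq> S B"
  proof
    fix X assume "X \<in> V"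
    then have "\<exists>a. X = cls M \<Omega> k (\<lambda>c x is. \<Sum>b\<in>B. a b * rep b c x is)" by (rule bspec[OF span])
    then obtain a where "X = cls M \<Omega> k (\<lambda>c x is. \<Sum>b\<in>B. a b * rep b c x is)" by (elim exE)
    then show "X \<in> S B" unfolding S_def by (rule range_eqI[where x = a])
  qed
  ultimately show ?thesis using forms.deg.fin_dim_subspace[OF _ V] by blast
qed

text \<open>For every \<open>e > 0\<close> there is a harmonic form \<open>y\<close> of the full complex with \<open>h - y\<close> of norm at most
\<open>e\<close> times the norm of \<open>h\<close>.  Replacing \<open>h\<close> by \<open>h - y\<close> does not change the inner product with
\<open>d \<psi>\<close>, which is therefore arbitrarily small.\<close>

lemma harmonic_orthogonal_of_gap_zero:
  assumes gap: "gap M \<Omega> (Suc k) (harmonic M \<Omega> (HL M \<Omega>) (Suc k)) Y = 0"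
    and Y: "Y \<subseteq> HL M \<Omega> (Suc k)" and h: "h \<in> Y" and \<psi>: "\<psi> \<in> HL M \<Omega> k"
  shows "l2_inner M \<Omega> (Suc k) h (ext_d M \<Omega> k \<psi>) = 0"
proof (cases "h = czero M \<Omega> (Suc k)")
  case True
  then show ?thesis using \<psi> by simp
next
  case False
  let ?X = "harmonic M \<Omega> (HL M \<Omega>) (Suc k)" and ?d = "ext_d M \<Omega> k \<psi>"
  have hH: "h \<in> HL M \<Omega> (Suc k)" using Y h by blast
  have dH: "?d \<in> HL M \<Omega> (Suc k)" using \<psi> by simp
  have "sub_delta M \<Omega> (Suc k) Y ?X = 0"
    using gap max.cobounded2[of "sub_delta M \<Omega> (Suc k) Y ?X" "sub_delta M \<Omega> (Suc k) ?X Y"]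
    unfolding gap_def by (simp add: max.commute)
  moreover have "(INF y\<in>?X. ennreal (H_norm M \<Omega> (Suc k) (cdiff M \<Omega> (Suc k) h y) / H_norm M \<Omega> (Suc k) h)) \<le> sub_delta M \<Omega> (Suc k) Y ?X"
    unfolding sub_delta_def by (rule SUP_upper2[of h]) (use h False in auto)
  ultimately have inf0: "(INF y\<in>?X. ennreal (H_norm M \<Omega> (Suc k) (cdiff M \<Omega> (Suc k) h y) / H_norm M \<Omega> (Suc k) h)) = 0"
    by simp
  have "0 < forms.deg.nrm (Suc k) h"
    using False hH forms.deg.eq_zero_iff[of h "Suc k"] forms.deg.ip_nonneg[of h "Suc k"]
    by (auto simp: forms.deg.nrm_def less_le)
  then have hpos: "0 < H_norm M \<Omega> (Suc k) h"
    using forms.nrm_le_graph_norm(1)[OF hH] unfolding H_norm_eq by linarith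
  let ?A = "H_norm M \<Omega> (Suc k) h * forms.deg.nrm (Suc k) ?d"
  have bound: "\<bar>l2_inner M \<Omega> (Suc k) h ?d\<bar> \<le> e * ?A" if e: "0 < e" for e
  proof -
    have "(INF y\<in>?X. ennreal (H_norm M \<Omega> (Suc k) (cdiff M \<Omega> (Suc k) h y) / H_norm M \<Omega> (Suc k) h)) < ennreal e"
      using inf0 e by simp
    then obtain y where y: "y \<in> ?X" "ennreal (H_norm M \<Omega> (Suc k) (cdiff M \<Omega> (Suc k) h y) / H_norm M \<Omega> (Suc k) h) < ennreal e"
      unfolding INF_less_iff by blast
    have yH: "y \<in> HL M \<Omega> (Suc k)" using y(1) by (simp add: harmonic_def cocycles_def)
    have "H_norm M \<Omega> (Suc k) (cdiff M \<Omega> (Suc k) h y) / H_norm M \<Omega> (Suc k) h < e"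
      using y(2) e by (simp add: ennreal_less_iff H_norm_def)
    then have close: "H_norm M \<Omega> (Suc k) (cdiff M \<Omega> (Suc k) h y) \<le> e * H_norm M \<Omega> (Suc k) h"
      using hpos by (simp add: pos_divide_less_eq)
    have "l2_inner M \<Omega> (Suc k) y ?d = 0"
      using y(1) \<psi> by (simp add: harmonic_def coboundaries_def)
    then have "l2_inner M \<Omega> (Suc k) h ?d = l2_inner M \<Omega> (Suc k) (forms.deg.minus (Suc k) h y) ?d"
      using forms.deg.ip_minus_left[OF hH yH dH] by linarith
    then have "\<bar>l2_inner M \<Omega> (Suc k) h ?d\<bar> \<le> forms.deg.nrm (Suc k) (forms.deg.minus (Suc k) h y) * forms.deg.nrm (Suc k) ?d"
      using forms.deg.abs_ip_le[OF forms.deg.minus_closed[OF hH yH] dH] by simp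
    also have "\<dots> \<le> (e * H_norm M \<Omega> (Suc k) h) * forms.deg.nrm (Suc k) ?d"
      using close forms.nrm_le_graph_norm(1)[OF forms.deg.minus_closed[OF hH yH]] forms.deg.nrm_nonneg[OF dH]
      unfolding H_norm_eq cdiff_eq_minus[OF hH yH] by (intro mult_right_mono) linarith+
    finally show ?thesis by (simp only: mult.assoc)
  qed
  have A: "0 \<le> ?A" using hpos forms.deg.nrm_nonneg[OF dH] by simp
  show ?thesis
  proof (rule ccontr)
    assume ne: "l2_inner M \<Omega> (Suc k) h ?d \<noteq> 0"
    (* A may vanish, so A + 1 is used to keep the denominator positive *)
    define e where "e = \<bar>l2_inner M \<Omega> (Suc k) h ?d\<bar> / (2 * (?A + 1))"
    have "0 < e" using ne A by (simp add: e_def)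
    then have "\<bar>l2_inner M \<Omega> (Suc k) h ?d\<bar> \<le> e * ?A" by (rule bound)
    also have "\<dots> \<le> e * (?A + 1)" using \<open>0 < e\<close> by simp
    also have "\<dots> = \<bar>l2_inner M \<Omega> (Suc k) h ?d\<bar> / 2" unfolding e_def using A by (simp add: field_simps)
    finally show False using ne by simp
  qed
qed

end

section \<open>The bounded cochain projectors\<close>

theorem theorem6p1:
  fixes M :: "('m, 'n::finite) riem_mfd"
    and \<Omega> :: "'m set"
    and V W :: "nat \<Rightarrow> ('m, 'n) fclass set"
    and PC :: "nat \<Rightarrow> ('m, 'n) fclass \<Rightarrow> ('m, 'n) fclass"
  assumes "riemannian_manifold M"
    and "lipschitz_domain M \<Omega>"
    and "\<not> contractible_space (subtopology (mtop M) \<Omega>)"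
    and "de_rham_subcomplex M \<Omega> V"
    and "de_rham_subcomplex M \<Omega> W"
    and "\<And>k. V k \<subseteq> W k"
    and "\<And>k. gap M \<Omega> k (harmonic M \<Omega> (HL M \<Omega>) k) (harmonic M \<Omega> W k) = 0"
    and "canonical_projector M \<Omega> W V PC"
  defines "P \<equiv> mixed_proj M \<Omega> W"
  defines "Q \<equiv> \<lambda>k \<phi>. PC k (P k \<phi>)"
  shows "(\<forall>k. linear_on_forms M \<Omega> k (HL M \<Omega> k) (Q k) \<and>
              (\<forall>\<phi>\<in>HL M \<Omega> k. Q k (Q k \<phi>) = Q k \<phi>) \<and>
              Q k ` HL M \<Omega> k = V k \<and>
              (\<exists>C>0. \<forall>\<phi>\<in>HL M \<Omega> k. H_norm M \<Omega> k (Q k \<phi>) \<le> C * H_norm M \<Omega> k \<phi>) \<and>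
              (\<forall>\<phi>\<in>HL M \<Omega> k. ext_d M \<Omega> k (Q k \<phi>) = Q (Suc k) (ext_d M \<Omega> k \<phi>))) \<and>
         (\<forall>k. P k ` HL M \<Omega> k \<subseteq> W k \<and>
              (\<forall>\<phi>\<in>HL M \<Omega> k. ext_d M \<Omega> k (P k \<phi>) = P (Suc k) (ext_d M \<Omega> k \<phi>)) \<and>
              (\<forall>\<phi>\<in>W k. ext_d M \<Omega> k (PC k \<phi>) = PC (Suc k) (ext_d M \<Omega> k \<phi>)))"
proof -
  interpret riem_domain M \<Omega>
    using assms(1,2) by unfold_locales (auto simp: lipschitz_domain_def)
  interpret W: fin_dim_subcomplex "HL M \<Omega>" "cadd M \<Omega>" "cscale M \<Omega>" "czero M \<Omega>" "l2_inner M \<Omega>" "ext_d M \<Omega>" W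
  proof
    show "forms.deg.fin_dim k (W k)" for k
      using assms(5) unfolding de_rham_subcomplex_def by (intro fin_dim_subspace_imp_fin_dim) blast
    show "ext_d M \<Omega> k x \<in> W (Suc k)" if "x \<in> W k" for x k
      using assms(5) that unfolding de_rham_subcomplex_def by blast
  qed
  have harm: "harmonic M \<Omega> W (Suc k) = W.harm k" for k
    unfolding W.harm_def W.Z_def W.B_def harmonic_def cocycles_def coboundaries_def by simp
  have system: "mixed_system M \<Omega> W k \<phi> l0 l1 l2 h = W.mixed k \<phi> l0 l1 l2 h" for k \<phi> l0 l1 l2 h
    unfolding mixed_system_def W.mixed_def by (simp add: harm)
  have gal: "W.galerkin k \<phi> (P k \<phi>)" if "\<phi> \<in> HL M \<Omega> k" for k \<phi>
  proof -
    have "P k \<phi> = (THE l. W.galerkin k \<phi> l)"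
      unfolding P_def mixed_proj_def system W.ex_mixed_iff_galerkin[OF that] ..
    moreover have "\<exists>!l. W.galerkin k \<phi> l"
      using W.galerkin_exists[OF that] W.galerkin_unique by blast
    ultimately show ?thesis using theI'[of "W.galerkin k \<phi>"] by simp
  qed
  have P_eq: "P k \<phi> = l" if "W.galerkin k \<phi> l" "\<phi> \<in> HL M \<Omega> k" for k \<phi> l
    using W.galerkin_unique[OF gal[OF that(2)] that(1)] .
  have P_W: "P k \<phi> \<in> W k" if "\<phi> \<in> HL M \<Omega> k" for k \<phi>
    using gal[OF that] by (simp add: W.galerkin_def)
  have P_id: "P k \<phi> = \<phi>" if "\<phi> \<in> W k" for k \<phi>
    using that by (intro P_eq W.galerkin_id) auto
  have P_add: "P k (cadd M \<Omega> k \<phi> \<psi>) = cadd M \<Omega> k (P k \<phi>) (P k \<psi>)" if "\<phi> \<in> HL M \<Omega> k" "\<psi> \<in> HL M \<Omega> k" for k \<phi> \<psi>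
    using that by (intro P_eq W.galerkin_add gal) auto
  have P_scale: "P k (cscale M \<Omega> k a \<phi>) = cscale M \<Omega> k a (P k \<phi>)" if "\<phi> \<in> HL M \<Omega> k" for k a \<phi>
    using that by (intro P_eq W.galerkin_scale gal) auto
  have P_d: "ext_d M \<Omega> k (P k \<phi>) = P (Suc k) (ext_d M \<Omega> k \<phi>)" if \<phi>: "\<phi> \<in> HL M \<Omega> k" for k \<phi>
  proof -
    have "l2_inner M \<Omega> (Suc k) h (ext_d M \<Omega> k \<psi>) = 0" if "h \<in> W.harm k" "\<psi> \<in> HL M \<Omega> k" for h \<psi>
    proof (rule harmonic_orthogonal_of_gap_zero[OF assms(7)])
      show "harmonic M \<Omega> W (Suc k) \<subseteq> HL M \<Omega> (Suc k)" unfolding harm W.harm_def by auto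
    qed (use that harm in auto)
    then have "W.galerkin (Suc k) (ext_d M \<Omega> k \<phi>) (ext_d M \<Omega> k (P k \<phi>))"
      by (intro W.galerkin_commutes gal \<phi>)
    then show ?thesis using \<phi> by (intro P_eq[symmetric]) auto
  qed
  have PC_linear: "linear_on_forms M \<Omega> k (W k) (PC k)" for k
    using assms(8) unfolding canonical_projector_def by blast
  have PC_add: "PC k (cadd M \<Omega> k X Y) = cadd M \<Omega> k (PC k X) (PC k Y)" if "X \<in> W k" "Y \<in> W k" for k X Y
    using PC_linear[of k] that unfolding linear_on_forms_def by blast
  have PC_scale: "PC k (cscale M \<Omega> k a X) = cscale M \<Omega> k a (PC k X)" if "X \<in> W k" for k a X
    using PC_linear[of k] that unfolding linear_on_forms_def by blast
  have PC_image: "PC k ` W k = V k" for k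
    using assms(8) unfolding canonical_projector_def by blast
  have PC_idem: "PC k (PC k X) = PC k X" if "X \<in> W k" for k X
    using assms(8) that unfolding canonical_projector_def by blast
  have PC_d: "ext_d M \<Omega> k (PC k X) = PC (Suc k) (ext_d M \<Omega> k X)" if "X \<in> W k" for k X
    using assms(8) that unfolding canonical_projector_def by blast
  have PC_W: "PC k X \<in> W k" if "X \<in> W k" for k X
    using PC_image[of k] assms(6)[of k] that by blast
  have PC_id: "PC k X = X" if "X \<in> V k" for k X
    using that PC_idem unfolding PC_image[of k, symmetric] by auto
  have Q_V: "Q k \<phi> \<in> V k" if "\<phi> \<in> HL M \<Omega> k" for k \<phi>
    using P_W[OF that] PC_image unfolding Q_def by blast
  have Q_id: "Q k \<phi> = \<phi>" if "\<phi> \<in> V k" for k \<phi>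
    using P_id[of \<phi> k] PC_id[OF that] assms(6)[of k] that unfolding Q_def by auto
  have V_H: "X \<in> HL M \<Omega> k" if "X \<in> V k" for k X
    using assms(6)[of k] that W.W_H by blast
  have Q_bounded: "\<exists>C>0. \<forall>\<phi>\<in>HL M \<Omega> k. H_norm M \<Omega> k (Q k \<phi>) \<le> C * H_norm M \<Omega> k \<phi>" for k
  proof -
    have "\<exists>C>0. \<forall>\<phi> l. \<phi> \<in> HL M \<Omega> k \<longrightarrow> W.galerkin k \<phi> l \<longrightarrow> H_norm M \<Omega> k (PC k l) \<le> C * forms.graph_norm k \<phi>"
    proof (rule W.galerkin_bounded)
      fix X Y assume XY: "X \<in> W k" "Y \<in> W k"
      show "H_norm M \<Omega> k (PC k (cadd M \<Omega> k X Y)) \<le> H_norm M \<Omega> k (PC k X) + H_norm M \<Omega> k (PC k Y)"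
        unfolding PC_add[OF XY] H_norm_eq
        by (rule forms.graph_norm_add_le[OF W.W_H[OF PC_W[OF XY(1)]] W.W_H[OF PC_W[OF XY(2)]]])
    next
      fix a X assume X: "X \<in> W k"
      show "H_norm M \<Omega> k (PC k (cscale M \<Omega> k a X)) = \<bar>a\<bar> * H_norm M \<Omega> k (PC k X)"
        unfolding PC_scale[OF X] H_norm_eq by (rule forms.graph_norm_scale[OF W.W_H[OF PC_W[OF X]]])
    qed
    then show ?thesis using gal unfolding Q_def H_norm_eq by blast
  qed
  show ?thesis
  proof (intro conjI allI)
    fix k
    show "linear_on_forms M \<Omega> k (HL M \<Omega> k) (Q k)"
      unfolding linear_on_forms_def Q_def by (simp add: P_add P_scale PC_add PC_scale P_W)
    show "\<forall>\<phi>\<in>HL M \<Omega> k. Q k (Q k \<phi>) = Q k \<phi>" using Q_V Q_id by blast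
    show "Q k ` HL M \<Omega> k = V k" using Q_V Q_id V_H by (metis image_eqI image_subsetI subsetI subset_antisym)
    show "\<exists>C>0. \<forall>\<phi>\<in>HL M \<Omega> k. H_norm M \<Omega> k (Q k \<phi>) \<le> C * H_norm M \<Omega> k \<phi>" by (rule Q_bounded)
    show "\<forall>\<phi>\<in>HL M \<Omega> k. ext_d M \<Omega> k (Q k \<phi>) = Q (Suc k) (ext_d M \<Omega> k \<phi>)"
      unfolding Q_def by (simp add: PC_d P_W P_d)
    show "P k ` HL M \<Omega> k \<subseteq> W k" using P_W by blast
    show "\<forall>\<phi>\<in>HL M \<Omega> k. ext_d M \<Omega> k (P k \<phi>) = P (Suc k) (ext_d M \<Omega> k \<phi>)" using P_d by blast
    show "\<forall>\<phi>\<in>W k. ext_d M \<Omega> k (PC k \<phi>) = PC (Suc k) (ext_d M \<Omega> k \<phi>)" using PC_d by blast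
  qed
qed

end
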